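(* Assume $\mathbb{E}(|\nu_v|^{2+\varepsilon}+|\omega_e|^{2+\varepsilon})<\infty$ for some $\varepsilon>0$. Let $U(\mathfrak{m})$ denote the number of unpaired vertices in a matching $\mathfrak{m}$ chosen from the Gibbs measure $\mu$. (i) There exists a constant $u\in[0,1]$, depending on the distributions of the edge weights $\omega$ and the vertex weights $\nu$, such that $n^{-1}\langle U\rangle_n\to u$ in probability as $n\to\infty$. (ii) There exist constants $\sigma_Q\in(0,\infty)$ and $\sigma_A\in[0,\infty)$, depending on the distributions of $\omega$ and $\nu$, such that, as $n\to\infty$, $$n^{-1}\bigl(\langle U^2\rangle_n-\langle U\rangle_n^2\bigr)\to\sigma_Q^2\ \text{ in probability}\qquad\text{and}\qquad n^{-1}\operatorname{Var}(\langle U\rangle_n)\to\sigma_A^2 .$$ (iii) Moreover, let the edge and vertex weights be compactly supported and let $d_{\max}$ denote the maximal degree of $\mathcal{G}_n$. If $\omega_e-2\nu_v<-\log d_{\max}$ almost surely, then $\sigma_A>0$.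
   Context: Let $H=(V_H,E_H)$ be a fixed finite graph with $|V_H|=h$, and let $G_n$ be the line graph (path) on the $n$ vertices $1,\dots,n$ with $i\sim i+1$. The cylinder graph $\mathcal{G}_n=G_n\times H$ is the Cartesian product: its vertex set is $V=\{1,\dots,n\}\times V_H$, and $(i,j)\sim(i',j')$ iff either $i\sim i'$ in $G_n$ and $j=j'$, or $i=i'$ and $j\sim j'$ in $H$. Let $E$ be its edge set. The vertex weights $\{\nu_v\}_{v\in V}$ are i.i.d. real-valued random variables; the edge weights $\{\omega_e\}_{e\in E}$ are i.i.d. real-valued random variables, independent of the vertex weights, not necessarily with the same distribution; the two distributions do not depend on $n$. A matching $\mathfrak{m}\subseteq E$ is a (possibly empty) set of pairwise vertex-disjoint edges; $\mathcal{M}$ is the set of all matchings of $\mathcal{G}_n$; $v\notin\mathfrak{m}$ ($v$ is unpaired) means that $v$ is not covered by any edge of $\mathfrak{m}$. The Hamiltonian is $\mathcal{H}(\mathfrak{m})=\sum_{v\notin\mathfrak{m}}\nu_v+\sum_{e\in\mathfrak{m}}\omega_e$, the partition function is $Z_n=\sum_{\mathfrak{m}\in\mathcal{M}}\exp(\mathcal{H}(\mathfrak{m}))$, and the (random) Gibbs measure is $\mu(\mathfrak{m})=Z_n^{-1}\exp(\mathcal{H}(\mathfrak{m}))$. For $X:\mathcal{M}\to\mathbb{R}$, $\langle X\rangle_n=\sum_{\mathfrak{m}\in\mathcal{M}}X(\mathfrak{m})\mu(\mathfrak{m})$ is its Gibbs average, a random variable depending on the weights. $\operatorname{Var}(\langle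 U\rangle_n)$ and convergence in probability refer to the randomness of the weights.
   Formalization: The range u∈[0,1] is corrected to u∈[0,h], since with normalisation 1/n the limit can exceed 1 when h≥2; in (iii) it is additionally assumed that the vertex and edge weights are not both almost surely constant, since otherwise Var(⟨U⟩_n)=0 and σ_A=0. *)

theory Defs
  imports "HOL-Probability.Probability"
begin

text \<open>A finite simple graph is a pair of a finite vertex set and a set of edges, an edge being the
  two-element set of its endpoints.\<close>

definition simple_graph :: "'v set \<Rightarrow> 'v set set \<Rightarrow> bool" where
  "simple_graph V E \<longleftrightarrow> finite V \<and> (\<forall>e\<in>E. e \<subseteq> V \<and> card e = 2)"

definition max_degree :: "'v set \<Rightarrow> 'v set set \<Rightarrow> nat" where
  "max_degree V E = Max ((\<lambda>v. card {e \<in> E. v \<in> e}) ` V)"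

definition path_edges :: "nat \<Rightarrow> nat set set" where
  "path_edges n = {{i, Suc i} | i. 1 \<le> i \<and> i < n}"

definition cartesian_edges ::
  "'a set \<Rightarrow> 'a set set \<Rightarrow> 'b set \<Rightarrow> 'b set set \<Rightarrow> ('a \<times> 'b) set set" where
  "cartesian_edges V\<^sub>1 E\<^sub>1 V\<^sub>2 E\<^sub>2 =
     {{(i, j), (i', j')} | i j i' j'.
        i \<in> V\<^sub>1 \<and> i' \<in> V\<^sub>1 \<and> j \<in> V\<^sub>2 \<and> j' \<in> V\<^sub>2 \<and>
        ({i, i'} \<in> E\<^sub>1 \<and> j = j' \<or> i = i' \<and> {j, j'} \<in> E\<^sub>2)}"

definition cyl_verts :: "'a set \<Rightarrow> nat \<Rightarrow> (nat \<times> 'a) set" where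
  "cyl_verts VH n = {1..n} \<times> VH"

definition cyl_edges :: "'a set \<Rightarrow> 'a set set \<Rightarrow> nat \<Rightarrow> (nat \<times> 'a) set set" where
  "cyl_edges VH EH n = cartesian_edges {1..n} (path_edges n) VH EH"

definition matchings :: "'v set set \<Rightarrow> 'v set set set" where
  "matchings E = {m. m \<subseteq> E \<and> disjoint m}"

definition unpaired :: "'v set \<Rightarrow> 'v set set \<Rightarrow> 'v set" where
  "unpaired V m = V - \<Union>m"

definition hamiltonian ::
  "'v set \<Rightarrow> ('v \<Rightarrow> real) \<Rightarrow> ('v set \<Rightarrow> real) \<Rightarrow> 'v set set \<Rightarrow> real" where
  "hamiltonian V \<nu> \<omega> m = (\<Sum>v\<in>unpaired V m. \<nu> v) + (\<Sum>e\<in>m. \<omega> e)"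

definition partition_function ::
  "'v set \<Rightarrow> 'v set set \<Rightarrow> ('v \<Rightarrow> real) \<Rightarrow> ('v set \<Rightarrow> real) \<Rightarrow> real" where
  "partition_function V E \<nu> \<omega> = (\<Sum>m\<in>matchings E. exp (hamiltonian V \<nu> \<omega> m))"

definition gibbs ::
  "'v set \<Rightarrow> 'v set set \<Rightarrow> ('v \<Rightarrow> real) \<Rightarrow> ('v set \<Rightarrow> real) \<Rightarrow> 'v set set \<Rightarrow> real" where
  "gibbs V E \<nu> \<omega> m = exp (hamiltonian V \<nu> \<omega> m) / partition_function V E \<nu> \<omega>"

definition gibbs_average ::
  "'v set \<Rightarrow> 'v set set \<Rightarrow> ('v \<Rightarrow> real) \<Rightarrow> ('v set \<Rightarrow> real) \<Rightarrow> ('v set set \<Rightarrow> real) \<Rightarrow> real" where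
  "gibbs_average V E \<nu> \<omega> X = (\<Sum>m\<in>matchings E. X m * gibbs V E \<nu> \<omega> m)"

definition num_unpaired :: "'v set \<Rightarrow> 'v set set \<Rightarrow> real" where
  "num_unpaired V m = real (card (unpaired V m))"

definition U_mean ::
  "'v set \<Rightarrow> 'v set set \<Rightarrow> ('v \<Rightarrow> real) \<Rightarrow> ('v set \<Rightarrow> real) \<Rightarrow> real" where
  "U_mean V E \<nu> \<omega> = gibbs_average V E \<nu> \<omega> (num_unpaired V)"

definition U_quenched_var ::
  "'v set \<Rightarrow> 'v set set \<Rightarrow> ('v \<Rightarrow> real) \<Rightarrow> ('v set \<Rightarrow> real) \<Rightarrow> real" where
  "U_quenched_var V E \<nu> \<omega> =
     gibbs_average V E \<nu> \<omega> (\<lambda>m. (num_unpaired V m)\<^sup>2)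
       - (gibbs_average V E \<nu> \<omega> (num_unpaired V))\<^sup>2"

text \<open>On the probability space \<open>M\<close>, the vertex weights have common law \<open>N\<close>, the edge
  weights have common law \<open>W\<close>, and all weights are jointly independent. The joint family is indexed
  by the disjoint sum of \<open>V\<close> and \<open>E\<close>.\<close>

definition random_weights ::
  "real measure \<Rightarrow> real measure \<Rightarrow> 'v set \<Rightarrow> 'v set set \<Rightarrow>
   'w measure \<Rightarrow> ('v \<Rightarrow> 'w \<Rightarrow> real) \<Rightarrow> ('v set \<Rightarrow> 'w \<Rightarrow> real) \<Rightarrow> bool" where
  "random_weights N W V E M \<nu> \<omega> \<longleftrightarrow>
     prob_space M \<and>
     prob_space.indep_vars M (\<lambda>_. borel) (case_sum \<nu> \<omega>) (V <+> E) \<and>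
     (\<forall>v\<in>V. distr M borel (\<nu> v) = N) \<and>
     (\<forall>e\<in>E. distr M borel (\<omega> e) = W)"

text \<open>Convergence in probability to a constant; the \<open>n\<close>-th variable may live on its own
  probability space, as there is no coupling between different \<open>n\<close>.\<close>

definition tendsto_in_prob ::
  "(nat \<Rightarrow> 'w measure) \<Rightarrow> (nat \<Rightarrow> 'w \<Rightarrow> real) \<Rightarrow> real \<Rightarrow> bool" where
  "tendsto_in_prob M X c \<longleftrightarrow>
     (\<forall>\<delta>>0. (\<lambda>n. measure (M n) {x \<in> space (M n). \<bar>X n x - c\<bar> > \<delta>}) \<longlonglongrightarrow> 0)"

definition compactly_supported :: "real measure \<Rightarrow> bool" where
  "compactly_supported D \<longleftrightarrow> (\<exists>K. compact K \<and> (AE x in D. x \<in> K))"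

definition degenerate :: "real measure \<Rightarrow> bool" where
  "degenerate D \<longleftrightarrow> (\<exists>c. AE x in D. x = c)"

text \<open>A sequence of weights, one realisation (probability space, vertex weights, edge weights) for
  each cylinder of length \<open>n \<ge> 1\<close>, always with the same two laws.\<close>

definition cylinder_weights ::
  "'a set \<Rightarrow> 'a set set \<Rightarrow> real measure \<Rightarrow> real measure \<Rightarrow> (nat \<Rightarrow> 'w measure) \<Rightarrow>
   (nat \<Rightarrow> nat \<times> 'a \<Rightarrow> 'w \<Rightarrow> real) \<Rightarrow> (nat \<Rightarrow> (nat \<times> 'a) set \<Rightarrow> 'w \<Rightarrow> real) \<Rightarrow> bool" where
  "cylinder_weights VH EH N W M \<nu> \<omega> \<longleftrightarrow>
     (\<forall>n\<ge>1. random_weights N W (cyl_verts VH n) (cyl_edges VH EH n) (M n) (\<nu> n) (\<omega> n))"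

definition cyl_U_mean ::
  "'a set \<Rightarrow> 'a set set \<Rightarrow> (nat \<Rightarrow> nat \<times> 'a \<Rightarrow> 'w \<Rightarrow> real) \<Rightarrow>
   (nat \<Rightarrow> (nat \<times> 'a) set \<Rightarrow> 'w \<Rightarrow> real) \<Rightarrow> nat \<Rightarrow> 'w \<Rightarrow> real" where
  "cyl_U_mean VH EH \<nu> \<omega> n x =
     U_mean (cyl_verts VH n) (cyl_edges VH EH n) (\<lambda>v. \<nu> n v x) (\<lambda>e. \<omega> n e x)"

definition cyl_U_quenched_var ::
  "'a set \<Rightarrow> 'a set set \<Rightarrow> (nat \<Rightarrow> nat \<times> 'a \<Rightarrow> 'w \<Rightarrow> real) \<Rightarrow>
   (nat \<Rightarrow> (nat \<times> 'a) set \<Rightarrow> 'w \<Rightarrow> real) \<Rightarrow> nat \<Rightarrow> 'w \<Rightarrow> real" where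
  "cyl_U_quenched_var VH EH \<nu> \<omega> n x =
     U_quenched_var (cyl_verts VH n) (cyl_edges VH EH n) (\<lambda>v. \<nu> n v x) (\<lambda>e. \<omega> n e x)"

text \<open>The maximal degree of the cylinder is the constant \<open>2 + max_degree VH EH\<close> from \<open>n = 3\<close> on
  and smaller before, hence the condition is imposed for all large \<open>n\<close>.\<close>

definition small_edge_weights ::
  "'a set \<Rightarrow> 'a set set \<Rightarrow> (nat \<Rightarrow> 'w measure) \<Rightarrow>
   (nat \<Rightarrow> nat \<times> 'a \<Rightarrow> 'w \<Rightarrow> real) \<Rightarrow> (nat \<Rightarrow> (nat \<times> 'a) set \<Rightarrow> 'w \<Rightarrow> real) \<Rightarrow> bool" where
  "small_edge_weights VH EH M \<nu> \<omega> \<longleftrightarrow>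
     (\<forall>\<^sub>F n in sequentially. \<forall>e\<in>cyl_edges VH EH n. \<forall>v\<in>cyl_verts VH n.
        AE x in M n. \<omega> n e x - 2 * \<nu> n v x
          < - ln (real (max_degree (cyl_verts VH n) (cyl_edges VH EH n))))"

end

theory Submission
  imports Defs
begin

text \<open>
  Absorb the vertex weights into the edges by \<open>w(uv) = exp (\<omega>(uv) - \<nu>(u) - \<nu>(v))\<close>; then
  \<open>U = |V| - 2 |m|\<close> and only the Gibbs mean \<open>f(A)\<close> and variance \<open>V(A)\<close> of the number \<open>|m|\<close> of edges
  of a matching inside the vertex set \<open>A\<close> matter. Conditioning on the partner of a vertex \<open>v\<close> shows by
  induction that \<open>D = f(A) - f(A - v)\<close> lies in \<open>[0, 1]\<close> and \<open>|V(A) - V(A - v)| \<le> D (1 - D)\<close>, whatever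
  the weights are. Deleting one column of the cylinder therefore changes both quantities by a bounded
  amount only and splits it into two independent cylinders: each quantity is, up to a bounded error, a
  sum of two independent copies for the shorter cylinders. Hence the means are additive up to
  \<open>O(1)\<close> and the variances up to \<open>O(\<surd>n)\<close>, and dividing by \<open>n\<close> both converge.

  The constant \<open>\<sigma>\<^sub>Q\<close> is positive because a matching of edges spread along the cylinder carries
  orthogonal local variables, each correlated with \<open>|m|\<close>. For \<open>\<sigma>\<^sub>A\<close>, the
  smallness of the edge weights makes \<open>\<langle>U\<rangle>\<close> strictly monotone, with slope bounded away from zero, in
  every vertex weight and in every edge weight; its covariance with the sum of the vertex (or edge)
  weights is then of order \<open>n\<close>, and Cauchy-Schwarz applies.
\<close>

section \<open>Weighted matchings of a finite graph\<close>

text \<open>Uniformity in the weights is what drives the argument: whatever the realisation,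
  deleting a column of vertices moves the mean and the variance of the edge count by at most its
  number of vertices. Passing to variances over the weights produces a cross term that is controlled
  only by the standard deviation itself. A linear bound on these variances must therefore come
  before the error can be called O(sqrt n). Both steps split an interval into nearly equal halves,
  where the square root gains a fixed factor. Weights for different lengths live on unrelated
  probability spaces, so every statistic is transported to one product measure on an infinite strip,
  on which translations act.

  For \<open>\<sigma>\<^sub>A\<close> the hypothesis is a threshold. Averaged over the two ends of
  an edge, it bounds the absorbed weight by one over the maximal degree, so the weights at a vertex
  sum to at most 1 and a vertex is free with probability at least 1/2. Forcing an edge gains one
  edge and costs at most the coverage probabilities of its two ends; the strict margin comes from
  the edge's own weight, absent once that edge is switched off.\<close>

definition induced :: "'v set set \<Rightarrow> 'v set \<Rightarrow> 'v set set" where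
  "induced E A = {e \<in> E. e \<subseteq> A}"

text \<open>A general \<open>g\<close> makes the partition function and the first two moments of the
  edge count instances of one object, so that each combinatorial identity is proved once.\<close>

definition matching_sum :: "'v set set \<Rightarrow> ('v set \<Rightarrow> real) \<Rightarrow> (nat \<Rightarrow> real) \<Rightarrow> 'v set \<Rightarrow> real" where
  "matching_sum E w g A = (\<Sum>m\<in>matchings (induced E A). g (card m) * (\<Prod>e\<in>m. w e))"

definition matching_Z :: "'v set set \<Rightarrow> ('v set \<Rightarrow> real) \<Rightarrow> 'v set \<Rightarrow> real" where
  "matching_Z E w A = matching_sum E w (\<lambda>_. 1) A"

definition edge_mean :: "'v set set \<Rightarrow> ('v set \<Rightarrow> real) \<Rightarrow> 'v set \<Rightarrow> real" where
  "edge_mean E w A = matching_sum E w real A / matching_Z E w A"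

definition edge_var :: "'v set set \<Rightarrow> ('v set \<Rightarrow> real) \<Rightarrow> 'v set \<Rightarrow> real" where
  "edge_var E w A = matching_sum E w (\<lambda>k. (real k)\<^sup>2) A / matching_Z E w A - (edge_mean E w A)\<^sup>2"

lemma matching_edges_eq: "m \<in> matchings F \<Longrightarrow> a \<in> m \<Longrightarrow> b \<in> m \<Longrightarrow> a \<inter> b \<noteq> {} \<Longrightarrow> a = b"
  by (auto simp: matchings_def disjoint_def)

definition incident :: "'v set set \<Rightarrow> 'v set \<Rightarrow> 'v \<Rightarrow> 'v set set" where
  "incident E A v = {e \<in> E. v \<in> e \<and> e \<subseteq> A}"

lemma finite_incident: "finite A \<Longrightarrow> finite (incident E A v)"
  by (rule finite_subset[of _ "Pow A"]) (auto simp: incident_def)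

lemma finite_induced: "finite A \<Longrightarrow> finite (induced E A)"
  by (rule finite_subset[of _ "Pow A"]) (auto simp: induced_def)

lemma finite_matchings: "finite E \<Longrightarrow> finite (matchings E)"
  by (rule finite_subset[of _ "Pow E"]) (auto simp: matchings_def)

lemma finite_matching: "finite A \<Longrightarrow> m \<in> matchings (induced E A) \<Longrightarrow> finite m"
  using finite_induced finite_subset unfolding matchings_def by blast

lemma induced_mono: "B \<subseteq> A \<Longrightarrow> induced E B \<subseteq> induced E A"
  by (auto simp: induced_def)

lemma matchings_mono: "E \<subseteq> E' \<Longrightarrow> matchings E \<subseteq> matchings E'"
  by (auto simp: matchings_def)

lemma matching_sum_add:
  "matching_sum E w (\<lambda>k. g k + h k) A = matching_sum E w g A + matching_sum E w h A"
  by (simp add: matching_sum_def algebra_simps sum.distrib)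

lemma matching_sum_cmult:
  "matching_sum E w (\<lambda>k. c * g k) A = c * matching_sum E w g A"
  by (simp add: matching_sum_def algebra_simps sum_distrib_left)

lemma matching_sum_cong:
  "(\<And>e. e \<in> E \<Longrightarrow> e \<subseteq> A \<Longrightarrow> w e = w' e) \<Longrightarrow> matching_sum E w g A = matching_sum E w' g A"
  unfolding matching_sum_def
  by (intro sum.cong arg_cong2[where f="(*)"] prod.cong refl) (auto simp: matchings_def induced_def)

lemma edge_mean_cong:
  "(\<And>e. e \<in> E \<Longrightarrow> e \<subseteq> A \<Longrightarrow> w e = w' e) \<Longrightarrow> edge_mean E w A = edge_mean E w' A"
  unfolding edge_mean_def matching_Z_def by (metis matching_sum_cong)

lemma edge_var_cong:
  "(\<And>e. e \<in> E \<Longrightarrow> e \<subseteq> A \<Longrightarrow> w e = w' e) \<Longrightarrow> edge_var E w A = edge_var E w' A"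
  unfolding edge_var_def matching_Z_def by (metis matching_sum_cong edge_mean_cong)

text \<open>Intended for translations of the strip. These are injective but not onto, and the second
  assumption is an equivalence so that the edges inside the image of \<open>A\<close> are exactly
  the images of the edges inside \<open>A\<close>.\<close>

lemma matching_sum_image:
  assumes "inj \<phi>" and "\<And>e. \<phi> ` e \<in> E \<longleftrightarrow> e \<in> E"
  shows "matching_sum E w g (\<phi> ` A) = matching_sum E (\<lambda>e. w (\<phi> ` e)) g A"
proof -
  have inj1: "inj ((`) \<phi>)" by (rule injI) (simp add: inj_image_eq_iff[OF assms(1)])
  have inj2: "inj ((`) ((`) \<phi>))" by (rule injI) (simp add: inj_image_eq_iff[OF inj1])
  note inj = inj1 inj2
  have ind: "induced E (\<phi> ` A) = (`) \<phi> ` induced E A"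
    using assms by (auto simp: induced_def image_iff subset_image_iff inj_image_eq_iff)
  have "matchings (induced E (\<phi> ` A)) = (`) ((`) \<phi>) ` matchings (induced E A)"
  proof (intro equalityI subsetI)
    fix m assume m: "m \<in> matchings (induced E (\<phi> ` A))"
    then obtain m' where m': "m' \<subseteq> induced E A" "m = (`) \<phi> ` m'"
      by (auto simp: matchings_def ind subset_image_iff)
    have "disjoint m'"
      unfolding disjoint_def
    proof (intro ballI impI)
      fix a b assume "a \<in> m'" "b \<in> m'" "a \<noteq> b"
      then have "\<phi> ` a \<inter> \<phi> ` b = {}"
        using m m' assms(1) by (auto simp: matchings_def disjoint_def inj_image_eq_iff)
      then show "a \<inter> b = {}" by auto
    qed
    then show "m \<in> (`) ((`) \<phi>) ` matchings (induced E A)"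
      using m' by (auto simp: matchings_def)
  next
    fix m assume "m \<in> (`) ((`) \<phi>) ` matchings (induced E A)"
    then obtain m' where m': "m' \<subseteq> induced E A" "disjoint m'" "m = (`) \<phi> ` m'"
      by (auto simp: matchings_def)
    have "disjoint m"
      using m'(2) assms(1) unfolding m'(3) disjoint_def
      by (auto simp: image_Int[symmetric] inj_image_eq_iff; blast dest: injD)
    then show "m \<in> matchings (induced E (\<phi> ` A))"
      using m' by (auto simp: matchings_def ind)
  qed
  moreover have "card ((`) \<phi> ` m) = card m" "(\<Prod>e\<in>(`) \<phi> ` m. w e) = (\<Prod>e\<in>m. w (\<phi> ` e))" for m
    using inj by (auto intro!: card_image inj_on_subset[OF inj(1)] prod.reindex_cong simp: inj_on_subset[OF inj(1)])
  ultimately show ?thesis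
    unfolding matching_sum_def using inj(2) by (simp add: sum.reindex inj_on_subset)
qed

lemma edge_mean_image:
  assumes "inj \<phi>" and "\<And>e. \<phi> ` e \<in> E \<longleftrightarrow> e \<in> E"
  shows "edge_mean E w (\<phi> ` A) = edge_mean E (\<lambda>e. w (\<phi> ` e)) A"
  unfolding edge_mean_def matching_Z_def using matching_sum_image[OF assms] by metis

lemma edge_var_image:
  assumes "inj \<phi>" and "\<And>e. \<phi> ` e \<in> E \<longleftrightarrow> e \<in> E"
  shows "edge_var E w (\<phi> ` A) = edge_var E (\<lambda>e. w (\<phi> ` e)) A"
  unfolding edge_var_def matching_Z_def using matching_sum_image[OF assms] edge_mean_image[OF assms] by metis

text \<open>Weight zero is allowed because an edge is deleted by giving it weight 0. The edge set
  may be infinite, as for the strip; finiteness enters only through the vertex set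
  \<open>A\<close>.\<close>

locale weighted_graph =
  fixes E :: "'v set set" and w :: "'v set \<Rightarrow> real"
  assumes card_edge: "e \<in> E \<Longrightarrow> card e = 2"
    and weight_nonneg: "e \<in> E \<Longrightarrow> 0 \<le> w e"
begin

abbreviation "msum \<equiv> matching_sum E w"
abbreviation "Z \<equiv> matching_Z E w"
abbreviation "mean \<equiv> edge_mean E w"
abbreviation "var \<equiv> edge_var E w"


lemma edge_nonempty: "e \<in> E \<Longrightarrow> e \<noteq> {}"
  using card_edge by force

lemma prod_weight_nonneg: "m \<in> matchings (induced E A) \<Longrightarrow> 0 \<le> (\<Prod>e\<in>m. w e)"
  using weight_nonneg by (intro prod_nonneg) (auto simp: matchings_def induced_def)

lemma insert_matching:
  assumes "e \<in> E" "e \<subseteq> A" "m \<in> matchings (induced E (A - e))"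
  shows "insert e m \<in> matchings (induced E A)" "e \<notin> m" "\<Union>m \<inter> e = {}"
proof -
  have m: "x \<in> E" "x \<subseteq> A" "x \<inter> e = {}" if "x \<in> m" for x
    using assms(3) that by (auto simp: matchings_def induced_def)
  have "disjoint m" using assms(3) by (simp add: matchings_def)
  then have "disjoint (insert e m)"
    using m(3) unfolding disjoint_def by (auto simp: Int_commute)
  then show "insert e m \<in> matchings (induced E A)"
    using assms m by (auto simp: matchings_def induced_def)
  show "e \<notin> m" using m(3)[of e] edge_nonempty[OF assms(1)] by auto
  show "\<Union>m \<inter> e = {}" using m(3) by auto
qed

section \<open>Decomposition of matchings at an edge and at a vertex\<close>

lemma matchings_containing:
  assumes "e \<in> E" "e \<subseteq> A"
  shows "{m \<in> matchings (induced E A). e \<in> m} = insert e ` matchings (induced E (A - e))"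
proof (intro equalityI subsetI)
  fix m assume m: "m \<in> {m \<in> matchings (induced E A). e \<in> m}"
  then have "x \<inter> e = {}" if "x \<in> m - {e}" for x
    using that matching_edges_eq[of m _ x e] m by blast
  moreover have "x \<in> E" "x \<subseteq> A" if "x \<in> m" for x
    using that m by (auto simp: matchings_def induced_def)
  ultimately have "m - {e} \<subseteq> induced E (A - e)" by (force simp: induced_def)
  then have "m - {e} \<in> matchings (induced E (A - e))"
    using m by (auto simp: matchings_def disjoint_def)
  moreover have "m = insert e (m - {e})" using m by auto
  ultimately show "m \<in> insert e ` matchings (induced E (A - e))" by (rule rev_image_eqI)
qed (use insert_matching[OF assms] in auto)

lemma inj_on_insert_matching:
  assumes "e \<in> E" "e \<subseteq> A"
  shows "inj_on (insert e) (matchings (induced E (A - e)))"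
  using insert_matching(2)[OF assms] by (intro inj_onI) (metis Diff_insert_absorb)

lemma matchings_split:
  assumes "v \<in> A"
  shows "matchings (induced E A) = matchings (induced E (A - {v})) \<union>
    (\<Union>e\<in>incident E A v. {m \<in> matchings (induced E A). e \<in> m})"
proof (intro equalityI subsetI)
  fix m assume m: "m \<in> matchings (induced E A)"
  show "m \<in> matchings (induced E (A - {v})) \<union>
    (\<Union>e\<in>incident E A v. {m \<in> matchings (induced E A). e \<in> m})"
  proof (cases "v \<in> \<Union>m")
    case True
    then show ?thesis using m by (auto simp: incident_def matchings_def induced_def)
  next
    case False
    then show ?thesis using m by (auto simp: matchings_def induced_def)
  qed
qed (auto simp: matchings_def induced_def)

text \<open>Two edges of one matching cannot share \<open>v\<close>, so the classes in
  \<open>matchings_split\<close> are disjoint. Removing the edge at \<open>v\<close> lowers the edge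
  count by one, which turns \<open>g\<close> into \<open>\<lambda>k. g (Suc k)\<close>.\<close>

lemma msum_recursion:
  assumes "finite A" "v \<in> A"
  shows "msum g A = msum g (A - {v}) + (\<Sum>e\<in>incident E A v. w e * msum (\<lambda>k. g (Suc k)) (A - e))"
proof -
  let ?t = "\<lambda>m. g (card m) * (\<Prod>e\<in>m. w e)"
  let ?C = "\<lambda>e. {m \<in> matchings (induced E A). e \<in> m}"
  have fin: "finite (matchings (induced E B))" if "B \<subseteq> A" for B
    using assms(1) that by (intro finite_matchings finite_induced) (auto intro: finite_subset)
  have "msum g A = sum ?t (matchings (induced E (A - {v})) \<union> (\<Union>e\<in>incident E A v. ?C e))"
    unfolding matching_sum_def using matchings_split[OF assms(2)] by simp
  also have "\<dots> = msum g (A - {v}) + sum ?t (\<Union>e\<in>incident E A v. ?C e)"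
    unfolding matching_sum_def using fin assms(1)
    by (intro sum.union_disjoint)
      (auto intro!: finite_UN_I finite_incident, auto simp: incident_def matchings_def induced_def)
  also have "sum ?t (\<Union>e\<in>incident E A v. ?C e) = (\<Sum>e\<in>incident E A v. sum ?t (?C e))"
  proof (intro sum.UNION_disjoint ballI impI)
    fix e e' assume e: "e \<in> incident E A v" "e' \<in> incident E A v" "e \<noteq> e'"
    then have "e \<inter> e' \<noteq> {}" by (auto simp: incident_def)
    then show "?C e \<inter> ?C e' = {}" using e(3) matching_edges_eq by blast
  qed (use assms(1) fin finite_incident in auto)
  also have "\<dots> = (\<Sum>e\<in>incident E A v. w e * msum (\<lambda>k. g (Suc k)) (A - e))"
  proof (rule sum.cong[OF refl])
    fix e assume "e \<in> incident E A v"
    then have e: "e \<in> E" "e \<subseteq> A" by (auto simp: incident_def)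
    have "sum ?t (?C e) = (\<Sum>m\<in>matchings (induced E (A - e)). ?t (insert e m))"
      using matchings_containing[OF e] inj_on_insert_matching[OF e] by (simp add: sum.reindex)
    also have "\<dots> = (\<Sum>m\<in>matchings (induced E (A - e)). w e * (g (Suc (card m)) * (\<Prod>e\<in>m. w e)))"
    proof (rule sum.cong[OF refl])
      fix m assume m: "m \<in> matchings (induced E (A - e))"
      then have "finite m" using finite_matching[of "A - e" m E] assms(1) by auto
      then show "?t (insert e m) = w e * (g (Suc (card m)) * (\<Prod>e\<in>m. w e))"
        using insert_matching(2)[OF e m] by simp
    qed
    finally show "sum ?t (?C e) = w e * msum (\<lambda>k. g (Suc k)) (A - e)"
      by (simp add: matching_sum_def sum_distrib_left)
  qed
  finally show ?thesis .
qed

section \<open>Partition function and recursions for mean and variance\<close>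

lemma Z_ge_1:
  assumes "finite A" shows "1 \<le> Z A"
proof -
  have "{} \<in> matchings (induced E A)" by (simp add: matchings_def)
  then have "(\<Prod>e\<in>{}. w e) \<le> (\<Sum>m\<in>matchings (induced E A). (\<Prod>e\<in>m. w e))"
    using assms prod_weight_nonneg by (intro member_le_sum finite_matchings finite_induced) auto
  then show ?thesis by (simp add: matching_Z_def matching_sum_def)
qed

lemma Z_mono:
  assumes "finite A" "B \<subseteq> A" shows "Z B \<le> Z A"
  unfolding matching_Z_def matching_sum_def
  using assms prod_weight_nonneg
  by (intro sum_mono2 finite_matchings finite_induced matchings_mono induced_mono) auto

lemma Z_recursion:
  assumes "finite A" "v \<in> A"
  shows "Z A = Z (A - {v}) + (\<Sum>e\<in>incident E A v. w e * Z (A - e))"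
  using msum_recursion[OF assms] by (simp add: matching_Z_def)

lemma msum_mean: "finite A \<Longrightarrow> msum real A = mean A * Z A"
  using Z_ge_1[of A] by (simp add: edge_mean_def)

lemma msum_sq: "finite A \<Longrightarrow> msum (\<lambda>k. (real k)\<^sup>2) A = (var A + (mean A)\<^sup>2) * Z A"
  using Z_ge_1[of A] by (simp add: edge_var_def)

text \<open>All moment computations reduce to this form; zero coefficients in later sums are written
  out so that it can be applied.\<close>

lemma msum_quadratic:
  "msum (\<lambda>k. a * (real k)\<^sup>2 + b * real k + c) A = a * msum (\<lambda>k. (real k)\<^sup>2) A + b * msum real A + c * Z A"
proof -
  have "msum (\<lambda>k. c) A = c * Z A"
    using matching_sum_cmult[of E w c "\<lambda>_. 1" A] by (simp add: matching_Z_def)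
  then show ?thesis by (simp add: matching_sum_add matching_sum_cmult)
qed

text \<open>Both recursions condition on the partner of \<open>v\<close>; the moments are centred at the mean without \<open>v\<close>.\<close>

lemma mean_recursion:
  assumes "finite A" "v \<in> A"
  shows "(mean A - mean (A - {v})) * Z A =
    (\<Sum>e\<in>incident E A v. w e * Z (A - e) * (1 - (mean (A - {v}) - mean (A - e))))"
proof -
  let ?f = "mean (A - {v})"
  have fin: "finite (A - B)" for B using assms by auto
  have q: "msum (\<lambda>k. real (Suc k)) B = (1 + mean B) * Z B" if "finite B" for B
    using msum_quadratic[of 0 1 1 B] msum_mean[OF that] by (simp add: algebra_simps)
  have "mean A * Z A = ?f * Z (A - {v}) + (\<Sum>e\<in>incident E A v. w e * ((1 + mean (A - e)) * Z (A - e)))"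
    using msum_recursion[OF assms, of real] q fin msum_mean assms by simp
  moreover have "?f * Z A = ?f * Z (A - {v}) + (\<Sum>e\<in>incident E A v. ?f * (w e * Z (A - e)))"
    using Z_recursion[OF assms] by (simp add: algebra_simps sum_distrib_left)
  ultimately have "(mean A - ?f) * Z A = (\<Sum>e\<in>incident E A v. w e * ((1 + mean (A - e)) * Z (A - e)))
      - (\<Sum>e\<in>incident E A v. ?f * (w e * Z (A - e)))" by (simp add: algebra_simps)
  then show ?thesis by (simp add: sum_subtractf[symmetric] algebra_simps)
qed

lemma var_recursion:
  assumes "finite A" "v \<in> A"
  shows "(var A - var (A - {v}) + (mean A - mean (A - {v}))\<^sup>2) * Z A =
    (\<Sum>e\<in>incident E A v. w e * Z (A - e) *
       ((1 - (mean (A - {v}) - mean (A - e)))\<^sup>2 - (var (A - {v}) - var (A - e))))"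
proof -
  let ?f = "mean (A - {v})" and ?V = "var (A - {v})"
  have fin: "finite (A - B)" for B using assms by auto
  \<comment> \<open>This is \<open>(real k - ?f)\<^sup>2 - ?V\<close>, chosen so that its sum over
    the matchings of \<open>A - {v}\<close> vanishes and only the terms with an edge at
    \<open>v\<close> survive.\<close>
  define g where "g k = 1 * (real k)\<^sup>2 + (- 2 * ?f) * real k + (?f\<^sup>2 - ?V)" for k
  have g1: "g (Suc k) = 1 * (real k)\<^sup>2 + (2 - 2 * ?f) * real k + (1 - 2 * ?f + ?f\<^sup>2 - ?V)" for k
    by (simp add: g_def power2_eq_square algebra_simps)
  have A: "msum g B = (var B - ?V + (mean B - ?f)\<^sup>2) * Z B" if "finite B" for B
  proof -
    have "msum g B = 1 * msum (\<lambda>k. (real k)\<^sup>2) B + (- 2 * ?f) * msum real B + (?f\<^sup>2 - ?V) * Z B"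
      unfolding g_def[abs_def] by (rule msum_quadratic)
    then show ?thesis
      unfolding msum_mean[OF that] msum_sq[OF that] by (simp add: power2_eq_square algebra_simps)
  qed
  have B: "msum (\<lambda>k. g (Suc k)) B = (var B - ?V + (1 - (?f - mean B))\<^sup>2) * Z B" if "finite B" for B
  proof -
    have "msum (\<lambda>k. g (Suc k)) B =
        1 * msum (\<lambda>k. (real k)\<^sup>2) B + (2 - 2 * ?f) * msum real B + (1 - 2 * ?f + ?f\<^sup>2 - ?V) * Z B"
      unfolding g1 by (rule msum_quadratic)
    then show ?thesis
      unfolding msum_mean[OF that] msum_sq[OF that] by (simp add: power2_eq_square algebra_simps)
  qed
  have "msum g A = msum g (A - {v}) + (\<Sum>e\<in>incident E A v. w e * msum (\<lambda>k. g (Suc k)) (A - e))"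
    by (rule msum_recursion[OF assms])
  then show ?thesis unfolding A[OF assms(1)] A[OF fin] B[OF fin]
    by (simp add: algebra_simps)
qed

section \<open>The effect of deleting vertices\<close>

lemma edge_other_end:
  assumes "e \<in> incident E A v"
  obtains u where "e = {v, u}" "u \<noteq> v" "u \<in> A - {v}" "A - e = A - {v} - {u}"
proof -
  have "card e = 2" "v \<in> e" "e \<subseteq> A" using assms card_edge by (auto simp: incident_def)
  then obtain u where "e = {v, u}" "u \<noteq> v" by (auto simp: card_2_iff)
  then show ?thesis using that[of u] \<open>e \<subseteq> A\<close> by auto
qed

text \<open>The estimate for the variance is sharp enough to reproduce itself through the recursion; a bound
  on the increment of the variance by a constant alone would not.\<close>

lemma remove_vertex_bounds:
  assumes "finite A" "v \<in> A"
  shows "0 \<le> mean A - mean (A - {v}) \<and> mean A - mean (A - {v}) \<le> 1 \<and>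
    \<bar>var A - var (A - {v})\<bar> \<le> (mean A - mean (A - {v})) * (1 - (mean A - mean (A - {v})))"
  using assms
proof (induction "card A" arbitrary: A v rule: less_induct)
  case less
  define D where "D = mean A - mean (A - {v})"
  define Q where "Q = var A - var (A - {v})"
  \<comment> \<open>\<open>p e\<close> is the Gibbs probability that \<open>v\<close> is matched
    through \<open>e\<close>, and \<open>y e\<close> is the gain in the expected number of edges,
    relative to \<open>A - {v}\<close>, when this happens. The recursions make \<open>D\<close> and
    \<open>Q + D\<^sup>2\<close> averages against \<open>p\<close>, and the induction hypothesis
    applies to the partner of \<open>v\<close> in \<open>A - {v}\<close>.\<close>
  define p where "p e = w e * Z (A - e) / Z A" for e
  define y where "y e = 1 - (mean (A - {v}) - mean (A - e))" for e
  define q where "q e = var (A - {v}) - var (A - e)" for e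
  have fin: "finite (A - B)" for B using less.prems by auto
  have Z1: "1 \<le> Z (A - B)" for B by (rule Z_ge_1[OF fin])
  have ZA: "1 \<le> Z A" by (rule Z_ge_1[OF less.prems(1)])
  have p0: "0 \<le> p e" if "e \<in> incident E A v" for e
    using that Z1[of e] ZA weight_nonneg[of e] by (auto simp: p_def incident_def)
  have psum: "sum p (incident E A v) \<le> 1"
  proof -
    have "sum p (incident E A v) = (Z A - Z (A - {v})) / Z A"
      using Z_recursion[OF less.prems] by (simp add: p_def sum_divide_distrib)
    also have "\<dots> \<le> 1" using ZA Z1[of "{v}"] by simp
    finally show ?thesis .
  qed
  have IH: "0 \<le> y e \<and> y e \<le> 1 \<and> \<bar>q e\<bar> \<le> y e * (1 - y e)" if "e \<in> incident E A v" for e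
  proof -
    obtain u where u: "u \<in> A - {v}" "A - e = A - {v} - {u}" using edge_other_end[OF \<open>e \<in> incident E A v\<close>] .
    have "card (A - {v}) < card A" using less.prems by (intro psubset_card_mono) auto
    from less.hyps[OF this fin u(1)] show ?thesis by (simp add: y_def q_def u(2) algebra_simps)
  qed
  have D: "D = (\<Sum>e\<in>incident E A v. p e * y e)"
  proof -
    have "D = (\<Sum>e\<in>incident E A v. w e * Z (A - e) * y e) / Z A"
      using mean_recursion[OF less.prems] ZA by (simp add: D_def y_def field_simps)
    then show ?thesis by (simp add: p_def sum_divide_distrib)
  qed
  have Q: "Q + D\<^sup>2 = (\<Sum>e\<in>incident E A v. p e * ((y e)\<^sup>2 - q e))"
  proof -
    have "Q + D\<^sup>2 = (\<Sum>e\<in>incident E A v. w e * Z (A - e) * ((y e)\<^sup>2 - q e)) / Z A"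
      using var_recursion[OF less.prems] ZA by (simp add: Q_def D_def y_def q_def field_simps)
    then show ?thesis by (simp add: p_def sum_divide_distrib)
  qed
  have D0: "0 \<le> D" unfolding D using p0 IH by (intro sum_nonneg) auto
  have "D \<le> sum p (incident E A v)" unfolding D
    using p0 IH by (intro sum_mono) (auto intro: mult_left_le)
  then have D1: "D \<le> 1" using psum by linarith
  have up: "Q + D\<^sup>2 \<le> D"
    unfolding Q unfolding D
  proof (intro sum_mono mult_left_mono p0)
    fix e assume "e \<in> incident E A v"
    then have "\<bar>q e\<bar> \<le> y e * (1 - y e)" using IH by blast
    then have "- q e \<le> y e - (y e)\<^sup>2" by (simp add: power2_eq_square right_diff_distrib)
    then show "(y e)\<^sup>2 - q e \<le> y e" by linarith
  qed auto
  \<comment> \<open>Jensen's inequality for \<open>p\<close>, whose total mass may be less than one;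
    the missing mass, the event that \<open>v\<close> is unpaired, counts as the value 0.\<close>
  have jensen: "D\<^sup>2 \<le> (\<Sum>e\<in>incident E A v. p e * (y e)\<^sup>2)"
  proof -
    have "0 \<le> (\<Sum>e\<in>incident E A v. p e * (y e - D)\<^sup>2)" using p0 by (intro sum_nonneg) auto
    also have "\<dots> = (\<Sum>e\<in>incident E A v. p e * (y e)\<^sup>2 - 2 * D * (p e * y e) + D\<^sup>2 * p e)"
      by (intro sum.cong refl) (simp add: power2_eq_square algebra_simps)
    also have "\<dots> = (\<Sum>e\<in>incident E A v. p e * (y e)\<^sup>2) - 2 * D * D + D\<^sup>2 * sum p (incident E A v)"
      by (simp add: sum.distrib sum_subtractf sum_distrib_left D)
    also have "\<dots> \<le> (\<Sum>e\<in>incident E A v. p e * (y e)\<^sup>2) - D\<^sup>2"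
      using mult_left_mono[OF psum, of "D\<^sup>2"] by (simp add: power2_eq_square)
    finally show ?thesis by linarith
  qed
  \<comment> \<open>The other half of the induction hypothesis costs a second copy of
    \<open>y - y\<^sup>2\<close>. With \<open>jensen\<close> it yields
    \<open>2 * D\<^sup>2 - D \<le> Q + D\<^sup>2\<close>, which matches the upper bound
    \<open>Q + D\<^sup>2 \<le> D\<close>, so that the estimate closes up.\<close>
  have lo: "2 * (\<Sum>e\<in>incident E A v. p e * (y e)\<^sup>2) - D \<le> Q + D\<^sup>2"
  proof -
    have "2 * (\<Sum>e\<in>incident E A v. p e * (y e)\<^sup>2) - D = (\<Sum>e\<in>incident E A v. p e * (2 * (y e)\<^sup>2 - y e))"
      by (simp add: D sum_distrib_left sum_subtractf algebra_simps)
    also have "\<dots> \<le> Q + D\<^sup>2"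
      unfolding Q
    proof (intro sum_mono mult_left_mono p0)
      fix e assume "e \<in> incident E A v"
      then have "\<bar>q e\<bar> \<le> y e * (1 - y e)" using IH by blast
      then have "q e \<le> y e - (y e)\<^sup>2" by (simp add: power2_eq_square right_diff_distrib)
      then show "2 * (y e)\<^sup>2 - y e \<le> (y e)\<^sup>2 - q e" by linarith
    qed auto
    finally show ?thesis .
  qed
  have "\<bar>Q\<bar> \<le> D - D\<^sup>2" using up lo jensen by linarith
  then show ?case using D0 D1 unfolding D_def Q_def by (simp add: power2_eq_square algebra_simps)
qed

lemma remove_set_bounds:
  assumes "finite A" "B \<subseteq> A"
  shows "\<bar>mean A - mean (A - B)\<bar> \<le> card B" "\<bar>var A - var (A - B)\<bar> \<le> card B"
proof -
  have "finite B" using assms finite_subset by auto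
  then have "\<bar>mean A - mean (A - B)\<bar> \<le> card B \<and> \<bar>var A - var (A - B)\<bar> \<le> card B"
    using assms(2)
  proof (induction B)
    case (insert x B)
    let ?D = "mean (A - B) - mean (A - B - {x})"
    have b: "0 \<le> ?D \<and> ?D \<le> 1 \<and> \<bar>var (A - B) - var (A - B - {x})\<bar> \<le> ?D * (1 - ?D)"
      using insert.prems insert.hyps assms(1) by (intro remove_vertex_bounds) auto
    then have "?D * (1 - ?D) \<le> 1 * 1" by (intro mult_mono) auto
    moreover have "A - insert x B = A - B - {x}" by auto
    ultimately show ?case using b insert by (auto simp: abs_if split: if_splits)
  qed simp
  then show "\<bar>mean A - mean (A - B)\<bar> \<le> card B" "\<bar>var A - var (A - B)\<bar> \<le> card B" by auto
qed

text \<open>In the recursion every conditional gain is at most one, so the increment of the mean is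
  at most the probability that \<open>v\<close> is covered.\<close>

lemma mean_remove_le:
  assumes "finite A" "v \<in> A"
  shows "mean A - mean (A - {v}) \<le> 1 - Z (A - {v}) / Z A"
proof -
  have ZA: "1 \<le> Z A" using Z_ge_1 assms by auto
  have "(mean A - mean (A - {v})) * Z A \<le> (\<Sum>e\<in>incident E A v. w e * Z (A - e))"
    unfolding mean_recursion[OF assms]
  proof (rule sum_mono)
    fix e assume e: "e \<in> incident E A v"
    obtain u where u: "u \<in> A - {v}" "A - e = A - {v} - {u}" using edge_other_end[OF e] .
    have "0 \<le> mean (A - {v}) - mean (A - e)"
      unfolding u(2) using remove_vertex_bounds[of "A - {v}" u] assms u by auto
    moreover have "0 \<le> w e * Z (A - e)"
      using e weight_nonneg Z_ge_1[of "A - e"] assms by (auto simp: incident_def)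
    ultimately show "w e * Z (A - e) * (1 - (mean (A - {v}) - mean (A - e))) \<le> w e * Z (A - e)"
      by (intro mult_left_le) auto
  qed
  also have "\<dots> = Z A - Z (A - {v})" using Z_recursion[OF assms] by simp
  finally show ?thesis using ZA by (simp add: field_simps)
qed

text \<open>The ratio is the probability that \<open>v\<close> is unpaired. Replacing each
  \<open>Z (A - e)\<close> in the recursion by the larger \<open>Z (A - {v})\<close> bounds it by
  the weights at \<open>v\<close> alone.\<close>

lemma Z_ratio_ge:
  assumes "finite A" "v \<in> A"
  shows "1 / (1 + sum w (incident E A v)) \<le> Z (A - {v}) / Z A"
proof -
  have s: "0 \<le> sum w (incident E A v)" using weight_nonneg by (intro sum_nonneg) (auto simp: incident_def)
  have "Z A \<le> Z (A - {v}) + (\<Sum>e\<in>incident E A v. w e * Z (A - {v}))"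
    unfolding Z_recursion[OF assms] using assms weight_nonneg
    by (intro add_left_mono sum_mono mult_left_mono Z_mono) (auto simp: incident_def)
  also have "\<dots> = Z (A - {v}) * (1 + sum w (incident E A v))"
    unfolding sum_distrib_right[symmetric] by (simp add: algebra_simps)
  finally show ?thesis using Z_ge_1[OF assms(1)] s by (simp add: field_simps)
qed


section \<open>Unions without connecting edges\<close>

lemma induced_disjoint: "A \<inter> B = {} \<Longrightarrow> induced E A \<inter> induced E B = {}"
  using edge_nonempty unfolding induced_def by blast

lemma bij_betw_matchings_Un:
  assumes "A \<inter> B = {}" and "\<And>e. e \<in> E \<Longrightarrow> e \<subseteq> A \<union> B \<Longrightarrow> e \<subseteq> A \<or> e \<subseteq> B"
  shows "bij_betw (\<lambda>(m, m'). m \<union> m')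
    (matchings (induced E A) \<times> matchings (induced E B)) (matchings (induced E (A \<union> B)))"
proof (rule bij_betw_byWitness[where f' = "\<lambda>m. (m \<inter> induced E A, m \<inter> induced E B)"])
  note disj = induced_disjoint[OF assms(1)]
  show "\<forall>p\<in>matchings (induced E A) \<times> matchings (induced E B).
      (\<lambda>m. (m \<inter> induced E A, m \<inter> induced E B)) ((\<lambda>(m, m'). m \<union> m') p) = p"
    using disj unfolding matchings_def by auto
  show "\<forall>m\<in>matchings (induced E (A \<union> B)). (\<lambda>(m, m'). m \<union> m') (m \<inter> induced E A, m \<inter> induced E B) = m"
    using assms(2) by (auto simp: matchings_def induced_def)
  show "(\<lambda>(m, m'). m \<union> m') ` (matchings (induced E A) \<times> matchings (induced E B))
      \<subseteq> matchings (induced E (A \<union> B))"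
  proof safe
    fix m m' assume m: "m \<in> matchings (induced E A)" "m' \<in> matchings (induced E B)"
    have "a \<inter> b = {}" if "a \<in> m" "b \<in> m'" for a b
    proof -
      have "a \<subseteq> A" "b \<subseteq> B" using that m by (auto simp: matchings_def induced_def)
      then show ?thesis using assms(1) by blast
    qed
    then have "disjoint (m \<union> m')"
      using m by (intro disjoint_union) (auto simp: matchings_def)
    then show "m \<union> m' \<in> matchings (induced E (A \<union> B))"
      using m by (auto simp: matchings_def induced_def)
  qed
  show "(\<lambda>m. (m \<inter> induced E A, m \<inter> induced E B)) ` matchings (induced E (A \<union> B))
      \<subseteq> matchings (induced E A) \<times> matchings (induced E B)"
    by (auto simp: matchings_def disjoint_def)
qed

text \<open>An iterated sum rather than a product, because \<open>g (card m + k)\<close> does not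
  factor for the moments; for quadratic \<open>g\<close> the inner sum is again quadratic in
  \<open>card m\<close>.\<close>

lemma msum_Un:
  assumes "finite A" "finite B" "A \<inter> B = {}"
    and "\<And>e. e \<in> E \<Longrightarrow> e \<subseteq> A \<union> B \<Longrightarrow> e \<subseteq> A \<or> e \<subseteq> B"
  shows "msum g (A \<union> B) =
    (\<Sum>m\<in>matchings (induced E A). (\<Prod>e\<in>m. w e) * msum (\<lambda>k. g (card m + k)) B)"
proof -
  note disj = induced_disjoint[OF assms(3)]
  have t: "g (card (m \<union> m')) * (\<Prod>e\<in>m \<union> m'. w e)
      = (\<Prod>e\<in>m. w e) * (g (card m + card m') * (\<Prod>e\<in>m'. w e))"
    if "m \<in> matchings (induced E A)" "m' \<in> matchings (induced E B)" for m m'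
  proof -
    have "m \<inter> m' = {}" using that disj by (auto simp: matchings_def)
    moreover have "finite m" "finite m'" using that assms(1,2) finite_matching by auto
    ultimately show ?thesis by (simp add: card_Un_disjoint prod.union_disjoint)
  qed
  have "msum g (A \<union> B) = (\<Sum>(m, m')\<in>matchings (induced E A) \<times> matchings (induced E B).
      g (card (m \<union> m')) * (\<Prod>e\<in>m \<union> m'. w e))"
    unfolding matching_sum_def
    by (subst sum.reindex_bij_betw[OF bij_betw_matchings_Un[OF assms(3,4)], symmetric])
      (auto simp: case_prod_unfold)
  also have "\<dots> = (\<Sum>(m, m')\<in>matchings (induced E A) \<times> matchings (induced E B).
      (\<Prod>e\<in>m. w e) * (g (card m + card m') * (\<Prod>e\<in>m'. w e)))"
    using t by (intro sum.cong) auto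
  also have "\<dots> = (\<Sum>m\<in>matchings (induced E A). (\<Prod>e\<in>m. w e) * msum (\<lambda>k. g (card m + k)) B)"
    unfolding matching_sum_def by (simp add: sum.cartesian_product[symmetric] sum_distrib_left)
  finally show ?thesis .
qed

lemma disconnected_union:
  assumes "finite A" "finite B" "A \<inter> B = {}"
    and "\<And>e. e \<in> E \<Longrightarrow> e \<subseteq> A \<union> B \<Longrightarrow> e \<subseteq> A \<or> e \<subseteq> B"
  shows "mean (A \<union> B) = mean A + mean B" "var (A \<union> B) = var A + var B"
proof -
  note U = msum_Un[OF assms]
  have sum_A: "(\<Sum>m\<in>matchings (induced E A). (\<Prod>e\<in>m. w e) * g (card m)) = msum g A" for g
    by (simp add: matching_sum_def mult.commute)
  have Z: "Z (A \<union> B) = Z A * Z B"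
    using U[of "\<lambda>_. 1"] sum_A[of "\<lambda>_. Z B"] matching_sum_cmult[of E w "Z B" "\<lambda>_. 1" A]
    by (simp add: matching_Z_def mult.commute)
  have "msum real (A \<union> B) =
    (\<Sum>m\<in>matchings (induced E A). (\<Prod>e\<in>m. w e) * msum (\<lambda>k. real (card m + k)) B)"
    by (rule U)
  also have "\<dots> = (\<Sum>m\<in>matchings (induced E A).
      (\<Prod>e\<in>m. w e) * (0 * (real (card m))\<^sup>2 + Z B * real (card m) + msum real B))"
  proof (intro sum.cong refl arg_cong2[where f="(*)"])
    fix m :: "'v set set"
    have e: "real (card m + k) = 0 * (real k)\<^sup>2 + 1 * real k + real (card m)" for k by simp
    show "msum (\<lambda>k. real (card m + k)) B = 0 * (real (card m))\<^sup>2 + Z B * real (card m) + msum real B"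
      unfolding e msum_quadratic by simp
  qed
  also have "\<dots> = Z B * msum real A + msum real B * Z A"
    using sum_A[of "\<lambda>k. 0 * (real k)\<^sup>2 + Z B * real k + msum real B"] unfolding msum_quadratic by simp
  finally have 1: "msum real (A \<union> B) = (mean A + mean B) * (Z A * Z B)"
    using msum_mean assms by (simp add: algebra_simps)
  have "msum (\<lambda>k. (real k)\<^sup>2) (A \<union> B) =
    (\<Sum>m\<in>matchings (induced E A). (\<Prod>e\<in>m. w e) * msum (\<lambda>k. (real (card m + k))\<^sup>2) B)"
    by (rule U)
  also have "\<dots> = (\<Sum>m\<in>matchings (induced E A). (\<Prod>e\<in>m. w e) *
      (Z B * (real (card m))\<^sup>2 + 2 * msum real B * real (card m) + msum (\<lambda>k. (real k)\<^sup>2) B))"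
  proof (intro sum.cong refl arg_cong2[where f="(*)"])
    fix m :: "'v set set"
    have e: "(real (card m + k))\<^sup>2 = 1 * (real k)\<^sup>2 + (2 * real (card m)) * real k + (real (card m))\<^sup>2" for k
      by (simp add: power2_eq_square algebra_simps)
    show "msum (\<lambda>k. (real (card m + k))\<^sup>2) B =
      Z B * (real (card m))\<^sup>2 + 2 * msum real B * real (card m) + msum (\<lambda>k. (real k)\<^sup>2) B"
      unfolding e msum_quadratic by simp
  qed
  also have "\<dots> = Z B * msum (\<lambda>k. (real k)\<^sup>2) A + 2 * msum real B * msum real A + msum (\<lambda>k. (real k)\<^sup>2) B * Z A"
    using sum_A[of "\<lambda>k. Z B * (real k)\<^sup>2 + 2 * msum real B * real k + msum (\<lambda>k. (real k)\<^sup>2) B"]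
    unfolding msum_quadratic by simp
  finally have 2: "msum (\<lambda>k. (real k)\<^sup>2) (A \<union> B) = (var A + var B + (mean A + mean B)\<^sup>2) * (Z A * Z B)"
    using msum_mean msum_sq assms by (simp add: power2_eq_square algebra_simps)
  have "1 \<le> Z A" "1 \<le> Z B" using Z_ge_1 assms by auto
  then show "mean (A \<union> B) = mean A + mean B"
    using 1 Z by (simp add: edge_mean_def)
  then show "var (A \<union> B) = var A + var B"
    using 2 Z \<open>1 \<le> Z A\<close> \<open>1 \<le> Z B\<close> by (simp add: edge_var_def)
qed

section \<open>Lower bound for the variance of the edge count\<close>

text \<open>Integration by parts for the Gibbs measure. Inserting \<open>e\<close> maps the
  matchings in which both ends of \<open>e\<close> are free bijectively onto those containing
  \<open>e\<close> and multiplies their weight by \<open>w e\<close>, so that integrating against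
  this variable produces the discrete derivative of \<open>\<phi>\<close> in direction
  \<open>e\<close>.\<close>

lemma msum_toggle:
  assumes "finite A" "e \<in> E" "e \<subseteq> A"
  shows "(\<Sum>m\<in>matchings (induced E A).
      (of_bool (e \<in> m) - w e * of_bool (e \<inter> \<Union>m = {})) * \<phi> m * (\<Prod>e\<in>m. w e)) =
    (\<Sum>m\<in>matchings (induced E (A - e)). w e * (\<Prod>e\<in>m. w e) * (\<phi> (insert e m) - \<phi> m))"
proof -
  let ?M = "matchings (induced E A)" and ?M' = "matchings (induced E (A - e))"
  let ?W = "\<lambda>m. \<Prod>e\<in>m. w e"
  have fin: "finite ?M" using assms(1) by (intro finite_matchings finite_induced)
  have free: "{m \<in> ?M. e \<inter> \<Union>m = {}} = ?M'"
    by (auto simp: matchings_def induced_def)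
  have "(\<Sum>m\<in>?M. of_bool (e \<in> m) * (\<phi> m * ?W m)) = (\<Sum>m\<in>{m \<in> ?M. e \<in> m}. \<phi> m * ?W m)"
    using fin by (intro sum.mono_neutral_cong_right) auto
  also have "\<dots> = (\<Sum>m\<in>?M'. \<phi> (insert e m) * ?W (insert e m))"
    using matchings_containing[OF assms(2,3)] inj_on_insert_matching[OF assms(2,3)]
    by (simp add: sum.reindex)
  also have "\<dots> = (\<Sum>m\<in>?M'. w e * ?W m * \<phi> (insert e m))"
  proof (rule sum.cong[OF refl])
    fix m assume m: "m \<in> ?M'"
    then have "finite m" using finite_matching[of "A - e" m E] assms(1) by auto
    then show "\<phi> (insert e m) * ?W (insert e m) = w e * ?W m * \<phi> (insert e m)"
      using insert_matching(2)[OF assms(2,3) m] by simp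
  qed
  finally have 1: "(\<Sum>m\<in>?M. of_bool (e \<in> m) * (\<phi> m * ?W m)) = (\<Sum>m\<in>?M'. w e * ?W m * \<phi> (insert e m))" .
  have 2: "(\<Sum>m\<in>?M. w e * of_bool (e \<inter> \<Union>m = {}) * (\<phi> m * ?W m)) = (\<Sum>m\<in>?M'. w e * ?W m * \<phi> m)"
    unfolding free[symmetric] using fin by (intro sum.mono_neutral_cong_right) auto
  show ?thesis
    using 1 2 by (simp add: left_diff_distrib right_diff_distrib sum_subtractf mult.assoc)
qed

text \<open>The variance of the number \<open>N\<close> of edges is bounded below by projecting \<open>N\<close> onto the span of the
  centred variables \<open>1(e \<in> m) - w e * 1(e is free in m)\<close>, which are orthogonal for disjoint edges.\<close>

lemma var_ge_matching:
  assumes "finite A" "B \<in> matchings (induced E A)"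
  shows "(\<Sum>e\<in>B. w e / (1 + w e) * (Z (A - e) / Z A)) \<le> var A"
proof -
  let ?M = "matchings (induced E A)"
  let ?W = "\<lambda>m. \<Prod>e\<in>m. w e"
  define \<xi> where "\<xi> e m = (of_bool (e \<in> m) - w e * of_bool (e \<inter> \<Union>m = {}) :: real)" for e m
  \<comment> \<open>The divisor makes the insertion of a free \<open>e \<in> B\<close> raise
    \<open>X\<close> by exactly one, as it raises the edge count. Hence \<open>X\<close> has the
    same inner product \<open>S\<close> with the centred count and with itself, and
    \<open>S / Z A\<close> is a lower bound for the variance.\<close>
  define X where "X m = (\<Sum>e\<in>B. \<xi> e m / (1 + w e))" for m
  define S where "S = (\<Sum>e\<in>B. w e / (1 + w e) * Z (A - e))"
  have B: "e \<in> E" "e \<subseteq> A" "0 \<le> w e" if "e \<in> B" for e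
    using that assms(2) weight_nonneg by (auto simp: matchings_def induced_def)
  have finB: "finite B" using finite_matching assms by auto
  have toggle: "(\<Sum>m\<in>?M. \<xi> e m * \<phi> m * ?W m) = w e * Z (A - e) * c"
    if "e \<in> B" and "\<And>m. m \<in> matchings (induced E (A - e)) \<Longrightarrow> \<phi> (insert e m) - \<phi> m = c" for e \<phi> c
  proof -
    have "(\<Sum>m\<in>?M. \<xi> e m * \<phi> m * ?W m) = (\<Sum>m\<in>matchings (induced E (A - e)). w e * ?W m * c)"
      unfolding \<xi>_def using msum_toggle[OF assms(1) B(1,2)[OF that(1)], of \<phi>] that(2) by simp
    then show ?thesis
      by (simp add: matching_Z_def matching_sum_def sum_distrib_left sum_distrib_right mult.assoc)
  qed
  have N: "(\<Sum>m\<in>?M. X m * (real (card m) - mean A) * ?W m) = S"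
  proof -
    have "(\<Sum>m\<in>?M. X m * (real (card m) - mean A) * ?W m)
        = (\<Sum>m\<in>?M. \<Sum>e\<in>B. (\<xi> e m * (real (card m) - mean A) * ?W m) / (1 + w e))"
      by (simp add: X_def sum_distrib_right)
    also have "\<dots> = (\<Sum>e\<in>B. (\<Sum>m\<in>?M. \<xi> e m * (real (card m) - mean A) * ?W m) / (1 + w e))"
      by (subst sum.swap) (simp add: sum_divide_distrib)
    also have "\<dots> = S"
      unfolding S_def
    proof (rule sum.cong[OF refl])
      fix e assume e: "e \<in> B"
      have "(\<Sum>m\<in>?M. \<xi> e m * (real (card m) - mean A) * ?W m) = w e * Z (A - e) * 1"
      proof (rule toggle[OF e])
        fix m assume m: "m \<in> matchings (induced E (A - e))"
        then have "finite m" using finite_matching[of "A - e" m E] assms(1) by auto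
        then show "real (card (insert e m)) - mean A - (real (card m) - mean A) = 1"
          using insert_matching(2)[OF B(1,2)[OF e] m] by simp
      qed
      then show "(\<Sum>m\<in>?M. \<xi> e m * (real (card m) - mean A) * ?W m) / (1 + w e)
          = w e / (1 + w e) * Z (A - e)" by simp
    qed
    finally show ?thesis .
  qed
  have XX: "(\<Sum>m\<in>?M. X m * X m * ?W m) = S"
  proof -
    have "(\<Sum>m\<in>?M. X m * X m * ?W m) = (\<Sum>m\<in>?M. (\<Sum>e\<in>B. \<xi> e m / (1 + w e)) * (X m * ?W m))"
      by (simp add: X_def mult.assoc)
    also have "\<dots> = (\<Sum>m\<in>?M. \<Sum>e\<in>B. (\<xi> e m * X m * ?W m) / (1 + w e))"
      by (simp add: sum_distrib_right mult.assoc)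
    also have "\<dots> = (\<Sum>e\<in>B. (\<Sum>m\<in>?M. \<xi> e m * X m * ?W m) / (1 + w e))"
      by (subst sum.swap) (simp add: sum_divide_distrib)
    also have "\<dots> = S"
      unfolding S_def
    proof (rule sum.cong[OF refl])
      fix e assume e: "e \<in> B"
      have "(\<Sum>m\<in>?M. \<xi> e m * X m * ?W m) = w e * Z (A - e) * 1"
      proof (rule toggle[OF e])
        fix m assume m: "m \<in> matchings (induced E (A - e))"
        \<comment> \<open>Disjointness of the edges of \<open>B\<close> enters here: inserting
          \<open>e\<close> neither adds \<open>e'\<close> nor covers one of its ends, so only the
          summand of \<open>e\<close> changes.\<close>
        have "\<xi> e' (insert e m) = \<xi> e' m" if "e' \<in> B - {e}" for e'
        proof -
          have "e' \<inter> e = {}" using matching_edges_eq[OF assms(2)] that e by blast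
          moreover have "e' \<noteq> e" using that by auto
          ultimately show ?thesis by (auto simp: \<xi>_def Int_Un_distrib)
        qed
        then have "X (insert e m) - X m = \<xi> e (insert e m) / (1 + w e) - \<xi> e m / (1 + w e)"
          unfolding X_def using finB e by (simp add: sum.remove[of B e])
        moreover have "\<xi> e (insert e m) = 1" "\<xi> e m = - w e"
          using insert_matching(2,3)[OF B(1,2)[OF e] m] edge_nonempty[OF B(1)[OF e]]
          by (auto simp: \<xi>_def)
        ultimately show "X (insert e m) - X m = 1"
          using B(3)[OF e] by (simp add: add_divide_distrib[symmetric] diff_divide_distrib[symmetric])
      qed
      then show "(\<Sum>m\<in>?M. \<xi> e m * X m * ?W m) / (1 + w e) = w e / (1 + w e) * Z (A - e)" by simp
    qed
    finally show ?thesis .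
  qed
  have NN: "(\<Sum>m\<in>?M. (real (card m) - mean A)\<^sup>2 * ?W m) = var A * Z A"
  proof -
    have "(\<Sum>m\<in>?M. (real (card m) - mean A)\<^sup>2 * ?W m)
        = msum (\<lambda>k. 1 * (real k)\<^sup>2 + (- 2 * mean A) * real k + (mean A)\<^sup>2) A"
      unfolding matching_sum_def by (simp add: power2_eq_square algebra_simps)
    also have "\<dots> = var A * Z A"
      unfolding msum_quadratic msum_mean[OF assms(1)] msum_sq[OF assms(1)]
      by (simp add: power2_eq_square algebra_simps)
    finally show ?thesis .
  qed
  have "0 \<le> (\<Sum>m\<in>?M. (real (card m) - mean A - X m)\<^sup>2 * ?W m)"
    using prod_weight_nonneg by (intro sum_nonneg) auto
  also have "\<dots> = (\<Sum>m\<in>?M. (real (card m) - mean A)\<^sup>2 * ?W m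
      - 2 * (X m * (real (card m) - mean A) * ?W m) + X m * X m * ?W m)"
    by (intro sum.cong refl) (simp add: power2_eq_square algebra_simps)
  also have "\<dots> = var A * Z A - S"
    unfolding sum.distrib sum_subtractf sum_distrib_left[symmetric] NN N XX by simp
  finally have "S \<le> var A * Z A" by simp
  then have "S / Z A \<le> var A" using Z_ge_1[OF assms(1)] by (simp add: field_simps)
  then show ?thesis by (simp add: S_def sum_divide_distrib)
qed

text \<open>Scaling all weights at \<open>v\<close> amounts to changing the weight of the vertex \<open>v\<close>.\<close>

lemma mean_vertex_slope:
  assumes "finite A" "{v, u} \<in> E" "{v, u} \<subseteq> A" "u \<noteq> v"
    and "sum w (incident E (A - {v}) u) \<le> 1"
    and s: "0 \<le> s" "s \<le> t"
  shows "(t - s) * (w {v, u} / 4) / (1 + t * sum w (incident E A v))\<^sup>2 \<le>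
    edge_mean E (\<lambda>e. if v \<in> e then t * w e else w e) A - edge_mean E (\<lambda>e. if v \<in> e then s * w e else w e) A"
proof -
  define z where "z = Z (A - {v})"
  define S where "S = (\<Sum>e\<in>incident E A v. w e * Z (A - e)) / z"
  define Y where "Y e = 1 - (mean (A - {v}) - mean (A - e))" for e
  define T where "T = (\<Sum>e\<in>incident E A v. w e * Z (A - e) * Y e) / z"
  define \<sigma> where "\<sigma> = sum w (incident E A v)"
  let ?w = "\<lambda>r e. if v \<in> e then r * w e else w e"
  have vA: "v \<in> A" "u \<in> A - {v}" and e0: "{v, u} \<in> incident E A v" and Ae0: "A - {v, u} = A - {v} - {u}"
    using assms(2-4) by (auto simp: incident_def)
  have fin: "finite (A - B)" for B using assms(1) by auto
  have z: "1 \<le> z" unfolding z_def by (rule Z_ge_1[OF fin])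
  have nonneg: "0 \<le> w e * Z (A - e)" if "e \<in> incident E A v" for e
    using that weight_nonneg Z_ge_1[OF fin[of e]] by (auto simp: incident_def)
  have Y: "0 \<le> Y e" if e: "e \<in> incident E A v" for e
  proof -
    obtain x where x: "x \<in> A - {v}" "A - e = A - {v} - {x}" using edge_other_end[OF e] .
    show ?thesis unfolding Y_def x(2) using remove_vertex_bounds[OF fin x(1)] by simp
  qed
  have S0: "0 \<le> S" unfolding S_def using nonneg z by (auto intro!: divide_nonneg_nonneg sum_nonneg)
  \<comment> \<open>A matching uses at most one edge at \<open>v\<close>, so the scaling factor
    enters the partition function affinely and the mean is a Moebius function of it. Its increments
    are then explicit.\<close>
  have eq: "edge_mean E (?w r) A - mean (A - {v}) = r * T / (1 + r * S)" if "0 \<le> r" for r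
  proof -
    interpret r: weighted_graph E "?w r"
      using card_edge weight_nonneg that by unfold_locales auto
    have c: "edge_mean E (?w r) B = mean B" "matching_Z E (?w r) B = Z B" if "v \<notin> B" for B
      using that by (auto intro!: edge_mean_cong matching_sum_cong simp: matching_Z_def)
    have v: "v \<in> e" if "e \<in> incident E A v" for e using that by (auto simp: incident_def)
    have 1: "matching_Z E (?w r) A = z * (1 + r * S)"
      using r.Z_recursion[OF assms(1) vA(1)] v c z
      by (simp add: z_def S_def sum_distrib_left field_simps)
    have 2: "(edge_mean E (?w r) A - mean (A - {v})) * matching_Z E (?w r) A = r * (T * z)"
      using r.mean_recursion[OF assms(1) vA(1)] v c z
      by (simp add: T_def Y_def sum_distrib_left mult.assoc)
    have "z * ((edge_mean E (?w r) A - mean (A - {v})) * (1 + r * S) - r * T) = 0"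
      using 2 unfolding 1 by (simp add: algebra_simps)
    moreover have "0 < 1 + r * S" using S0 that by (intro add_pos_nonneg) auto
    ultimately show ?thesis using z by (simp add: eq_divide_eq)
  qed
  have ratio: "1 / 2 \<le> Z (A - {v, u}) / z"
  proof -
    have "0 \<le> sum w (incident E (A - {v}) u)"
      using weight_nonneg by (intro sum_nonneg) (auto simp: incident_def)
    then have "1 / 2 \<le> 1 / (1 + sum w (incident E (A - {v}) u))"
      using assms(5) by (simp add: field_simps)
    then show ?thesis using Z_ratio_ge[OF fin vA(2)] unfolding z_def Ae0 by linarith
  qed
  have "1 / 2 \<le> Y {v, u}"
    using mean_remove_le[OF fin vA(2)] ratio by (simp add: Y_def Ae0 z_def)
  \<comment> \<open>One factor 1/2 bounds the probability that \<open>u\<close> is unpaired in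
    \<open>A - {v}\<close> from below. The other bounds \<open>Y {v, u}\<close>, which is at least
    that same probability.\<close>
  have T: "w {v, u} / 4 \<le> T"
  proof -
    have "w {v, u} / 4 = w {v, u} * ((1 / 2) * (1 / 2))" by simp
    also have "\<dots> \<le> w {v, u} * ((Z (A - {v, u}) / z) * Y {v, u})"
      using order_trans[OF _ ratio, of 0] \<open>1 / 2 \<le> Y {v, u}\<close> weight_nonneg[OF assms(2)]
      by (intro mult_left_mono mult_mono ratio) auto
    also have "\<dots> = w {v, u} * Z (A - {v, u}) * Y {v, u} / z" by simp
    also have "\<dots> \<le> T"
      unfolding T_def using nonneg Y z e0 finite_incident[OF assms(1)]
      by (intro divide_right_mono member_le_sum[where f = "\<lambda>e. w e * Z (A - e) * Y e"]) auto
    finally show ?thesis .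
  qed
  have "S \<le> (\<Sum>e\<in>incident E A v. w e * z) / z"
    unfolding S_def using z weight_nonneg assms(1)
    by (intro divide_right_mono sum_mono mult_left_mono) (auto simp: incident_def z_def intro!: Z_mono)
  then have S1: "S \<le> \<sigma>" using z by (simp add: \<sigma>_def sum_distrib_right[symmetric])
  have "(t - s) * (w {v, u} / 4) / (1 + t * \<sigma>)\<^sup>2 \<le> (t - s) * T / ((1 + t * S) * (1 + s * S))"
  proof (rule frac_le)
    show "(t - s) * (w {v, u} / 4) \<le> (t - s) * T" using T s by (intro mult_left_mono) auto
    show "0 \<le> (t - s) * T" using T s weight_nonneg[OF assms(2)] by auto
    show "0 < (1 + t * S) * (1 + s * S)" using s S0 by (intro mult_pos_pos) (auto intro: add_pos_nonneg)
    have le: "s * S \<le> t * \<sigma>" "t * S \<le> t * \<sigma>" using s S0 S1 by (auto intro!: mult_mono)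
    have "0 \<le> s * S" using s S0 by simp
    with le show "(1 + t * S) * (1 + s * S) \<le> (1 + t * \<sigma>)\<^sup>2"
      unfolding power2_eq_square using le by (intro mult_mono) linarith+
  qed
  also have "\<dots> = t * T / (1 + t * S) - s * T / (1 + s * S)"
  proof -
    have "1 + t * S > 0" "1 + s * S > 0" using s S0 by (auto intro: add_pos_nonneg)
    then show ?thesis by (simp add: divide_simps) (simp add: algebra_simps)
  qed
  also have "\<dots> = edge_mean E (?w t) A - edge_mean E (?w s) A"
    using eq[of t] eq[of s] s by simp
  finally show ?thesis unfolding \<sigma>_def .
qed

text \<open>The mean is again a Moebius function, now of a single edge weight, and the sign of
  \<open>\<kappa>\<close> decides its monotonicity. Forcing the edge gains one edge but withdraws
  both its ends from the rest; each end costs at most its probability of being covered, which a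
  weight sum of at most 1 bounds by 1/2 only. The margin \<open>\<eta>\<close> keeps the total loss
  below one.\<close>

lemma mean_edge_slope:
  assumes "finite A" "{v, u} \<in> E" "{v, u} \<subseteq> A" "u \<noteq> v" "0 \<le> \<eta>" "\<eta> \<le> 1"
    and "sum (w({v, u} := 0)) (incident E A u) \<le> 1 - \<eta>"
    and "sum (w({v, u} := 0)) (incident E A v) \<le> 1 - \<eta>"
    and x: "0 \<le> x" "x \<le> y"
  shows "(y - x) * (\<eta> / 8) / (1 + y)\<^sup>2 \<le> edge_mean E (w({v, u} := y)) A - edge_mean E (w({v, u} := x)) A"
proof -
  let ?e = "{v, u}" and ?w = "\<lambda>r. w({v, u} := r)"
  interpret z: weighted_graph E "?w 0"
    using card_edge weight_nonneg by unfold_locales auto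
  have vA: "v \<in> A" "u \<in> A" "v \<in> A - {u}" "A - ?e = A - {u} - {v}" and e0: "?e \<in> incident E A v"
    using assms(2-4) by (auto simp: incident_def)
  have fin: "finite (A - B)" for B using assms(1) by auto
  have c: "matching_sum E (?w r) g B = msum g B" if "\<not> ?e \<subseteq> B" for B r g
    using that by (intro matching_sum_cong) auto
  \<comment> \<open>Conditioning on whether the edge belongs to the matching, obtained by comparing
    the vertex recursions at \<open>v\<close> for the weights \<open>r\<close> and 0: all other
    terms avoid the edge and agree.\<close>
  have split: "matching_sum E (?w r) g A = matching_sum E (?w 0) g A + r * msum (\<lambda>k. g (Suc k)) (A - ?e)"
    if "0 \<le> r" for r g
  proof -
    interpret r: weighted_graph E "?w r"
      using card_edge weight_nonneg that by unfold_locales auto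
    have *: "(\<Sum>e\<in>incident E A v. ?w r e * matching_sum E (?w r) (\<lambda>k. g (Suc k)) (A - e)) =
      (\<Sum>e\<in>incident E A v - {?e}. w e * msum (\<lambda>k. g (Suc k)) (A - e)) + r * msum (\<lambda>k. g (Suc k)) (A - ?e)"
      for r
    proof -
      have "(\<Sum>e\<in>incident E A v. ?w r e * matching_sum E (?w r) (\<lambda>k. g (Suc k)) (A - e)) =
        (\<Sum>e\<in>incident E A v. ?w r e * msum (\<lambda>k. g (Suc k)) (A - e))"
        by (intro sum.cong arg_cong2[where f="(*)"] refl c) (auto simp: incident_def)
      also have "\<dots> = ?w r ?e * msum (\<lambda>k. g (Suc k)) (A - ?e)
          + (\<Sum>e\<in>incident E A v - {?e}. ?w r e * msum (\<lambda>k. g (Suc k)) (A - e))"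
        using finite_incident[OF assms(1)] e0 by (rule sum.remove)
      also have "(\<Sum>e\<in>incident E A v - {?e}. ?w r e * msum (\<lambda>k. g (Suc k)) (A - e)) =
        (\<Sum>e\<in>incident E A v - {?e}. w e * msum (\<lambda>k. g (Suc k)) (A - e))"
        by (intro sum.cong) auto
      finally show ?thesis by (simp only: fun_upd_same add.commute)
    qed
    have cv: "matching_sum E (?w q) g (A - {v}) = msum g (A - {v})" for q by (rule c) auto
    show ?thesis
      using r.msum_recursion[OF assms(1) vA(1), of g] z.msum_recursion[OF assms(1) vA(1), of g]
      unfolding * cv by simp
  qed
  define \<rho> where "\<rho> = Z (A - ?e) / z.Z A"
  define \<kappa> where "\<kappa> = 1 - (z.mean A - mean (A - ?e))"
  have zA: "1 \<le> z.Z A" by (rule z.Z_ge_1[OF assms(1)])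
  have eq: "edge_mean E (?w r) A - z.mean A = r * \<rho> * \<kappa> / (1 + r * \<rho>)" if "0 \<le> r" for r
  proof -
    have "msum (\<lambda>k. real (Suc k)) (A - ?e) = Z (A - ?e) * (1 + mean (A - ?e))"
      using msum_quadratic[of 0 1 1 "A - ?e"] msum_mean[OF fin[of ?e]] by (simp add: algebra_simps)
    then have 1: "matching_sum E (?w r) real A = z.Z A * (z.mean A + r * \<rho> * (1 + mean (A - ?e)))"
      using split[OF that, of real] z.msum_mean[OF assms(1)] zA by (simp add: \<rho>_def field_simps)
    have 2: "matching_Z E (?w r) A = z.Z A * (1 + r * \<rho>)"
      using split[OF that, of "\<lambda>_. 1"] zA by (simp add: \<rho>_def matching_Z_def field_simps)
    have "0 \<le> \<rho>" using zA Z_ge_1[OF fin[of ?e]] by (simp add: \<rho>_def)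
    then have "1 + r * \<rho> > 0" using that by (intro add_pos_nonneg) auto
    then show ?thesis unfolding edge_mean_def[of E "?w r"] 1 2 using zA
      by (simp add: \<kappa>_def divide_simps) (simp add: algebra_simps)
  qed
  have bnd: "1 / 2 + \<eta> / 4 \<le> z.Z (B - {b}) / z.Z B"
    if "B \<subseteq> A" "b \<in> B" "sum (?w 0) (incident E A b) \<le> 1 - \<eta>" for B b
  proof -
    have finB: "finite B" using that(1) assms(1) finite_subset by auto
    have s0: "0 \<le> sum (?w 0) (incident E B b)"
      using z.weight_nonneg by (intro sum_nonneg) (auto simp: incident_def)
    have "sum (?w 0) (incident E B b) \<le> sum (?w 0) (incident E A b)"
      using z.weight_nonneg that(1) assms(1) by (intro sum_mono2 finite_incident) (auto simp: incident_def)
    then have s1: "sum (?w 0) (incident E B b) \<le> 1 - \<eta>" using that(3) by linarith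
    have "(1 / 2 + \<eta> / 4) * (1 + sum (?w 0) (incident E B b)) \<le> (1 / 2 + \<eta> / 4) * (2 - \<eta>)"
      using s1 assms(5) by (intro mult_left_mono) auto
    also have "\<dots> = 1 - \<eta> * \<eta> / 4" by (simp add: field_simps)
    also have "\<dots> \<le> 1" by simp
    finally have "1 / 2 + \<eta> / 4 \<le> 1 / (1 + sum (?w 0) (incident E B b))"
      using s0 by (simp add: field_simps)
    then show ?thesis using z.Z_ratio_ge[OF finB that(2)] by linarith
  qed
  have b1: "1 / 2 + \<eta> / 4 \<le> z.Z (A - {u}) / z.Z A" by (rule bnd) (use vA assms in auto)
  have b2: "1 / 2 + \<eta> / 4 \<le> z.Z (A - {u} - {v}) / z.Z (A - {u})" by (rule bnd) (use vA assms in auto)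
  have same: "z.mean (A - {u} - {v}) = mean (A - ?e)" "z.Z (A - {u} - {v}) = Z (A - ?e)"
    unfolding vA(4) by (auto intro!: edge_mean_cong matching_sum_cong simp: matching_Z_def)
  \<comment> \<open>By \<open>b1\<close> and \<open>b2\<close> each of the two deletions costs at
    most \<open>1 / 2 - \<eta> / 4\<close>, which leaves \<open>\<eta> / 2\<close> of the edge
    gained.\<close>
  have \<kappa>: "\<eta> / 2 \<le> \<kappa>"
    using z.mean_remove_le[OF assms(1) vA(2)] z.mean_remove_le[OF fin vA(3)] b1 b2
    unfolding \<kappa>_def same by linarith
  have \<rho>4: "1 / 4 \<le> \<rho>"
  proof -
    have "(1 / 2) * (1 / 2) \<le> (z.Z (A - {u}) / z.Z A) * (z.Z (A - {u} - {v}) / z.Z (A - {u}))"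
      using b1 b2 assms(5) by (intro mult_mono) auto
    then show ?thesis using z.Z_ge_1[OF fin[of "{u}"]] by (simp add: \<rho>_def same)
  qed
  have \<rho>1: "\<rho> \<le> 1"
    using z.Z_mono[OF assms(1), of "A - {u} - {v}"] zA by (auto simp: \<rho>_def same)
  have "(y - x) * (\<eta> / 8) / (1 + y)\<^sup>2 \<le> (y - x) * (\<rho> * \<kappa>) / ((1 + y * \<rho>) * (1 + x * \<rho>))"
  proof (rule frac_le)
    have "\<eta> / 8 = 1 / 4 * (\<eta> / 2)" by simp
    also have "\<dots> \<le> \<rho> * \<kappa>" using \<kappa> \<rho>4 assms(5) by (intro mult_mono) auto
    finally have "\<eta> / 8 \<le> \<rho> * \<kappa>" .
    then show "(y - x) * (\<eta> / 8) \<le> (y - x) * (\<rho> * \<kappa>)" using x by (intro mult_left_mono) auto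
    show "0 \<le> (y - x) * (\<rho> * \<kappa>)" using x \<kappa> \<rho>4 assms(5) by auto
    show "0 < (1 + y * \<rho>) * (1 + x * \<rho>)" using x \<rho>4 by (intro mult_pos_pos) (auto intro: add_pos_nonneg)
    have "x * \<rho> \<le> y" "y * \<rho> \<le> y" using mult_mono[of x y \<rho> 1] mult_mono[of y y \<rho> 1] x \<rho>1 \<rho>4 by auto
    then show "(1 + y * \<rho>) * (1 + x * \<rho>) \<le> (1 + y)\<^sup>2"
      unfolding power2_eq_square using x \<rho>4 by (intro mult_mono) auto
  qed
  also have "\<dots> = y * \<rho> * \<kappa> / (1 + y * \<rho>) - x * \<rho> * \<kappa> / (1 + x * \<rho>)"
  proof -
    have "1 + y * \<rho> > 0" "1 + x * \<rho> > 0" using x \<rho>4 by (auto intro: add_pos_nonneg)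
    then show ?thesis by (simp add: divide_simps) (simp add: algebra_simps)
  qed
  also have "\<dots> = edge_mean E (?w y) A - edge_mean E (?w x) A"
    using eq[of y] eq[of x] x by simp
  finally show ?thesis .
qed

end

section \<open>Nearly additive sequences\<close>

text \<open>The halves of \<open>k \<ge> 2\<close> have ratio at most 2, so their roots exceed the
  root of \<open>k\<close> by a fixed factor. This surplus absorbs an error of order sqrt k at every
  halving. The value 4/3 is a convenient one below the worst case (1 + sqrt 2) / sqrt 3, attained by
  the halves 1 and 2.\<close>

lemma sqrt_halves:
  assumes "2 \<le> k"
  shows "4 / 3 * sqrt (real k) \<le> sqrt (real (k div 2)) + sqrt (real (k - k div 2))"
proof -
  define i where "i = real (k div 2)"
  define j where "j = real (k - k div 2)"
  have "k - k div 2 \<le> 2 * (k div 2)" "k div 2 \<le> k - k div 2" "1 \<le> k div 2" "k = k div 2 + (k - k div 2)"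
    using assms by auto
  then have ij: "real k = i + j" "i \<le> j" "j \<le> 2 * i" "1 \<le> i" unfolding i_def j_def by linarith+
  \<comment> \<open>Expanded, this says that 2 (i + j)^2 is at most 9 i j, which is more than the
    factor 7/18 requires; and 7/18 is chosen because 16/9 = 1 + 2 * 7/18.\<close>
  have "0 \<le> (2 * i - j) * (2 * j - i)" using ij by (intro mult_nonneg_nonneg) auto
  moreover have "0 \<le> (i + j)\<^sup>2" by simp
  ultimately have "(7 / 18 * (i + j))\<^sup>2 \<le> i * j" by (simp add: power2_eq_square algebra_simps)
  then have "7 / 18 * (i + j) \<le> sqrt (i * j)" by (rule real_le_rsqrt)
  then have "16 / 9 * (i + j) \<le> i + j + 2 * sqrt (i * j)" by (simp add: field_simps)
  moreover have "(sqrt i + sqrt j)\<^sup>2 = i + j + 2 * sqrt (i * j)"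
    using ij by (simp add: power2_eq_square algebra_simps real_sqrt_mult)
  moreover have "(4 / 3 * sqrt (i + j))\<^sup>2 = 16 / 9 * (i + j)"
    using ij by (simp add: power_mult_distrib power2_eq_square)
  ultimately have "(4 / 3 * sqrt (i + j))\<^sup>2 \<le> (sqrt i + sqrt j)\<^sup>2" by simp
  then have "4 / 3 * sqrt (i + j) \<le> sqrt i + sqrt j"
    by (rule power2_le_imp_le) (use ij in auto)
  then have "4 / 3 * sqrt (real k) \<le> sqrt i + sqrt j" by (simp only: ij(1))
  then show ?thesis unfolding i_def j_def .
qed

lemma halving_induct [consumes 1, case_names one halve]:
  fixes P :: "nat \<Rightarrow> bool"
  assumes "1 \<le> n" "P 1"
    and "\<And>k. 2 \<le> k \<Longrightarrow> P (k div 2) \<Longrightarrow> P (k - k div 2) \<Longrightarrow> P k"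
  shows "P n"
  using assms(1)
proof (induction n rule: less_induct)
  case (less n)
  show ?case
  proof (cases "n = 1")
    case False
    then have "2 \<le> n" using less.prems by simp
    then have "1 \<le> n div 2" "n div 2 < n" "1 \<le> n - n div 2" "n - n div 2 < n" by auto
    then show ?thesis using assms(3)[OF \<open>2 \<le> n\<close>] less.IH by blast
  qed (use assms(2) in simp)
qed

text \<open>The allowance \<open>real k - sqrt (real k)\<close> leaves room at each halving: the
  roots of the halves exceed that of \<open>k\<close> by at least a third of it, whence the factor
  3. Peeling off one copy of \<open>n\<close> at a time would accumulate an error of order k^(3/2)
  instead.\<close>

lemma near_additive_multiple:
  fixes a :: "nat \<Rightarrow> real"
  assumes "0 \<le> C" and "\<And>i j. 1 \<le> i \<Longrightarrow> 1 \<le> j \<Longrightarrow> \<bar>a (i + j) - a i - a j\<bar> \<le> C * sqrt (real (i + j))"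
    and "1 \<le> n" "1 \<le> k"
  shows "\<bar>a (k * n) - real k * a n\<bar> \<le> 3 * C * sqrt (real n) * (real k - sqrt (real k))"
  using assms(4)
proof (induction k rule: halving_induct)
  case (halve k)
  define i where "i = k div 2"
  define j where "j = k - k div 2"
  have k: "k = i + j" "1 \<le> i" "1 \<le> j" using halve(1) by (auto simp: i_def j_def)
  have IH: "\<bar>a (i * n) - real i * a n\<bar> \<le> 3 * C * sqrt (real n) * (real i - sqrt (real i))"
    "\<bar>a (j * n) - real j * a n\<bar> \<le> 3 * C * sqrt (real n) * (real j - sqrt (real j))"
    using halve(2,3) by (simp_all only: i_def j_def)
  have "\<bar>a (i * n + j * n) - a (i * n) - a (j * n)\<bar> \<le> C * sqrt (real (i * n + j * n))"
    using assms(3) k by (intro assms(2)) auto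
  also have "\<dots> = C * sqrt (real n) * sqrt (real k)"
  proof -
    have "i * n + j * n = n * k" unfolding k(1) by (simp add: algebra_simps)
    then show ?thesis by (simp add: real_sqrt_mult)
  qed
  also have "\<dots> \<le> C * sqrt (real n) * (3 * (sqrt (real i) + sqrt (real j) - sqrt (real k)))"
  proof (rule mult_left_mono)
    have "4 / 3 * sqrt (real k) \<le> sqrt (real i) + sqrt (real j)"
      unfolding i_def j_def by (rule sqrt_halves[OF halve(1)])
    then show "sqrt (real k) \<le> 3 * (sqrt (real i) + sqrt (real j) - sqrt (real k))" by (simp add: field_simps)
  qed (use assms(1) in simp)
  finally have 1: "\<bar>a (i * n + j * n) - a (i * n) - a (j * n)\<bar>
      \<le> C * sqrt (real n) * (3 * (sqrt (real i) + sqrt (real j) - sqrt (real k)))" .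
  have "\<bar>a (k * n) - real k * a n\<bar> \<le> \<bar>a (i * n + j * n) - a (i * n) - a (j * n)\<bar>
      + \<bar>a (i * n) - real i * a n\<bar> + \<bar>a (j * n) - real j * a n\<bar>"
    unfolding k(1) by (simp add: distrib_right)
  also have "\<dots> \<le> C * sqrt (real n) * (3 * (sqrt (real i) + sqrt (real j) - sqrt (real k)))
      + 3 * C * sqrt (real n) * (real i - sqrt (real i)) + 3 * C * sqrt (real n) * (real j - sqrt (real j))"
    using 1 IH by linarith
  also have "\<dots> = 3 * C * sqrt (real n) * (real k - sqrt (real k))"
  proof -
    have "real k = real i + real j" by (simp add: k(1))
    then show ?thesis by (simp only: right_diff_distrib distrib_left mult.assoc mult.left_commute)
  qed
  finally show ?case .
next
  case one
  show ?case by simp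
qed

text \<open>Comparing \<open>n\<close> and \<open>m\<close> with their product shows that \<open>a n / n\<close> is a Cauchy sequence.\<close>

lemma near_additive_convergent:
  fixes a :: "nat \<Rightarrow> real"
  assumes "\<And>i j. 1 \<le> i \<Longrightarrow> 1 \<le> j \<Longrightarrow> \<bar>a (i + j) - a i - a j\<bar> \<le> C * sqrt (real (i + j))"
  shows "convergent (\<lambda>n. a n / real n)"
proof -
  define K where "K = 3 * \<bar>C\<bar>"
  have bound: "\<bar>a (k * n) / real (k * n) - a n / real n\<bar> \<le> K / sqrt (real n)" if "1 \<le> n" "1 \<le> k" for n k
  proof -
    have abs: "\<bar>a (i + j) - a i - a j\<bar> \<le> \<bar>C\<bar> * sqrt (real (i + j))" if "1 \<le> i" "1 \<le> j" for i j
      using assms[OF that] by (rule order_trans) (intro mult_right_mono, auto)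
    have "\<bar>a (k * n) - real k * a n\<bar> \<le> K * sqrt (real n) * (real k - sqrt (real k))"
      unfolding K_def using near_additive_multiple[of "\<bar>C\<bar>" a n k] abs that by auto
    also have "\<dots> \<le> K * sqrt (real n) * real k" by (intro mult_left_mono) (auto simp: K_def)
    finally have "\<bar>a (k * n) - real k * a n\<bar> / real (k * n) \<le> K * sqrt (real n) * real k / real (k * n)"
      by (intro divide_right_mono) auto
    also have "\<dots> = K / sqrt (real n)"
      using that by (simp add: field_simps real_sqrt_mult_self)
    finally have "\<bar>(a (k * n) - real k * a n) / real (k * n)\<bar> \<le> K / sqrt (real n)" by simp
    moreover have "(a (k * n) - real k * a n) / real (k * n) = a (k * n) / real (k * n) - a n / real n"
      using that by (simp add: field_simps)
    ultimately show ?thesis by (simp only:)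
  qed
  have lim: "(\<lambda>n. K / sqrt (real n)) \<longlonglongrightarrow> 0" by real_asymp
  have "Cauchy (\<lambda>n. a n / real n)"
  proof (rule metric_CauchyI)
    fix e :: real assume "0 < e"
    then have "eventually (\<lambda>n. K / sqrt (real n) < e / 2) sequentially"
      using order_tendstoD(2)[OF lim, of "e / 2"] by simp
    then obtain M where M: "K / sqrt (real n) < e / 2" if "M \<le> n" for n
      by (auto simp: eventually_sequentially)
    have "dist (a m / real m) (a n / real n) < e" if "max M 1 \<le> m" "max M 1 \<le> n" for m n
    proof -
      have "\<bar>a (m * n) / real (m * n) - a m / real m\<bar> \<le> K / sqrt (real m)"
        using bound[of m n] that by (simp add: mult.commute[of n m])
      moreover have "\<bar>a (m * n) / real (m * n) - a n / real n\<bar> \<le> K / sqrt (real n)"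
        using bound[of n m] that by simp
      moreover have "K / sqrt (real m) < e / 2" "K / sqrt (real n) < e / 2" using M that by auto
      ultimately show ?thesis unfolding dist_real_def by linarith
    qed
    then show "\<exists>M. \<forall>m\<ge>M. \<forall>n\<ge>M. dist (a m / real m) (a n / real n) < e" by blast
  qed
  then show ?thesis by (simp add: Cauchy_convergent_iff)
qed

text \<open>The error term contains the unknown \<open>v\<close> itself. The ansatz
  \<open>r\<^sup>2 * real n - b * sqrt (real n)\<close> turns it into a multiple of the square root
  of \<open>k\<close>, which the surplus of the negative term pays for.\<close>

lemma variance_linear_bound:
  fixes v :: "nat \<Rightarrow> real"
  assumes "\<And>n. 0 \<le> v n" "0 \<le> C"
    and "\<And>i j. 1 \<le> i \<Longrightarrow> 1 \<le> j \<Longrightarrow> v (i + j) \<le> v i + v j + 2 * C * sqrt (v i + v j) + C\<^sup>2"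
  shows "\<exists>K\<ge>0. \<forall>n\<ge>1. v n \<le> K * real n"
proof -
  \<comment> \<open>Two conditions fix the constants: \<open>b\<close> must be three times the
    coefficient \<open>2 * C * r + C\<^sup>2\<close> of the error, and the case \<open>n = 1\<close>
    needs \<open>v 1 + b \<le> r\<^sup>2\<close>. As \<open>b\<close> is linear in \<open>r\<close>,
    the summand \<open>6 * C\<close> together with \<open>1 \<le> r\<close> suffices.\<close>
  define r where "r = v 1 + 1 + 6 * C + 3 * C\<^sup>2"
  define b where "b = 3 * (2 * C * r + C\<^sup>2)"
  have r: "1 \<le> r" "r\<^sup>2 \<ge> v 1 + b"
  proof -
    show "1 \<le> r" using assms(1)[of 1] assms(2) by (simp add: r_def)
    then have "1 * (v 1 + 1 + 3 * C\<^sup>2) \<le> r * (v 1 + 1 + 3 * C\<^sup>2)"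
      using assms(1)[of 1] by (intro mult_right_mono) auto
    moreover have "r\<^sup>2 = r * (v 1 + 1 + 3 * C\<^sup>2) + 6 * C * r"
      by (simp add: r_def power2_eq_square algebra_simps)
    ultimately show "r\<^sup>2 \<ge> v 1 + b" unfolding b_def by (simp add: algebra_simps)
  qed
  have b0: "0 \<le> b" unfolding b_def using r(1) assms(2) by auto
  have main: "v n \<le> r\<^sup>2 * real n - b * sqrt (real n)" if "1 \<le> n" for n
    using that
  proof (induction n rule: halving_induct)
    case one
    then show ?case using r(2) by simp
  next
    case (halve k)
    define i where "i = k div 2"
    define j where "j = k - k div 2"
    have k: "k = i + j" "1 \<le> i" "1 \<le> j" using halve(1) by (auto simp: i_def j_def)
    have ij: "v i \<le> r\<^sup>2 * real i - b * sqrt (real i)" "v j \<le> r\<^sup>2 * real j - b * sqrt (real j)"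
      using halve(2,3) by (simp_all add: i_def j_def)
    have "0 \<le> b * sqrt (real i)" "0 \<le> b * sqrt (real j)" using b0 by auto
    moreover have rk: "r\<^sup>2 * real k = r\<^sup>2 * real i + r\<^sup>2 * real j" by (simp add: k(1) distrib_left)
    ultimately have "v i + v j \<le> r\<^sup>2 * real k" using ij by linarith
    then have "sqrt (v i + v j) \<le> r * sqrt (real k)"
      using r(1) real_sqrt_le_mono[of "v i + v j" "r\<^sup>2 * real k"] by (simp add: real_sqrt_mult)
    then have "2 * C * sqrt (v i + v j) \<le> 2 * C * (r * sqrt (real k))"
      using assms(2) by (intro mult_left_mono) auto
    moreover have "C\<^sup>2 * 1 \<le> C\<^sup>2 * sqrt (real k)"
      using halve(1) by (intro mult_left_mono) auto
    moreover have "b * (4 / 3 * sqrt (real k)) \<le> b * (sqrt (real i) + sqrt (real j))"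
      unfolding i_def j_def by (intro mult_left_mono sqrt_halves[OF halve(1)] b0)
    moreover have "v k \<le> v i + v j + 2 * C * sqrt (v i + v j) + C\<^sup>2"
      unfolding k(1) by (rule assms(3)[OF k(2,3)])
    moreover have "b * sqrt (real k) = 3 * (2 * C * (r * sqrt (real k))) + 3 * (C\<^sup>2 * sqrt (real k))"
      by (simp add: b_def algebra_simps)
    moreover have "b * (4 / 3 * sqrt (real k)) = b * sqrt (real k) + b * sqrt (real k) / 3" by simp
    moreover have "b * (sqrt (real i) + sqrt (real j)) = b * sqrt (real i) + b * sqrt (real j)"
      by (simp add: distrib_left)
    ultimately show ?case using ij rk by linarith
  qed
  have "v n \<le> r\<^sup>2 * real n" if "1 \<le> n" for n
    using main[OF that] mult_nonneg_nonneg[OF b0, of "sqrt (real n)"] by simp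
  then show ?thesis by (intro exI[of _ "r\<^sup>2"]) auto
qed

section \<open>Nearly additive processes\<close>

context prob_space
begin

lemma integrable_bounded:
  fixes X :: "'a \<Rightarrow> real"
  assumes "random_variable borel X" "\<And>x. x \<in> space M \<Longrightarrow> \<bar>X x\<bar> \<le> B"
  shows "integrable M X"
  by (rule integrable_const_bound[of _ B]) (use assms in auto)

lemma expectation_abs_le_sqrt:
  fixes X :: "'a \<Rightarrow> real"
  assumes "random_variable borel X" "integrable M (\<lambda>x. (X x)\<^sup>2)"
  shows "expectation (\<lambda>x. \<bar>X x\<bar>) \<le> sqrt (expectation (\<lambda>x. (X x)\<^sup>2))"
proof -
  have "integrable M X" using square_integrable_imp_integrable[OF assms] .
  then have "variance (\<lambda>x. \<bar>X x\<bar>) = expectation (\<lambda>x. (\<bar>X x\<bar>)\<^sup>2) - (expectation (\<lambda>x. \<bar>X x\<bar>))\<^sup>2"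
    using assms by (intro variance_eq) auto
  moreover have "0 \<le> variance (\<lambda>x. \<bar>X x\<bar>)" by (intro integral_nonneg_AE) auto
  ultimately have "(expectation (\<lambda>x. \<bar>X x\<bar>))\<^sup>2 \<le> expectation (\<lambda>x. (X x)\<^sup>2)" by simp
  then show ?thesis by (rule real_le_rsqrt)
qed

text \<open>The covariance with \<open>R\<close> is estimated through the standard deviation of
  \<open>X\<close>. The bound \<open>B\<close> serves integrability only and stays out of the
  estimate, since in the application it grows linearly with the length.\<close>

lemma variance_perturbation:
  fixes X R :: "'a \<Rightarrow> real"
  assumes rv: "random_variable borel X" "random_variable borel R"
    and bdd: "\<And>x. x \<in> space M \<Longrightarrow> \<bar>X x\<bar> \<le> B" "\<And>x. x \<in> space M \<Longrightarrow> \<bar>R x\<bar> \<le> C" and "0 \<le> C"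
  shows "\<bar>variance (\<lambda>x. X x + R x) - variance X\<bar> \<le> 2 * C * sqrt (variance X) + C\<^sup>2"
proof -
  note [measurable] = rv
  define y where "y x = X x - expectation X" for x
  have [measurable]: "random_variable borel y" unfolding y_def by simp
  have iX: "integrable M X" "integrable M R" using integrable_bounded rv bdd by blast+
  have y: "\<bar>y x\<bar> \<le> B + \<bar>expectation X\<bar>" if "x \<in> space M" for x using bdd(1)[OF that] by (simp add: y_def)
  have B: "0 \<le> B" using bdd(1) not_empty by fastforce
  have iy: "integrable M y" "integrable M (\<lambda>x. \<bar>y x\<bar>)" using iX unfolding y_def[abs_def] by auto
  have yR: "\<bar>y x * R x\<bar> \<le> (B + \<bar>expectation X\<bar>) * C" if "x \<in> space M" for x
    unfolding abs_mult using y[OF that] bdd(2)[OF that] B by (intro mult_mono) auto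
  have iyR: "integrable M (\<lambda>x. y x * R x)" using yR by (intro integrable_bounded) auto
  have iy2: "integrable M (\<lambda>x. (y x)\<^sup>2)"
  proof (rule integrable_bounded)
    show "\<bar>(y x)\<^sup>2\<bar> \<le> (B + \<bar>expectation X\<bar>)\<^sup>2" if "x \<in> space M" for x
      using y[OF that] by (simp add: abs_le_square_iff[symmetric])
  qed simp
  have R2: "(R x)\<^sup>2 \<le> C\<^sup>2" if "x \<in> space M" for x
    using bdd(2)[OF that] by (simp add: abs_le_square_iff[symmetric])
  have iR2: "integrable M (\<lambda>x. (R x)\<^sup>2)" using R2 by (intro integrable_bounded) auto
  define a where "a = expectation (\<lambda>x. y x * R x)"
  have vX: "variance X = expectation (\<lambda>x. (y x)\<^sup>2)" by (simp add: y_def)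
  have Ey: "expectation y = 0" using iX by (simp add: y_def[abs_def] prob_space)
  have "variance (\<lambda>x. X x + R x) = expectation (\<lambda>x. (y x)\<^sup>2 + 2 * (y x * R x) - 2 * expectation R * y x
      + ((R x)\<^sup>2 - 2 * expectation R * R x + (expectation R)\<^sup>2))"
    using iX by (intro Bochner_Integration.integral_cong) (auto simp: y_def power2_eq_square algebra_simps)
  also have "\<dots> = variance X + 2 * a + (expectation (\<lambda>x. (R x)\<^sup>2) - (expectation R)\<^sup>2)"
    unfolding vX using iX iy iyR iy2 iR2 Ey by (simp add: a_def prob_space power2_eq_square)
  also have "expectation (\<lambda>x. (R x)\<^sup>2) - (expectation R)\<^sup>2 = variance R"
    by (rule variance_eq[symmetric]) (use iX iR2 in auto)
  finally have eq: "variance (\<lambda>x. X x + R x) - variance X = 2 * a + variance R" by simp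
  have "\<bar>a\<bar> \<le> expectation (\<lambda>x. \<bar>y x * R x\<bar>)" unfolding a_def by (rule integral_abs_bound)
  also have "\<dots> \<le> expectation (\<lambda>x. C * \<bar>y x\<bar>)"
  proof (rule integral_mono)
    show "\<bar>y x * R x\<bar> \<le> C * \<bar>y x\<bar>" if "x \<in> space M" for x
      unfolding abs_mult using bdd(2)[OF that] by (subst mult.commute) (intro mult_right_mono, auto)
  qed (use iy iyR in auto)
  also have "\<dots> = C * expectation (\<lambda>x. \<bar>y x\<bar>)" by simp
  also have "\<dots> \<le> C * sqrt (variance X)"
    unfolding vX using assms(5) by (intro mult_left_mono expectation_abs_le_sqrt iy2) auto
  finally have a: "\<bar>a\<bar> \<le> C * sqrt (variance X)" .
  have "expectation (\<lambda>x. (R x)\<^sup>2) \<le> expectation (\<lambda>x. C\<^sup>2)" using iR2 R2 by (intro integral_mono) auto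
  then have "variance R \<le> C\<^sup>2"
    using variance_eq[OF iX(2) iR2] by (simp add: prob_space) (smt (verit) zero_le_power2)
  moreover have "0 \<le> variance R" by (intro integral_nonneg_AE) auto
  ultimately show ?thesis using a eq by linarith
qed

lemma variance_indep_sum:
  fixes X Y :: "'a \<Rightarrow> real"
  assumes ind: "indep_var borel X borel Y"
    and bdd: "\<And>x. x \<in> space M \<Longrightarrow> \<bar>X x\<bar> \<le> B" "\<And>x. x \<in> space M \<Longrightarrow> \<bar>Y x\<bar> \<le> B"
  shows "variance (\<lambda>x. X x + Y x) = variance X + variance Y"
proof -
  have rv [measurable]: "random_variable borel X" "random_variable borel Y"
    using indep_var_rv1[OF ind] indep_var_rv2[OF ind] by auto
  have B: "0 \<le> B" using bdd(1) not_empty by fastforce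
  have i: "integrable M X" "integrable M Y" using integrable_bounded rv bdd by blast+
  have XY: "\<bar>X x * Y x\<bar> \<le> B * B" if "x \<in> space M" for x
    unfolding abs_mult using bdd[OF that] B by (intro mult_mono) auto
  have sq: "(X x)\<^sup>2 \<le> B\<^sup>2" "(Y x)\<^sup>2 \<le> B\<^sup>2" if "x \<in> space M" for x
    using bdd[OF that] by (simp_all add: abs_le_square_iff[symmetric])
  have i2: "integrable M (\<lambda>x. X x * Y x)" "integrable M (\<lambda>x. (X x)\<^sup>2)" "integrable M (\<lambda>x. (Y x)\<^sup>2)"
    using XY sq by (auto intro!: integrable_bounded)
  have E: "expectation (\<lambda>x. X x * Y x) = expectation X * expectation Y"
    by (rule indep_var_lebesgue_integral[OF ind i])
  have s: "integrable M (\<lambda>x. (X x + Y x)\<^sup>2)"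
    using i2 by (simp add: power2_sum mult.assoc)
  have "variance (\<lambda>x. X x + Y x) = expectation (\<lambda>x. (X x + Y x)\<^sup>2) - (expectation (\<lambda>x. X x + Y x))\<^sup>2"
    by (rule variance_eq) (use i s in auto)
  also have "\<dots> = expectation (\<lambda>x. (X x)\<^sup>2) + expectation (\<lambda>x. (Y x)\<^sup>2) + 2 * (expectation X * expectation Y)
      - (expectation X + expectation Y)\<^sup>2"
    using i i2 E by (simp add: power2_sum mult.assoc)
  also have "\<dots> = variance X + variance Y"
    using variance_eq[OF i(1) i2(2)] variance_eq[OF i(2) i2(3)] by (simp add: power2_eq_square algebra_simps)
  finally show ?thesis .
qed

text \<open>\<open>Y\<close> stands for the statistic of the translated second piece; of its law
  only the mean and the variance are compared with those of \<open>X j\<close>. The constant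
  \<open>C\<close> does not depend on \<open>i\<close> and \<open>j\<close>.\<close>

lemma near_additive_process:
  fixes X :: "nat \<Rightarrow> 'a \<Rightarrow> real"
  assumes bdd: "\<And>n. \<exists>B. \<forall>x. \<bar>X n x\<bar> \<le> B"
    and split: "\<And>i j. 1 \<le> i \<Longrightarrow> 1 \<le> j \<Longrightarrow> \<exists>Y. indep_var borel (X i) borel Y \<and> (\<exists>B. \<forall>x. \<bar>Y x\<bar> \<le> B) \<and>
      expectation Y = expectation (X j) \<and> variance Y = variance (X j) \<and>
      (\<forall>x. \<bar>X (i + j) x - X i x - Y x\<bar> \<le> C)"
    and rv: "\<And>n. random_variable borel (X n)"
  shows "convergent (\<lambda>n. expectation (X n) / real n)"
    and "convergent (\<lambda>n. variance (X n) / real n)"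
    and "\<exists>K\<ge>0. \<forall>n\<ge>1. variance (X n) \<le> K * real n"
proof -
  have C: "0 \<le> C" using split[of 1 1] by (force intro: order_trans[OF abs_ge_zero])
  have E: "\<bar>expectation (X (i + j)) - expectation (X i) - expectation (X j)\<bar> \<le> C"
    and V: "\<bar>variance (X (i + j)) - (variance (X i) + variance (X j))\<bar>
      \<le> 2 * C * sqrt (variance (X i) + variance (X j)) + C\<^sup>2" if ij: "1 \<le> i" "1 \<le> j" for i j
  proof -
    obtain Y B' where Y: "indep_var borel (X i) borel Y" "\<And>x. \<bar>Y x\<bar> \<le> B'" "expectation Y = expectation (X j)"
      "variance Y = variance (X j)" "\<And>x. \<bar>X (i + j) x - X i x - Y x\<bar> \<le> C"
      using split[OF ij] by blast
    obtain B where B: "\<And>x. \<bar>X i x\<bar> \<le> B" using bdd[of i] by blast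
    have [measurable]: "random_variable borel Y" "\<And>n. random_variable borel (X n)"
      using indep_var_rv2[OF Y(1)] rv by auto
    have iX: "integrable M (X n)" for n using bdd[of n] rv integrable_bounded by blast
    have iY: "integrable M Y" using Y(2) by (intro integrable_bounded) auto
    have "\<bar>expectation (\<lambda>x. X (i + j) x - X i x - Y x)\<bar> \<le> expectation (\<lambda>x. \<bar>X (i + j) x - X i x - Y x\<bar>)"
      by (rule integral_abs_bound)
    also have "\<dots> \<le> expectation (\<lambda>x. C)" using iX iY Y(5) by (intro integral_mono) auto
    finally show "\<bar>expectation (X (i + j)) - expectation (X i) - expectation (X j)\<bar> \<le> C"
      using iX iY Y(3) by (simp add: prob_space)
    have "\<bar>variance (\<lambda>x. (X i x + Y x) + (X (i + j) x - X i x - Y x)) - variance (\<lambda>x. X i x + Y x)\<bar>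
      \<le> 2 * C * sqrt (variance (\<lambda>x. X i x + Y x)) + C\<^sup>2"
    proof (rule variance_perturbation)
      show "\<bar>X i x + Y x\<bar> \<le> B + B'" for x using B[of x] Y(2)[of x] by linarith
    qed (use Y(5) C in auto)
    moreover have "variance (\<lambda>x. X i x + Y x) = variance (X i) + variance (X j)"
      using variance_indep_sum[OF Y(1), of "max B B'"] B Y(2,4) by (simp add: le_max_iff_disj)
    ultimately show "\<bar>variance (X (i + j)) - (variance (X i) + variance (X j))\<bar>
      \<le> 2 * C * sqrt (variance (X i) + variance (X j)) + C\<^sup>2" by simp
  qed
  have v0: "0 \<le> variance (X n)" for n by (intro integral_nonneg_AE) auto
  show "convergent (\<lambda>n. expectation (X n) / real n)"
  proof (rule near_additive_convergent)
    fix i j :: nat assume ij: "1 \<le> i" "1 \<le> j"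
    then have "C * 1 \<le> C * sqrt (real (i + j))" using C by (intro mult_left_mono) auto
    then show "\<bar>expectation (X (i + j)) - expectation (X i) - expectation (X j)\<bar> \<le> C * sqrt (real (i + j))"
      using E[OF ij] by linarith
  qed
  define v where "v n = variance (X n)" for n
  note v0' = v0[folded v_def] and V' = V[folded v_def]
  have "\<exists>K\<ge>0. \<forall>n\<ge>1. v n \<le> K * real n"
  proof (rule variance_linear_bound[OF v0' C])
    show "v (i + j) \<le> v i + v j + 2 * C * sqrt (v i + v j) + C\<^sup>2" if "1 \<le> i" "1 \<le> j" for i j
      using V'[OF that] by linarith
  qed
  then show "\<exists>K\<ge>0. \<forall>n\<ge>1. variance (X n) \<le> K * real n" unfolding v_def .
  from \<open>\<exists>K\<ge>0. \<forall>n\<ge>1. v n \<le> K * real n\<close>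
  obtain K where K: "0 \<le> K" "\<And>n. 1 \<le> n \<Longrightarrow> v n \<le> K * real n" by blast
  \<comment> \<open>Only now, with \<open>v\<close> known to grow at most linearly, is the cross
    term of order \<open>sqrt (real (i + j))\<close>, as \<open>near_additive_convergent\<close>
    demands.\<close>
  have "convergent (\<lambda>n. v n / real n)"
  proof (rule near_additive_convergent[where C = "2 * C * sqrt K + C\<^sup>2"])
    fix i j :: nat assume ij: "1 \<le> i" "1 \<le> j"
    have "v i + v j \<le> K * real (i + j)"
      using K(2)[OF ij(1)] K(2)[OF ij(2)] by (simp add: algebra_simps)
    then have "sqrt (v i + v j) \<le> sqrt K * sqrt (real (i + j))"
      by (simp flip: real_sqrt_mult)
    then have "2 * C * sqrt (v i + v j) \<le> 2 * C * (sqrt K * sqrt (real (i + j)))"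
      using C by (intro mult_left_mono) auto
    moreover have "C\<^sup>2 * 1 \<le> C\<^sup>2 * sqrt (real (i + j))" using ij by (intro mult_left_mono) auto
    ultimately show "\<bar>v (i + j) - v i - v j\<bar> \<le> (2 * C * sqrt K + C\<^sup>2) * sqrt (real (i + j))"
      using V'[OF ij] by (simp add: algebra_simps)
  qed
  then show "convergent (\<lambda>n. variance (X n) / real n)" unfolding v_def .
qed

end

section \<open>Convergence in probability from a linear variance bound\<close>

text \<open>Chebyshev's inequality for each \<open>n\<close> separately, as no common probability
  space is available. Half of \<open>\<delta>\<close> is spent on the distance of the mean from its
  limit.\<close>

lemma tendsto_in_prob_variance:
  fixes M :: "nat \<Rightarrow> 'w measure" and X :: "nat \<Rightarrow> 'w \<Rightarrow> real"
  assumes P: "\<And>n. 1 \<le> n \<Longrightarrow> prob_space (M n)"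
    and rv: "\<And>n. 1 \<le> n \<Longrightarrow> X n \<in> borel_measurable (M n)"
    and sq: "\<And>n. 1 \<le> n \<Longrightarrow> integrable (M n) (\<lambda>x. (X n x)\<^sup>2)"
    and var: "\<And>n. 1 \<le> n \<Longrightarrow> prob_space.variance (M n) (X n) \<le> K * real n"
    and lim: "(\<lambda>n. integral\<^sup>L (M n) (X n) / real n) \<longlonglongrightarrow> u"
  shows "tendsto_in_prob M (\<lambda>n x. X n x / real n) u"
  unfolding tendsto_in_prob_def
proof (intro allI impI)
  fix \<delta> :: real assume \<delta>: "0 < \<delta>"
  let ?p = "\<lambda>n. measure (M n) {x \<in> space (M n). \<delta> < \<bar>X n x / real n - u\<bar>}"
  have ev: "eventually (\<lambda>n. \<bar>integral\<^sup>L (M n) (X n) / real n - u\<bar> < \<delta> / 2) sequentially"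
    using tendstoD[OF lim, of "\<delta> / 2"] \<delta> by (simp add: dist_real_def)
  have "eventually (\<lambda>n. ?p n \<le> 4 * K / \<delta>\<^sup>2 / real n) sequentially"
    using ev eventually_ge_at_top[of 1]
  proof eventually_elim
    case (elim n)
    interpret prob_space "M n" by (rule P[OF elim(2)])
    note [measurable] = rv[OF elim(2)]
    have n: "0 < real n" using elim(2) by simp
    have "{x \<in> space (M n). \<delta> < \<bar>X n x / real n - u\<bar>} \<subseteq>
        {x \<in> space (M n). \<delta> / 2 * real n \<le> \<bar>X n x - expectation (X n)\<bar>}"
    proof safe
      fix x assume "\<delta> < \<bar>X n x / real n - u\<bar>"
      then have "\<delta> / 2 \<le> \<bar>X n x / real n - expectation (X n) / real n\<bar>" using elim(1) by linarith
      also have "\<dots> = \<bar>X n x - expectation (X n)\<bar> / real n" by (simp add: diff_divide_distrib[symmetric])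
      finally show "\<delta> / 2 * real n \<le> \<bar>X n x - expectation (X n)\<bar>" using n by (simp add: field_simps)
    qed
    then have "?p n \<le> prob {x \<in> space (M n). \<delta> / 2 * real n \<le> \<bar>X n x - expectation (X n)\<bar>}"
      by (intro finite_measure_mono) auto
    also have "\<dots> \<le> variance (X n) / (\<delta> / 2 * real n)\<^sup>2"
      using sq[OF elim(2)] \<delta> n by (intro Chebyshev_inequality) auto
    also have "\<dots> \<le> K * real n / (\<delta> / 2 * real n)\<^sup>2"
      using var[OF elim(2)] by (intro divide_right_mono) auto
    also have "\<dots> = 4 * K / \<delta>\<^sup>2 / real n" using n by (simp add: power2_eq_square field_simps)
    finally show ?case .
  qed
  then show "?p \<longlonglongrightarrow> 0"
    by (rule tendsto_sandwich[OF always_eventually[OF allI[OF measure_nonneg]] _ tendsto_const lim_const_over_n])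
qed

section \<open>The infinite strip with independent weights\<close>

text \<open>All columns in \<open>nat\<close> are present, also column 0, which lies in no cylinder:
  translations then preserve the strip, and every cylinder is an induced subgraph of it.\<close>

definition strip_edges :: "'a set \<Rightarrow> 'a set set \<Rightarrow> (nat \<times> 'a) set set" where
  "strip_edges VH EH = cartesian_edges UNIV (range (\<lambda>i. {i, Suc i})) VH EH"

text \<open>A weight configuration is a function on the disjoint sum of the vertices (\<open>Inl\<close>) and the edges
  (\<open>Inr\<close>). Absorbing the vertex weights into the edges changes the Hamiltonian by a constant only.\<close>

definition edge_weight :: "('v + 'v set \<Rightarrow> real) \<Rightarrow> 'v set \<Rightarrow> real" where
  "edge_weight \<omega> e = exp (\<omega> (Inr e) - (\<Sum>v\<in>e. \<omega> (Inl v)))"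

definition shift :: "nat \<Rightarrow> nat \<times> 'a \<Rightarrow> nat \<times> 'a" where
  "shift k v = (fst v + k, snd v)"

definition shift_index :: "nat \<Rightarrow> (nat \<times> 'a) + (nat \<times> 'a) set \<Rightarrow> (nat \<times> 'a) + (nat \<times> 'a) set" where
  "shift_index k = map_sum (shift k) ((`) (shift k))"

lemma edge_weight_pos: "0 < edge_weight \<omega> e"
  by (simp add: edge_weight_def)

lemma inj_shift: "inj (shift k)"
  by (auto simp: inj_def shift_def prod_eq_iff)

lemma inj_shift_index: "inj (shift_index k)"
  unfolding shift_index_def
  by (intro sum.inj_map inj_shift injI) (simp add: inj_image_eq_iff[OF inj_shift])

lemma edge_weight_shift: "edge_weight \<omega> (shift k ` e) = edge_weight (\<lambda>i. \<omega> (shift_index k i)) e"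
  by (simp add: edge_weight_def shift_index_def sum.reindex inj_on_subset[OF inj_shift])

lemma edge_weight_restrict:
  "e \<in> induced E A \<Longrightarrow> edge_weight (restrict \<omega> (A <+> induced E A)) e = edge_weight \<omega> e"
  unfolding edge_weight_def by (subst sum.cong[of e e _ "\<lambda>v. \<omega> (Inl v)"]) (auto simp: induced_def)

section \<open>Gibbs averages as quotients of matching sums\<close>

context
  fixes E :: "'v set set" and V :: "'v set" and \<nu> :: "'v \<Rightarrow> real" and \<omega> :: "'v set \<Rightarrow> real"
  assumes card2: "\<And>e. e \<in> E \<Longrightarrow> card e = 2" and finV: "finite V"
begin

abbreviation (input) "ew \<equiv> edge_weight (case_sum \<nu> \<omega>)"

lemma sum_vertices_matching:
  assumes "m \<in> matchings (induced E V)"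
  shows "(\<Sum>v\<in>unpaired V m. f v) = (\<Sum>v\<in>V. f v) - (\<Sum>e\<in>m. \<Sum>v\<in>e. (f v :: real))"
proof -
  have m: "\<And>e. e \<in> m \<Longrightarrow> e \<subseteq> V" "disjoint m" using assms by (auto simp: matchings_def induced_def)
  have "(\<Sum>v\<in>\<Union>m. f v) = (\<Sum>e\<in>m. \<Sum>v\<in>e. f v)"
    using m by (subst sum.Union_disjoint) (auto simp: disjoint_def intro: finite_subset[OF _ finV])
  moreover have "\<Union>m \<subseteq> V" using m by auto
  ultimately show ?thesis using finV by (simp add: unpaired_def sum_diff)
qed

lemma hamiltonian_eq:
  assumes "m \<in> matchings (induced E V)"
  shows "exp (hamiltonian V \<nu> \<omega> m) = exp (\<Sum>v\<in>V. \<nu> v) * (\<Prod>e\<in>m. ew e)"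
proof -
  have "finite m" using finite_matching[OF finV assms] .
  moreover have "hamiltonian V \<nu> \<omega> m = (\<Sum>v\<in>V. \<nu> v) + (\<Sum>e\<in>m. \<omega> e - (\<Sum>v\<in>e. \<nu> v))"
    unfolding hamiltonian_def sum_vertices_matching[OF assms] by (simp add: sum_subtractf)
  ultimately show ?thesis by (simp add: exp_add exp_sum edge_weight_def)
qed

lemma num_unpaired_eq:
  assumes "m \<in> matchings (induced E V)"
  shows "num_unpaired V m = real (card V) - 2 * real (card m)"
proof -
  have "(\<Sum>e\<in>m. \<Sum>v\<in>e. 1 :: real) = (\<Sum>e\<in>m. 2)"
    using assms card2 by (intro sum.cong) (auto simp: matchings_def induced_def)
  then show ?thesis
    using sum_vertices_matching[OF assms, of "\<lambda>_. 1"] by (simp add: num_unpaired_def)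
qed

lemma gibbs_average_eq:
  assumes "\<And>m. m \<in> matchings (induced E V) \<Longrightarrow> X m = g (card m)"
  shows "gibbs_average V (induced E V) \<nu> \<omega> X = matching_sum E ew g V / matching_Z E ew V"
proof -
  let ?M = "matchings (induced E V)"
  let ?c = "exp (\<Sum>v\<in>V. \<nu> v)"
  have Z: "partition_function V (induced E V) \<nu> \<omega> = ?c * matching_Z E ew V"
    unfolding partition_function_def matching_Z_def matching_sum_def
    by (simp add: hamiltonian_eq sum_distrib_left)
  have "gibbs_average V (induced E V) \<nu> \<omega> X
      = (\<Sum>m\<in>?M. g (card m) * (?c * (\<Prod>e\<in>m. ew e) / (?c * matching_Z E ew V)))"
    unfolding gibbs_average_def gibbs_def Z
    by (intro sum.cong refl) (simp only: assms hamiltonian_eq)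
  also have "\<dots> = matching_sum E ew g V / matching_Z E ew V"
    by (simp add: matching_sum_def sum_divide_distrib)
  finally show ?thesis .
qed

lemma U_mean_eq: "U_mean V (induced E V) \<nu> \<omega> = real (card V) - 2 * edge_mean E ew V"
  and U_quenched_var_eq: "U_quenched_var V (induced E V) \<nu> \<omega> = 4 * edge_var E ew V"
proof -
  interpret weighted_graph E ew
    using card2 by unfold_locales (auto intro: less_imp_le edge_weight_pos)
  let ?h = "real (card V)"
  have Z: "1 \<le> Z V" by (rule Z_ge_1[OF finV])
  have 1: "gibbs_average V (induced E V) \<nu> \<omega> (num_unpaired V)
      = msum (\<lambda>k. 0 * (real k)\<^sup>2 + (-2) * real k + ?h) V / Z V"
    by (rule gibbs_average_eq) (simp add: num_unpaired_eq)
  also have "\<dots> = ?h - 2 * mean V"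
    unfolding msum_quadratic msum_mean[OF finV] using Z by (simp add: field_simps)
  finally have m: "gibbs_average V (induced E V) \<nu> \<omega> (num_unpaired V) = ?h - 2 * mean V" .
  then show "U_mean V (induced E V) \<nu> \<omega> = ?h - 2 * mean V" by (simp add: U_mean_def)
  have "gibbs_average V (induced E V) \<nu> \<omega> (\<lambda>m. (num_unpaired V m)\<^sup>2)
      = msum (\<lambda>k. 4 * (real k)\<^sup>2 + (- 4 * ?h) * real k + ?h\<^sup>2) V / Z V"
    by (rule gibbs_average_eq) (simp add: num_unpaired_eq power2_eq_square algebra_simps)
  also have "\<dots> = 4 * (var V + (mean V)\<^sup>2) - 4 * ?h * mean V + ?h\<^sup>2"
    unfolding msum_quadratic msum_mean[OF finV] msum_sq[OF finV] using Z by (simp add: field_simps)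
  finally show "U_quenched_var V (induced E V) \<nu> \<omega> = 4 * var V"
    unfolding U_quenched_var_def m by (simp add: power2_eq_square algebra_simps)
qed

end

text \<open>Only the laws are fixed, no weights. The space \<open>\<Omega>\<close> below is the
  product over the whole index type, including sets that are not edges, so that translations act on
  a single space.\<close>

locale cylinder_model =
  fixes VH :: "'a set" and EH :: "'a set set" and N W :: "real measure"
  assumes graph: "simple_graph VH EH" and VH: "VH \<noteq> {}"
    and prob_N: "prob_space N" and sets_N: "sets N = sets borel"
    and prob_W: "prob_space W" and sets_W: "sets W = sets borel"
begin

abbreviation "S \<equiv> strip_edges VH EH"
abbreviation "cyl \<equiv> cyl_verts VH"
abbreviation law :: "(nat \<times> 'a) + (nat \<times> 'a) set \<Rightarrow> real measure" where
  "law \<equiv> case_sum (\<lambda>_. N) (\<lambda>_. W)"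
abbreviation "coords A \<equiv> A <+> induced S A"
abbreviation "\<Omega> \<equiv> Pi\<^sub>M UNIV law"

section \<open>Edges of the strip and of its cylinders\<close>

lemma finite_VH: "finite VH" and edge_VH: "e \<in> EH \<Longrightarrow> e \<subseteq> VH \<and> card e = 2"
  using graph by (auto simp: simple_graph_def)

lemma finite_cyl: "finite (cyl n)"
  using finite_VH by (simp add: cyl_verts_def)

lemma strip_edge_iff:
  "e \<in> S \<longleftrightarrow> (\<exists>i j. j \<in> VH \<and> e = {(i, j), (Suc i, j)}) \<or>
    (\<exists>i j j'. j \<in> VH \<and> j' \<in> VH \<and> {j, j'} \<in> EH \<and> e = {(i, j), (i, j')})"
  (is "_ \<longleftrightarrow> ?A \<or> ?B")
proof
  assume "e \<in> S"
  then obtain i j i' j' where e: "e = {(i, j), (i', j')}" "j \<in> VH" "j' \<in> VH"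
    "{i, i'} \<in> range (\<lambda>k. {k, Suc k}) \<and> j = j' \<or> i = i' \<and> {j, j'} \<in> EH"
    unfolding strip_edges_def cartesian_edges_def by blast
  from e(4) show "?A \<or> ?B"
  proof (elim disjE conjE rangeE)
    fix k assume "{i, i'} = {k, Suc k}" "j = j'"
    then have "e = {(k, j), (Suc k, j)}" using e(1) by (auto simp: doubleton_eq_iff)
    then show ?thesis using e(2) by blast
  next
    assume "i = i'" "{j, j'} \<in> EH"
    then show ?thesis using e by blast
  qed
next
  assume "?A \<or> ?B"
  then show "e \<in> S"
  proof
    assume ?A
    then obtain i j where "j \<in> VH" "e = {(i, j), (Suc i, j)}" by blast
    then show ?thesis unfolding strip_edges_def cartesian_edges_def
      by (intro CollectI exI[of _ i] exI[of _ j] exI[of _ "Suc i"]) auto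
  next
    assume ?B
    then show ?thesis unfolding strip_edges_def cartesian_edges_def by blast
  qed
qed

lemma card_strip_edge: "e \<in> S \<Longrightarrow> card e = 2"
  unfolding strip_edge_iff using edge_VH by (fastforce simp: card_insert_if)

lemma cyl_edges_eq: "cyl_edges VH EH n = induced S (cyl n)"
proof (intro equalityI subsetI)
  fix e assume "e \<in> cyl_edges VH EH n"
  then show "e \<in> induced S (cyl n)"
    unfolding cyl_edges_def cartesian_edges_def path_edges_def strip_edges_def induced_def cyl_verts_def
    by blast
next
  fix e assume "e \<in> induced S (cyl n)"
  then have e: "e \<in> S" "e \<subseteq> cyl n" by (auto simp: induced_def)
  from e(1) show "e \<in> cyl_edges VH EH n"
    unfolding strip_edge_iff
  proof (elim disjE exE conjE)
    fix i j assume ij: "j \<in> VH" "e = {(i, j), (Suc i, j)}"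
    then have "{i, Suc i} \<in> path_edges n" "i \<in> {1..n}" "Suc i \<in> {1..n}"
      using e(2) by (auto simp: path_edges_def cyl_verts_def)
    then show ?thesis unfolding cyl_edges_def cartesian_edges_def using ij by blast
  next
    fix i j j' assume ij: "j \<in> VH" "j' \<in> VH" "{j, j'} \<in> EH" "e = {(i, j), (i, j')}"
    then have "i \<in> {1..n}" using e(2) by (auto simp: cyl_verts_def)
    then show ?thesis unfolding cyl_edges_def cartesian_edges_def using ij by blast
  qed
qed

lemma shift_strip_edge: "shift k ` e \<in> S \<longleftrightarrow> e \<in> S"
proof
  assume "e \<in> S"
  then show "shift k ` e \<in> S"
    unfolding strip_edge_iff
  proof (elim disjE exE conjE)
    fix i j assume "j \<in> VH" "e = {(i, j), (Suc i, j)}"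
    then show "(\<exists>i j. j \<in> VH \<and> shift k ` e = {(i, j), (Suc i, j)}) \<or>
      (\<exists>i j j'. j \<in> VH \<and> j' \<in> VH \<and> {j, j'} \<in> EH \<and> shift k ` e = {(i, j), (i, j')})"
      by (intro disjI1 exI[of _ "i + k"] exI[of _ j]) (simp add: shift_def)
  next
    fix i j j' assume "j \<in> VH" "j' \<in> VH" "{j, j'} \<in> EH" "e = {(i, j), (i, j')}"
    then show "(\<exists>i j. j \<in> VH \<and> shift k ` e = {(i, j), (Suc i, j)}) \<or>
      (\<exists>i j j'. j \<in> VH \<and> j' \<in> VH \<and> {j, j'} \<in> EH \<and> shift k ` e = {(i, j), (i, j')})"
      by (intro disjI2 exI[of _ "i + k"] exI[of _ j] exI[of _ j']) (simp add: shift_def)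
  qed
next
  assume "shift k ` e \<in> S"
  then show "e \<in> S"
    unfolding strip_edge_iff
  proof (elim disjE exE conjE)
    fix i j assume ij: "j \<in> VH" "shift k ` e = {(i, j), (Suc i, j)}"
    then have "(i, j) \<in> shift k ` e" by simp
    then obtain a where a: "i = a + k" by (auto simp: shift_def)
    then have "shift k ` e = shift k ` {(a, j), (Suc a, j)}" using ij by (simp add: shift_def)
    then have "e = {(a, j), (Suc a, j)}" by (simp only: inj_image_eq_iff[OF inj_shift])
    then show "(\<exists>i j. j \<in> VH \<and> e = {(i, j), (Suc i, j)}) \<or>
      (\<exists>i j j'. j \<in> VH \<and> j' \<in> VH \<and> {j, j'} \<in> EH \<and> e = {(i, j), (i, j')})" using ij by blast
  next
    fix i j j' assume ij: "j \<in> VH" "j' \<in> VH" "{j, j'} \<in> EH" "shift k ` e = {(i, j), (i, j')}"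
    then have "(i, j) \<in> shift k ` e" by simp
    then obtain a where a: "i = a + k" by (auto simp: shift_def)
    then have "shift k ` e = shift k ` {(a, j), (a, j')}" using ij by (simp add: shift_def)
    then have "e = {(a, j), (a, j')}" by (simp only: inj_image_eq_iff[OF inj_shift])
    then show "(\<exists>i j. j \<in> VH \<and> e = {(i, j), (Suc i, j)}) \<or>
      (\<exists>i j j'. j \<in> VH \<and> j' \<in> VH \<and> {j, j'} \<in> EH \<and> e = {(i, j), (i, j')})" using ij by blast
  qed
qed

lemma weighted: "weighted_graph S (edge_weight \<omega>)"
  using card_strip_edge by unfold_locales (auto intro: less_imp_le edge_weight_pos)

section \<open>The product measure of the weights\<close>

lemma prob_law: "prob_space (law i)"
  using prob_N prob_W by (cases i) auto

lemma sets_law [measurable_cong]: "sets (law i) = sets borel"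
  using sets_N sets_W by (cases i) auto

sublocale prob_space \<Omega>
  by (intro prob_space_PiM prob_law)

lemma measurable_coordinate: "i \<in> J \<Longrightarrow> (\<lambda>\<omega>. \<omega> i) \<in> borel_measurable (Pi\<^sub>M J law)"
  using measurable_component_singleton[of i J law] measurable_cong_sets[OF refl sets_law[of i], of "Pi\<^sub>M J law"]
  by blast

lemma measurable_edge_weight:
  assumes "e \<in> induced S A" "coords A \<subseteq> J"
  shows "(\<lambda>\<omega>. edge_weight \<omega> e) \<in> borel_measurable (Pi\<^sub>M J law)"
proof -
  have "Inr e \<in> J" "\<And>v. v \<in> e \<Longrightarrow> Inl v \<in> J" using assms by (auto simp: induced_def)
  then show ?thesis
    unfolding edge_weight_def by (auto intro!: borel_measurable_exp borel_measurable_diff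
      borel_measurable_sum measurable_coordinate measurable_compose[OF _ borel_measurable_exp])
qed

lemma measurable_matching_sum:
  assumes "coords A \<subseteq> J"
  shows "(\<lambda>\<omega>. matching_sum S (edge_weight \<omega>) g A) \<in> borel_measurable (Pi\<^sub>M J law)"
  unfolding matching_sum_def using assms
  by (intro borel_measurable_sum borel_measurable_times borel_measurable_const borel_measurable_prod
      measurable_edge_weight) (auto simp: matchings_def)

lemma measurable_edge_mean:
  assumes "coords A \<subseteq> J"
  shows "(\<lambda>\<omega>. edge_mean S (edge_weight \<omega>) A) \<in> borel_measurable (Pi\<^sub>M J law)"
  unfolding edge_mean_def matching_Z_def
  by (intro borel_measurable_divide measurable_matching_sum assms)

lemma measurable_edge_var:
  assumes "coords A \<subseteq> J"
  shows "(\<lambda>\<omega>. edge_var S (edge_weight \<omega>) A) \<in> borel_measurable (Pi\<^sub>M J law)"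
  unfolding edge_var_def matching_Z_def
  by (intro borel_measurable_divide borel_measurable_diff borel_measurable_power
      measurable_matching_sum measurable_edge_mean assms)

lemma indep_coordinates: "indep_vars law (\<lambda>i \<omega>. \<omega> i) UNIV"
proof (subst indep_vars_iff_distr_eq_PiM)
  have "distr \<Omega> (law i) (\<lambda>\<omega>. \<omega> i) = law i" for i
    by (rule distr_PiM_component) (use prob_law in auto)
  then show "distr \<Omega> \<Omega> (\<lambda>\<omega>. \<lambda>i\<in>UNIV. \<omega> i) = (\<Pi>\<^sub>M i\<in>UNIV. distr \<Omega> (law i) (\<lambda>\<omega>. \<omega> i))"
    by (simp add: restrict_def distr_id)
qed auto

text \<open>Both functions live on the full configuration space. The last two assumptions say that
  they read disjoint sets of coordinates, so they factor through independent restrictions.\<close>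

lemma indep_functions:
  assumes "A \<inter> B = {}" "f \<in> borel_measurable (Pi\<^sub>M A law)" "g \<in> borel_measurable (Pi\<^sub>M B law)"
    and "\<And>\<omega>. f (restrict \<omega> A) = f \<omega>" "\<And>\<omega>. g (restrict \<omega> B) = g \<omega>"
  shows "indep_var borel f borel g"
proof -
  have "indep_var (Pi\<^sub>M A law) (\<lambda>\<omega>. restrict \<omega> A) (Pi\<^sub>M B law) (\<lambda>\<omega>. restrict \<omega> B)"
    using indep_var_restrict[OF indep_coordinates assms(1)] by simp
  from indep_var_compose[OF this assms(2,3)] show ?thesis
    by (simp add: comp_def assms(4,5))
qed

lemma distr_shift: "distr \<Omega> \<Omega> (\<lambda>\<omega> i. \<omega> (shift_index k i)) = \<Omega>"
proof -
  have "law (shift_index k i) = law i" for i by (cases i) (auto simp: shift_index_def)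
  moreover have "distr \<Omega> (Pi\<^sub>M UNIV (\<lambda>i. law (shift_index k i))) (\<lambda>\<omega>. \<lambda>i\<in>UNIV. \<omega> (shift_index k i))
      = Pi\<^sub>M UNIV (\<lambda>i. law (shift_index k i))"
    by (rule distr_PiM_reindex) (auto intro: prob_law inj_shift_index)
  ultimately show ?thesis by (simp add: restrict_def)
qed

lemma measurable_shift: "(\<lambda>\<omega> i. \<omega> (shift_index k i)) \<in> measurable \<Omega> \<Omega>"
proof -
  have "(\<lambda>\<omega>. \<omega> (shift_index k i)) \<in> measurable \<Omega> (law i)" for i
  proof -
    have "law (shift_index k i) = law i" by (cases i) (auto simp: shift_index_def)
    then show ?thesis using measurable_component_singleton[of "shift_index k i" UNIV law] by simp
  qed
  then have "(\<lambda>\<omega>. \<lambda>i\<in>UNIV. \<omega> (shift_index k i)) \<in> measurable \<Omega> \<Omega>" by (intro measurable_restrict)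
  then show ?thesis by (simp add: restrict_def)
qed

lemma expectation_shift:
  fixes f :: "((nat \<times> 'a) + (nat \<times> 'a) set \<Rightarrow> real) \<Rightarrow> real"
  assumes "f \<in> borel_measurable \<Omega>"
  shows "expectation (\<lambda>\<omega>. f (\<lambda>i. \<omega> (shift_index k i))) = expectation f"
  using integral_distr[OF measurable_shift assms, of k] by (simp add: distr_shift)

section \<open>Limits for local translation-covariant functionals\<close>

lemma edge_mean_restrict:
  "edge_mean S (edge_weight (restrict \<omega> (coords A))) A = edge_mean S (edge_weight \<omega>) A"
  by (intro edge_mean_cong edge_weight_restrict) (auto simp: induced_def)

lemma edge_var_restrict:
  "edge_var S (edge_weight (restrict \<omega> (coords A))) A = edge_var S (edge_weight \<omega>) A"
  by (intro edge_var_cong edge_weight_restrict) (auto simp: induced_def)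

lemma edge_mean_bound:
  assumes "finite A" shows "\<bar>edge_mean S (edge_weight \<omega>) A\<bar> \<le> card A"
proof -
  interpret weighted_graph S "edge_weight \<omega>" by (rule weighted)
  have "induced S {} = {}" using edge_nonempty by (auto simp: induced_def)
  then have "mean {} = 0" by (simp add: edge_mean_def matching_sum_def matchings_def)
  then show ?thesis using remove_set_bounds(1)[OF assms subset_refl] by simp
qed

lemma edge_var_bound:
  assumes "finite A" shows "\<bar>edge_var S (edge_weight \<omega>) A\<bar> \<le> card A"
proof -
  interpret weighted_graph S "edge_weight \<omega>" by (rule weighted)
  have "induced S {} = {}" using edge_nonempty by (auto simp: induced_def)
  then have "var {} = 0" by (simp add: edge_var_def edge_mean_def matching_sum_def matchings_def)
  then show ?thesis using remove_set_bounds(2)[OF assms subset_refl] by simp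
qed

lemma cyl_add: "cyl (i + j) = cyl i \<union> shift i ` cyl j" "cyl i \<inter> shift i ` cyl j = {}"
proof -
  have "shift i ` cyl j = {i + 1..i + j} \<times> VH"
  proof (intro equalityI subsetI)
    fix v assume "v \<in> {i + 1..i + j} \<times> VH"
    then show "v \<in> shift i ` cyl j"
      by (intro image_eqI[of _ _ "(fst v - i, snd v)"]) (auto simp: shift_def cyl_verts_def)
  qed (auto simp: shift_def cyl_verts_def)
  then show "cyl (i + j) = cyl i \<union> shift i ` cyl j" "cyl i \<inter> shift i ` cyl j = {}"
    by (auto simp: cyl_verts_def)
qed

text \<open>Column \<open>i\<close> is deleted and later restored in the first piece only, so that
  the second piece is a full translate of \<open>cyl j\<close>. Deleting and restoring cost
  \<open>card VH\<close> each, whence the factor 2; \<open>1 \<le> i\<close> makes the column part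
  of the first piece.\<close>

lemma near_additive:
  assumes "1 \<le> i"
  shows "\<bar>edge_mean S (edge_weight \<omega>) (cyl (i + j)) - edge_mean S (edge_weight \<omega>) (cyl i)
      - edge_mean S (edge_weight \<omega>) (shift i ` cyl j)\<bar> \<le> 2 * real (card VH)"
    and "\<bar>edge_var S (edge_weight \<omega>) (cyl (i + j)) - edge_var S (edge_weight \<omega>) (cyl i)
      - edge_var S (edge_weight \<omega>) (shift i ` cyl j)\<bar> \<le> 2 * real (card VH)"
proof -
  interpret weighted_graph S "edge_weight \<omega>" by (rule weighted)
  define B where "B = {i} \<times> VH"
  let ?A = "cyl i - B" and ?A' = "shift i ` cyl j"
  have B: "card B = card VH" "B \<subseteq> cyl i" "B \<subseteq> cyl (i + j)"
    using assms by (auto simp: B_def cyl_verts_def card_cartesian_product)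
  have eq: "cyl (i + j) - B = ?A \<union> ?A'" using cyl_add[of i j] B by blast
  have fin: "finite ?A" "finite ?A'" "?A \<inter> ?A' = {}"
    using finite_cyl cyl_add(2)[of i j] by auto
  have cross: "e \<subseteq> ?A \<or> e \<subseteq> ?A'" if "e \<in> S" "e \<subseteq> ?A \<union> ?A'" for e
  proof -
    have A: "v \<in> ?A \<Longrightarrow> fst v < i" and A': "v \<in> ?A' \<Longrightarrow> i < fst v" for v
      by (auto simp: B_def cyl_verts_def shift_def)
    from that(1) show ?thesis
      unfolding strip_edge_iff
    proof (elim disjE exE conjE)
      fix k l assume e: "e = {(k, l), (Suc k, l)}"
      then have "(k, l) \<in> ?A \<union> ?A'" "(Suc k, l) \<in> ?A \<union> ?A'" using that(2) by auto
      then show ?thesis using e A[of "(k, l)"] A[of "(Suc k, l)"] A'[of "(k, l)"] A'[of "(Suc k, l)"] by auto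
    next
      fix k l l' assume e: "e = {(k, l), (k, l')}"
      then have "(k, l) \<in> ?A \<union> ?A'" "(k, l') \<in> ?A \<union> ?A'" using that(2) by auto
      then show ?thesis using e A[of "(k, l)"] A[of "(k, l')"] A'[of "(k, l)"] A'[of "(k, l')"] by auto
    qed
  qed
  note U = disconnected_union[OF fin cross]
  have "\<bar>mean (cyl (i + j)) - (mean ?A + mean ?A')\<bar> \<le> card VH"
    using remove_set_bounds(1)[OF finite_cyl B(3)] U(1) eq B(1) by simp
  moreover have "\<bar>mean (cyl i) - mean ?A\<bar> \<le> card VH"
    using remove_set_bounds(1)[OF finite_cyl B(2)] B(1) by simp
  ultimately show "\<bar>mean (cyl (i + j)) - mean (cyl i) - mean ?A'\<bar> \<le> 2 * real (card VH)" by linarith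
  have "\<bar>var (cyl (i + j)) - (var ?A + var ?A')\<bar> \<le> card VH"
    using remove_set_bounds(2)[OF finite_cyl B(3)] U(2) eq B(1) by simp
  moreover have "\<bar>var (cyl i) - var ?A\<bar> \<le> card VH"
    using remove_set_bounds(2)[OF finite_cyl B(2)] B(1) by simp
  ultimately show "\<bar>var (cyl (i + j)) - var (cyl i) - var ?A'\<bar> \<le> 2 * real (card VH)" by linarith
qed


text \<open>The mean and the variance of the edge count share these five properties, so the
  probabilistic argument is run once. Measurability is asked for every \<open>J\<close> because it
  is used on \<open>\<Omega>\<close> and on the factor that carries the relevant
  coordinates.\<close>

lemma functional_limits:
  fixes \<Phi> :: "((nat \<times> 'a) set \<Rightarrow> real) \<Rightarrow> (nat \<times> 'a) set \<Rightarrow> real"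
  assumes bound: "\<And>\<omega> A. finite A \<Longrightarrow> \<bar>\<Phi> (edge_weight \<omega>) A\<bar> \<le> card A"
    and local: "\<And>\<omega> A. \<Phi> (edge_weight (restrict \<omega> (coords A))) A = \<Phi> (edge_weight \<omega>) A"
    and meas: "\<And>A J. coords A \<subseteq> J \<Longrightarrow> (\<lambda>\<omega>. \<Phi> (edge_weight \<omega>) A) \<in> borel_measurable (Pi\<^sub>M J law)"
    and image: "\<And>w k A. \<Phi> w (shift k ` A) = \<Phi> (\<lambda>e. w (shift k ` e)) A"
    and add: "\<And>\<omega> i j. 1 \<le> i \<Longrightarrow> \<bar>\<Phi> (edge_weight \<omega>) (cyl (i + j)) - \<Phi> (edge_weight \<omega>) (cyl i)
      - \<Phi> (edge_weight \<omega>) (shift i ` cyl j)\<bar> \<le> C"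
  shows "convergent (\<lambda>n. expectation (\<lambda>\<omega>. \<Phi> (edge_weight \<omega>) (cyl n)) / real n)"
    and "convergent (\<lambda>n. variance (\<lambda>\<omega>. \<Phi> (edge_weight \<omega>) (cyl n)) / real n)"
    and "\<exists>K\<ge>0. \<forall>n\<ge>1. variance (\<lambda>\<omega>. \<Phi> (edge_weight \<omega>) (cyl n)) \<le> K * real n"
proof -
  let ?X = "\<lambda>n \<omega>. \<Phi> (edge_weight \<omega>) (cyl n)"
  have rv: "random_variable borel (?X n)" for n by (rule meas) simp
  have bdd: "\<exists>B. \<forall>\<omega>. \<bar>?X n \<omega>\<bar> \<le> B" for n using bound[OF finite_cyl] by blast
  have split: "\<exists>Y. indep_var borel (?X i) borel Y \<and> (\<exists>B. \<forall>\<omega>. \<bar>Y \<omega>\<bar> \<le> B) \<and>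
      expectation Y = expectation (?X j) \<and> variance Y = variance (?X j) \<and>
      (\<forall>\<omega>. \<bar>?X (i + j) \<omega> - ?X i \<omega> - Y \<omega>\<bar> \<le> C)" if "1 \<le> i" "1 \<le> j" for i j
  proof (intro exI conjI allI)
    let ?Y = "\<lambda>\<omega>. \<Phi> (edge_weight \<omega>) (shift i ` cyl j)"
    have Y: "?Y \<omega> = ?X j (\<lambda>l. \<omega> (shift_index i l))" for \<omega>
      unfolding image edge_weight_shift ..
    have "coords (cyl i) \<inter> coords (shift i ` cyl j) = {}"
    proof -
      \<comment> \<open>Any weights would do; the purpose is access to
        \<open>induced_disjoint\<close>. Edges joining the two pieces belong to neither coordinate
        set.\<close>
      interpret weighted_graph S "\<lambda>_. 0" using card_strip_edge by unfold_locales auto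
      show ?thesis using cyl_add(2)[of i j] induced_disjoint[OF cyl_add(2)[of i j]] by blast
    qed
    then show "indep_var borel (?X i) borel ?Y"
      by (rule indep_functions) (auto intro: meas simp: local)
    show "\<bar>?Y \<omega>\<bar> \<le> card (shift i ` cyl j)" for \<omega>
      using finite_cyl by (intro bound) auto
    show E: "expectation ?Y = expectation (?X j)"
      unfolding Y by (rule expectation_shift[OF rv])
    have "variance ?Y = expectation (\<lambda>\<omega>. (?X j (\<lambda>l. \<omega> (shift_index i l)) - expectation (?X j))\<^sup>2)"
      unfolding E unfolding Y ..
    also have "\<dots> = variance (?X j)"
      by (rule expectation_shift) (use rv in measurable)
    finally show "variance ?Y = variance (?X j)" .
    show "\<bar>?X (i + j) \<omega> - ?X i \<omega> - ?Y \<omega>\<bar> \<le> C" for \<omega> by (rule add[OF \<open>1 \<le> i\<close>])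
  qed
  show "convergent (\<lambda>n. expectation (?X n) / real n)" "convergent (\<lambda>n. variance (?X n) / real n)"
    "\<exists>K\<ge>0. \<forall>n\<ge>1. variance (?X n) \<le> K * real n"
    using near_additive_process[OF bdd split rv] by blast+
qed

lemma image_functional:
  "edge_mean S w (shift k ` A) = edge_mean S (\<lambda>e. w (shift k ` e)) A"
  "edge_var S w (shift k ` A) = edge_var S (\<lambda>e. w (shift k ` e)) A"
  by (rule edge_mean_image[OF inj_shift shift_strip_edge] edge_var_image[OF inj_shift shift_strip_edge])+

lemmas edge_mean_limits = functional_limits[of "edge_mean S", OF edge_mean_bound edge_mean_restrict
  measurable_edge_mean image_functional(1) near_additive(1)]

lemmas edge_var_limits = functional_limits[of "edge_var S", OF edge_var_bound edge_var_restrict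
  measurable_edge_var image_functional(2) near_additive(2)]

section \<open>Transfer from a realisation to the product measure\<close>

text \<open>Independence together with the two laws determines the joint law of the weights on
  \<open>cyl n\<close>, and it is the marginal of \<open>\<Omega>\<close> on these coordinates. As
  \<open>g\<close> reads no others, its law is the same on both spaces. \<open>1 \<le> n\<close>
  makes the index set nonempty.\<close>

lemma distr_realisation:
  fixes M :: "'w measure" and g :: "((nat \<times> 'a) + (nat \<times> 'a) set \<Rightarrow> real) \<Rightarrow> real"
  assumes rw: "random_weights N W (cyl n) (induced S (cyl n)) M \<nu> \<omega>" and n: "1 \<le> n"
    and g: "g \<in> borel_measurable (Pi\<^sub>M (coords (cyl n)) law)" "\<And>\<omega>. g (restrict \<omega> (coords (cyl n))) = g \<omega>"
  shows "(\<lambda>x. g (\<lambda>i. case_sum \<nu> \<omega> i x)) \<in> borel_measurable M"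
    and "distr M borel (\<lambda>x. g (\<lambda>i. case_sum \<nu> \<omega> i x)) = distr \<Omega> borel g"
proof -
  let ?J = "coords (cyl n)" and ?X = "case_sum \<nu> \<omega>"
  interpret M: prob_space M using rw by (simp add: random_weights_def)
  have ind: "M.indep_vars (\<lambda>_. borel) ?X ?J"
    and law: "\<And>v. v \<in> cyl n \<Longrightarrow> distr M borel (\<nu> v) = N" "\<And>e. e \<in> induced S (cyl n) \<Longrightarrow> distr M borel (\<omega> e) = W"
    using rw by (auto simp: random_weights_def)
  have rv: "?X i \<in> borel_measurable M" if "i \<in> ?J" for i
    using ind that unfolding M.indep_vars_def by auto
  have ne: "?J \<noteq> {}" using VH n by (auto simp: cyl_verts_def)
  have R: "(\<lambda>x. \<lambda>i\<in>?J. ?X i x) \<in> measurable M (Pi\<^sub>M ?J law)"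
    using rv by (intro measurable_restrict) (simp add: measurable_cong_sets[OF refl sets_law])
  have "distr M (Pi\<^sub>M ?J law) (\<lambda>x. \<lambda>i\<in>?J. ?X i x) = distr M (Pi\<^sub>M ?J (\<lambda>_. borel)) (\<lambda>x. \<lambda>i\<in>?J. ?X i x)"
    by (intro distr_cong sets_PiM_cong refl sets_law)
  also have "\<dots> = (\<Pi>\<^sub>M i\<in>?J. distr M borel (?X i))"
    by (rule iffD1[OF M.indep_vars_iff_distr_eq_PiM'[OF ne] ind]) (rule rv)
  also have "\<dots> = Pi\<^sub>M ?J law"
    using law by (intro PiM_cong) auto
  finally have 1: "distr M (Pi\<^sub>M ?J law) (\<lambda>x. \<lambda>i\<in>?J. ?X i x) = Pi\<^sub>M ?J law" .
  have 2: "distr \<Omega> (Pi\<^sub>M ?J law) (\<lambda>\<omega>. \<lambda>i\<in>?J. \<omega> i) = Pi\<^sub>M ?J law"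
    using distr_PiM_reindex[of UNIV law "\<lambda>i. i" ?J] prob_law by simp
  have R2: "(\<lambda>\<omega>. \<lambda>i\<in>?J. \<omega> i) \<in> measurable \<Omega> (Pi\<^sub>M ?J law)"
    by (intro measurable_restrict measurable_component_singleton) auto
  have g': "g (\<lambda>i. ?X i x) = g (\<lambda>i\<in>?J. ?X i x)" for x using g(2)[of "\<lambda>i. ?X i x"] by simp
  show "(\<lambda>x. g (\<lambda>i. ?X i x)) \<in> borel_measurable M"
    unfolding g' by (rule measurable_compose[OF R g(1)])
  have "distr M borel (\<lambda>x. g (\<lambda>i. ?X i x)) = distr (Pi\<^sub>M ?J law) borel g"
    unfolding g' using distr_distr[OF g(1) R] by (simp add: 1 comp_def)
  also have "\<dots> = distr \<Omega> borel (\<lambda>\<omega>. g (\<lambda>i\<in>?J. \<omega> i))"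
    using distr_distr[OF g(1) R2] by (simp add: 2 comp_def)
  finally show "distr M borel (\<lambda>x. g (\<lambda>i. ?X i x)) = distr \<Omega> borel g" by (simp add: g(2))
qed

lemma expectation_realisation:
  fixes M :: "'w measure" and g :: "((nat \<times> 'a) + (nat \<times> 'a) set \<Rightarrow> real) \<Rightarrow> real" and h :: "real \<Rightarrow> real"
  assumes rw: "random_weights N W (cyl n) (induced S (cyl n)) M \<nu> \<omega>" and n: "1 \<le> n"
    and g: "g \<in> borel_measurable (Pi\<^sub>M (coords (cyl n)) law)" "\<And>\<omega>. g (restrict \<omega> (coords (cyl n))) = g \<omega>"
    and gO: "g \<in> borel_measurable \<Omega>"
    and h: "h \<in> borel_measurable borel"
  shows "integral\<^sup>L M (\<lambda>x. h (g (\<lambda>i. case_sum \<nu> \<omega> i x))) = expectation (\<lambda>\<omega>. h (g \<omega>))"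
proof -
  define G where "G x = g (\<lambda>i. case_sum \<nu> \<omega> i x)" for x
  have G: "G \<in> borel_measurable M" "distr M borel G = distr \<Omega> borel g"
    unfolding G_def[abs_def] by (rule distr_realisation[OF rw n g])+
  have "integral\<^sup>L M (\<lambda>x. h (G x)) = integral\<^sup>L (distr M borel G) h"
    by (rule integral_distr[OF G(1) h, symmetric])
  also have "\<dots> = expectation (\<lambda>\<omega>. h (g \<omega>))"
    unfolding G(2) by (rule integral_distr[OF gO h])
  finally show ?thesis unfolding G_def .
qed

section \<open>Positivity of the quenched variance\<close>

lemma incident_restrict:
  "sum (edge_weight (restrict \<omega> (coords A))) (incident S A v) = sum (edge_weight \<omega>) (incident S A v)"
  by (intro sum.cong refl edge_weight_restrict) (auto simp: incident_def induced_def)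

text \<open>The two ends of \<open>e\<close> are deleted in turn, each at the cost of one factor.
  \<open>F\<close> contains all edges at these ends, so the bound does not see the rest of
  \<open>A\<close>.\<close>

lemma Z_ratio_ge_window:
  assumes "finite A" "e \<in> S" "e \<subseteq> A"
    and win: "\<And>v e'. v \<in> e \<Longrightarrow> e' \<in> S \<Longrightarrow> v \<in> e' \<Longrightarrow> e' \<subseteq> A \<Longrightarrow> e' \<in> F" and "finite F" "F \<subseteq> S"
  shows "1 / (1 + sum (edge_weight \<omega>) F)\<^sup>2 \<le>
    matching_Z S (edge_weight \<omega>) (A - e) / matching_Z S (edge_weight \<omega>) A"
proof -
  interpret weighted_graph S "edge_weight \<omega>" by (rule weighted)
  let ?w = "edge_weight \<omega>"
  obtain u v where e: "e = {u, v}" "u \<noteq> v" using card_strip_edge[OF assms(2)] by (auto simp: card_2_iff)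
  have F0: "0 \<le> sum ?w F" using edge_weight_pos by (intro sum_nonneg) (auto intro: less_imp_le)
  have r: "1 / (1 + sum ?w F) \<le> Z (B - {x}) / Z B" if "B \<subseteq> A" "x \<in> B" "x \<in> e" for B x
  proof -
    have fB: "finite B" using that(1) assms(1) finite_subset by auto
    have "incident S B x \<subseteq> F" using that win[OF that(3)] by (auto simp: incident_def)
    then have "sum ?w (incident S B x) \<le> sum ?w F"
      using assms(5) less_imp_le[OF edge_weight_pos] by (intro sum_mono2) auto
    moreover have "0 \<le> sum ?w (incident S B x)"
      using edge_weight_pos by (intro sum_nonneg) (auto intro: less_imp_le)
    ultimately have "1 / (1 + sum ?w F) \<le> 1 / (1 + sum ?w (incident S B x))"
      by (intro divide_left_mono) auto
    then show ?thesis using Z_ratio_ge[OF fB that(2)] by linarith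
  qed
  have A: "A - e = A - {u} - {v}" using e by auto
  have "1 / (1 + sum ?w F)\<^sup>2 = (1 / (1 + sum ?w F)) * (1 / (1 + sum ?w F))"
    by (simp add: power2_eq_square)
  also have "\<dots> \<le> (Z (A - {u}) / Z A) * (Z (A - {u} - {v}) / Z (A - {u}))"
  proof (rule mult_mono)
    show "1 / (1 + sum ?w F) \<le> Z (A - {u}) / Z A" using r[of A u] e assms(3) by auto
    show "0 \<le> Z (A - {u}) / Z A" using Z_ge_1[of A] Z_ge_1[of "A - {u}"] assms(1) by simp
    show "1 / (1 + sum ?w F) \<le> Z (A - {u} - {v}) / Z (A - {u})" using r[of "A - {u}" v] e assms(3) by auto
  qed (use F0 in simp)
  also have "\<dots> = Z (A - e) / Z A"
    using Z_ge_1[of "A - {u}"] assms(1) by (simp add: A)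
  finally show ?thesis .
qed

text \<open>Every block of four columns contributes, through an edge between its two inner columns, a
  random lower bound depending on the block only; these bounds are translates of each other.\<close>

lemma edge_var_expectation_ge:
  "\<exists>r>0. \<forall>q n. 4 * q \<le> n \<longrightarrow> real q * r \<le> expectation (\<lambda>\<omega>. edge_var S (edge_weight \<omega>) (cyl n))"
proof -
  obtain j where j: "j \<in> VH" using VH by auto
  define e where "e = {(2 :: nat, j), (3, j)}"
  define F where "F = induced S (cyl 4)"
  \<comment> \<open>One summand of \<open>var_ge_matching\<close>, with the ratio of partition
    functions replaced by the window bound. An edge spans at most two adjacent columns, so all edges
    at the ends of \<open>e\<close>, in columns 2 and 3, stay within columns 1 to 4; hence blocks of
    width four.\<close>
  define \<rho> where "\<rho> \<omega> = edge_weight \<omega> e / (1 + edge_weight \<omega> e) * (1 / (1 + sum (edge_weight \<omega>) F)\<^sup>2)" for \<omega>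
  have eS: "e \<in> S" unfolding strip_edge_iff e_def using j by (intro disjI1 exI[of _ 2] exI[of _ j]) auto
  have finF: "finite F" unfolding F_def by (intro finite_induced finite_cyl)
  have F0: "0 \<le> sum (edge_weight \<omega>) F" for \<omega> using edge_weight_pos by (intro sum_nonneg) (auto intro: less_imp_le)
  have meas_w: "(\<lambda>\<omega>. edge_weight \<omega> f) \<in> borel_measurable \<Omega>" if "f \<in> S" for f
    using that by (intro measurable_edge_weight[where A = f]) (auto simp: induced_def)
  have [measurable]: "\<rho> \<in> borel_measurable \<Omega>"
    unfolding \<rho>_def[abs_def] using eS
    by (intro borel_measurable_times borel_measurable_divide borel_measurable_add borel_measurable_const
        borel_measurable_power borel_measurable_sum meas_w) (auto simp: F_def induced_def)
  have pos: "0 < \<rho> \<omega>" for \<omega>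
    unfolding \<rho>_def using edge_weight_pos[of \<omega> e] F0[of \<omega>] by (intro mult_pos_pos divide_pos_pos) auto
  have le1: "\<rho> \<omega> \<le> 1" for \<omega>
  proof -
    have "1 \<le> (1 + sum (edge_weight \<omega>) F)\<^sup>2" using F0[of \<omega>] by (intro one_le_power) auto
    then have "\<rho> \<omega> \<le> 1 * 1"
      unfolding \<rho>_def using edge_weight_pos[of \<omega> e] by (intro mult_mono) (auto simp: divide_le_eq)
    then show ?thesis by simp
  qed
  have int: "integrable \<Omega> \<rho>"
    using pos le1 by (intro integrable_bounded[where B = 1]) (auto intro: less_imp_le simp: abs_of_pos)
  define r where "r = expectation \<rho>"
  have "r \<noteq> 0"
    unfolding r_def using integral_nonneg_eq_0_iff_AE[OF int] pos AE_False
    by (auto simp: less_imp_le less_imp_neq[symmetric])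
  moreover have "0 \<le> r" unfolding r_def using pos by (intro integral_nonneg_AE) (auto intro: less_imp_le)
  ultimately have r: "0 < r" by simp
  have "real q * r \<le> expectation (\<lambda>\<omega>. edge_var S (edge_weight \<omega>) (cyl n))" if q: "4 * q \<le> n" for q n
  proof -
    let ?e = "\<lambda>k. shift (4 * k) ` e"
    have bound: "(\<Sum>k<q. \<rho> (\<lambda>i. \<omega> (shift_index (4 * k) i))) \<le> edge_var S (edge_weight \<omega>) (cyl n)" for \<omega>
    proof -
      interpret weighted_graph S "edge_weight \<omega>" by (rule weighted)
      let ?w = "edge_weight \<omega>"
      have sub: "?e k \<subseteq> cyl n" if "k < q" for k
        using that q j by (auto simp: e_def shift_def cyl_verts_def)
      have inj: "inj_on ?e {..<q}" by (auto simp: inj_on_def e_def shift_def doubleton_eq_iff)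
      have disj: "?e k \<inter> ?e l = {}" if "k \<noteq> l" for k l
        using that by (auto simp: e_def shift_def)
      have "?e ` {..<q} \<subseteq> induced S (cyl n)"
        using sub by (intro image_subsetI) (simp add: induced_def shift_strip_edge eS)
      moreover have "disjoint (?e ` {..<q})"
        unfolding disjoint_def
      proof (intro ballI impI)
        fix a b assume "a \<in> ?e ` {..<q}" "b \<in> ?e ` {..<q}" and ab: "a \<noteq> b"
        then obtain k l where kl: "a = ?e k" "b = ?e l" by (elim imageE)
        then have "k \<noteq> l" using ab by (intro notI) (simp only:)
        then show "a \<inter> b = {}" unfolding kl by (rule disj)
      qed
      ultimately have "?e ` {..<q} \<in> matchings (induced S (cyl n))" by (simp add: matchings_def)
      from var_ge_matching[OF finite_cyl this]
      have "(\<Sum>k<q. ?w (?e k) / (1 + ?w (?e k)) * (Z (cyl n - ?e k) / Z (cyl n))) \<le> var (cyl n)"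
        using inj by (simp add: sum.reindex)
      moreover have "(\<Sum>k<q. \<rho> (\<lambda>i. \<omega> (shift_index (4 * k) i)))
          \<le> (\<Sum>k<q. ?w (?e k) / (1 + ?w (?e k)) * (Z (cyl n - ?e k) / Z (cyl n)))"
      proof (rule sum_mono)
        fix k assume k: "k \<in> {..<q}"
        let ?F = "(`) (shift (4 * k)) ` F"
        have "1 / (1 + sum ?w ?F)\<^sup>2 \<le> Z (cyl n - ?e k) / Z (cyl n)"
        proof (rule Z_ratio_ge_window[OF finite_cyl])
          show "?e k \<in> S" using shift_strip_edge eS by blast
          show "?e k \<subseteq> cyl n" using sub k by auto
          show "finite ?F" using finF by simp
          show "?F \<subseteq> S" using shift_strip_edge by (auto simp: F_def induced_def)
          fix v e' assume e': "v \<in> ?e k" "e' \<in> S" "v \<in> e'" "e' \<subseteq> cyl n"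
          have "e' \<subseteq> shift (4 * k) ` cyl 4"
          proof
            fix x assume x: "x \<in> e'"
            have "fst x \<le> Suc (fst v) \<and> fst v \<le> Suc (fst x)"
              using e'(2) x e'(3) unfolding strip_edge_iff by auto
            moreover have "fst v = 2 + 4 * k \<or> fst v = 3 + 4 * k" using e'(1) by (auto simp: e_def shift_def)
            moreover have "snd x \<in> VH" using e'(4) x by (auto simp: cyl_verts_def)
            ultimately show "x \<in> shift (4 * k) ` cyl 4"
              by (intro image_eqI[of _ _ "(fst x - 4 * k, snd x)"]) (auto simp: shift_def cyl_verts_def prod_eq_iff)
          qed
          then obtain e'' where "e'' \<subseteq> cyl 4" "e' = shift (4 * k) ` e''" by (auto simp: subset_image_iff)
          then show "e' \<in> ?F" using e'(2) shift_strip_edge by (auto simp: F_def induced_def)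
        qed
        moreover have "sum ?w ?F = sum (edge_weight (\<lambda>i. \<omega> (shift_index (4 * k) i))) F"
        proof -
          have "inj ((`) (shift (4 * k)) :: (nat \<times> 'a) set \<Rightarrow> _)"
            by (rule injI) (simp add: inj_image_eq_iff[OF inj_shift])
          then show ?thesis by (simp add: sum.reindex inj_on_subset edge_weight_shift)
        qed
        ultimately show "\<rho> (\<lambda>i. \<omega> (shift_index (4 * k) i))
            \<le> ?w (?e k) / (1 + ?w (?e k)) * (Z (cyl n - ?e k) / Z (cyl n))"
          unfolding \<rho>_def edge_weight_shift[symmetric]
          using edge_weight_pos[of \<omega> "?e k"] by (intro mult_left_mono) (auto simp: edge_weight_shift)
      qed
      ultimately show ?thesis by linarith
    qed
    have shift_int: "integrable \<Omega> (\<lambda>\<omega>. \<rho> (\<lambda>i. \<omega> (shift_index k i)))" for k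
      using integrable_distr[OF measurable_shift[of k], of \<rho>] int by (simp add: distr_shift)
    have "real q * r = (\<Sum>k<q. expectation (\<lambda>\<omega>. \<rho> (\<lambda>i. \<omega> (shift_index (4 * k) i))))"
      by (simp add: expectation_shift r_def)
    also have "\<dots> = expectation (\<lambda>\<omega>. \<Sum>k<q. \<rho> (\<lambda>i. \<omega> (shift_index (4 * k) i)))"
      using shift_int by simp
    also have "\<dots> \<le> expectation (\<lambda>\<omega>. edge_var S (edge_weight \<omega>) (cyl n))"
    proof (rule integral_mono)
      show "integrable \<Omega> (\<lambda>\<omega>. edge_var S (edge_weight \<omega>) (cyl n))"
        by (rule integrable_bounded[OF measurable_edge_var edge_var_bound[OF finite_cyl]]) simp
    qed (use shift_int bound in auto)
    finally show ?thesis .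
  qed
  then show ?thesis using r by blast
qed

end

section \<open>Lower bound for the annealed variance\<close>

lemma exp_diff_ge:
  fixes x y L :: real
  assumes "- L \<le> x" "x \<le> y"
  shows "exp (- L) * (y - x) \<le> exp y - exp x"
proof -
  have "y - x \<le> exp (y - x) - 1" using exp_ge_add_one_self[of "y - x"] by linarith
  then have "exp (- L) * (y - x) \<le> exp x * (exp (y - x) - 1)"
    using assms by (intro mult_mono) auto
  then show ?thesis by (simp add: algebra_simps flip: exp_add)
qed

lemma (in prob_space) integrable_AE_bounded:
  fixes X :: "'a \<Rightarrow> real"
  assumes "random_variable borel X" "AE x in M. \<bar>X x\<bar> \<le> B"
  shows "integrable M X"
  by (rule integrable_const_bound[of _ B]) (use assms in auto)

context cylinder_model
begin

text \<open>The slope condition bounds \<open>F\<close> from below by its value at \<open>\<omega> (i := \<mu>)\<close>, which is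
  independent of \<open>\<omega> i\<close>.\<close>

lemma covariance_coordinate_ge:
  fixes F :: "((nat \<times> 'a) + (nat \<times> 'a) set \<Rightarrow> real) \<Rightarrow> real"
  defines "\<mu> i \<equiv> integral\<^sup>L (law i) (\<lambda>x. x)"
  assumes F: "F \<in> borel_measurable \<Omega>" and bdd: "\<And>\<omega>. \<bar>F \<omega>\<bar> \<le> B"
    and K: "AE x in law i. \<bar>x\<bar> \<le> K"
    and slope: "AE \<omega> in \<Omega>. \<forall>x y. - K \<le> x \<and> x \<le> y \<and> y \<le> K \<longrightarrow> c * (y - x) \<le> F (\<omega> (i := y)) - F (\<omega> (i := x))"
  shows "c * integral\<^sup>L (law i) (\<lambda>x. (x - \<mu> i)\<^sup>2) \<le> expectation (\<lambda>\<omega>. F \<omega> * (\<omega> i - \<mu> i))"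
    and "expectation (\<lambda>\<omega>. \<omega> i - \<mu> i) = 0"
    and "expectation (\<lambda>\<omega>. (\<omega> i - \<mu> i)\<^sup>2) = integral\<^sup>L (law i) (\<lambda>x. (x - \<mu> i)\<^sup>2)"
    and "AE \<omega> in \<Omega>. \<bar>\<omega> i - \<mu> i\<bar> \<le> 2 * K"
proof -
  interpret D: prob_space "law i" by (rule prob_law)
  have meas_i: "(\<lambda>\<omega>. \<omega> i - \<mu> i) \<in> borel_measurable \<Omega>"
    by (intro borel_measurable_diff measurable_coordinate borel_measurable_const UNIV_I)
  have id: "(\<lambda>x. x) \<in> borel_measurable (law i)"
    unfolding measurable_cong_sets[OF sets_law[of i] refl] by simp
  have comp: "distr \<Omega> (law i) (\<lambda>\<omega>. \<omega> i) = law i"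
    by (rule distr_PiM_component[OF prob_law UNIV_I])
  have tr: "expectation (\<lambda>\<omega>. h (\<omega> i)) = integral\<^sup>L (law i) h" if "h \<in> borel_measurable borel" for h :: "real \<Rightarrow> real"
  proof -
    have "h \<in> borel_measurable (law i)" unfolding measurable_cong_sets[OF sets_law[of i] refl] by (rule that)
    from integral_distr[OF measurable_component_singleton[of i UNIV law, OF UNIV_I] this]
    show ?thesis unfolding comp by (rule sym)
  qed
  have iD: "integrable (law i) (\<lambda>x. x)" by (rule D.integrable_AE_bounded[OF id K])
  \<comment> \<open>The slope is available only on the interval from \<open>- K\<close> to
    \<open>K\<close>, so the reference value \<open>\<mu> i\<close> has to lie in it.\<close>
  have \<mu>: "\<bar>\<mu> i\<bar> \<le> K"
  proof -
    have "\<mu> i \<le> K" unfolding \<mu>_def using K by (intro D.integral_le_const iD) auto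
    moreover have "- K \<le> \<mu> i" unfolding \<mu>_def using K by (intro D.integral_ge_const iD) auto
    ultimately show ?thesis by simp
  qed
  have AEi: "AE \<omega> in \<Omega>. \<bar>\<omega> i\<bar> \<le> K" by (rule AE_PiM_component[of UNIV law i, OF prob_law UNIV_I K])
  then show AE2: "AE \<omega> in \<Omega>. \<bar>\<omega> i - \<mu> i\<bar> \<le> 2 * K" by eventually_elim (use \<mu> in linarith)
  have "expectation (\<lambda>\<omega>. \<omega> i - \<mu> i) = integral\<^sup>L (law i) (\<lambda>x. x - \<mu> i)" by (rule tr) simp
  then show E0: "expectation (\<lambda>\<omega>. \<omega> i - \<mu> i) = 0"
    using iD by (simp add: \<mu>_def D.prob_space)
  show E2: "expectation (\<lambda>\<omega>. (\<omega> i - \<mu> i)\<^sup>2) = integral\<^sup>L (law i) (\<lambda>x. (x - \<mu> i)\<^sup>2)" by (rule tr) simp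
  let ?G = "\<lambda>\<omega>. F (\<omega> (i := \<mu> i))"
  have B0: "0 \<le> B" using bdd[of undefined] by linarith
  have upd: "(\<lambda>\<omega>. \<omega> (i := \<mu> i)) \<in> measurable (Pi\<^sub>M (UNIV - {i}) law) \<Omega>"
    by (rule measurable_fun_upd[where J = "UNIV - {i}"])
      (auto simp: sets_eq_imp_space_eq[OF sets_law])
  have G: "?G \<in> borel_measurable (Pi\<^sub>M (UNIV - {i}) law)"
    by (rule measurable_compose[OF upd F])
  have upd': "(\<lambda>\<omega>. \<omega> (i := \<mu> i)) \<in> measurable \<Omega> \<Omega>"
    by (rule measurable_fun_upd[where J = UNIV]) (auto simp: sets_eq_imp_space_eq[OF sets_law])
  have meas_G: "?G \<in> borel_measurable \<Omega>" by (rule measurable_compose[OF upd' F])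
  have ind: "indep_var borel (\<lambda>\<omega>. \<omega> i - \<mu> i) borel ?G"
  proof (rule indep_functions[OF _ _ G])
    show "(\<lambda>\<omega>. \<omega> i - \<mu> i) \<in> borel_measurable (Pi\<^sub>M {i} law)"
      by (intro borel_measurable_diff measurable_coordinate) auto
    show "F ((restrict \<omega> (UNIV - {i}))(i := \<mu> i)) = F (\<omega> (i := \<mu> i))" for \<omega>
      by (rule arg_cong[where f = F]) auto
  qed auto
  have int_i: "integrable \<Omega> (\<lambda>\<omega>. \<omega> i - \<mu> i)" by (rule integrable_AE_bounded[OF meas_i AE2])
  have int_G: "integrable \<Omega> ?G" by (rule integrable_bounded[OF meas_G bdd])
  have GE: "expectation (\<lambda>\<omega>. (\<omega> i - \<mu> i) * ?G \<omega>) = 0"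
    using indep_var_lebesgue_integral[OF ind int_i int_G] E0 by simp
  have iGE: "integrable \<Omega> (\<lambda>\<omega>. (\<omega> i - \<mu> i) * ?G \<omega>)"
    by (rule indep_var_integrable[OF ind int_i int_G])
  have i2: "integrable \<Omega> (\<lambda>\<omega>. (\<omega> i - \<mu> i)\<^sup>2)"
  proof (rule integrable_AE_bounded[where B = "(2 * K)\<^sup>2"])
    show "AE \<omega> in \<Omega>. \<bar>(\<omega> i - \<mu> i)\<^sup>2\<bar> \<le> (2 * K)\<^sup>2"
      using AE2
    proof eventually_elim
      case (elim \<omega>)
      have "\<bar>\<omega> i - \<mu> i\<bar>\<^sup>2 \<le> (2 * K)\<^sup>2" by (intro power_mono elim) simp
      then show ?case by simp
    qed
  qed (intro borel_measurable_power meas_i)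
  have iF: "integrable \<Omega> (\<lambda>\<omega>. F \<omega> * (\<omega> i - \<mu> i))"
  proof (rule integrable_AE_bounded[where B = "B * (2 * K)"])
    show "AE \<omega> in \<Omega>. \<bar>F \<omega> * (\<omega> i - \<mu> i)\<bar> \<le> B * (2 * K)"
      using AE2 by eventually_elim (unfold abs_mult, intro mult_mono bdd, use B0 in auto)
  qed (intro borel_measurable_times F meas_i)
  have "c * expectation (\<lambda>\<omega>. (\<omega> i - \<mu> i)\<^sup>2) = expectation (\<lambda>\<omega>. c * (\<omega> i - \<mu> i)\<^sup>2 + (\<omega> i - \<mu> i) * ?G \<omega>)"
    using i2 iGE GE by simp
  also have "\<dots> \<le> expectation (\<lambda>\<omega>. F \<omega> * (\<omega> i - \<mu> i))"
  proof (rule integral_mono_AE)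
    show "AE \<omega> in \<Omega>. c * (\<omega> i - \<mu> i)\<^sup>2 + (\<omega> i - \<mu> i) * ?G \<omega> \<le> F \<omega> * (\<omega> i - \<mu> i)"
      using slope AEi
    proof eventually_elim
      case (elim \<omega>)
      have s: "c * (y - x) \<le> F (\<omega> (i := y)) - F (\<omega> (i := x))" if "- K \<le> x" "x \<le> y" "y \<le> K" for x y
        using elim(1) that by blast
      \<comment> \<open>By the slope condition the first factor has the sign of
        \<open>\<omega> i - \<mu> i\<close>, on either side of \<open>\<mu> i\<close>.\<close>
      have "0 \<le> (F \<omega> - ?G \<omega> - c * (\<omega> i - \<mu> i)) * (\<omega> i - \<mu> i)"
      proof (cases "\<mu> i \<le> \<omega> i")
        case True
        then show ?thesis using s[of "\<mu> i" "\<omega> i"] \<mu> elim(2) by (intro mult_nonneg_nonneg) auto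
      next
        case False
        have "F \<omega> - ?G \<omega> - c * (\<omega> i - \<mu> i) \<le> 0"
          using False s[of "\<omega> i" "\<mu> i"] \<mu> elim(2) by (simp add: algebra_simps)
        then show ?thesis using False by (intro mult_nonpos_nonpos) auto
      qed
      then show ?case by (simp add: power2_eq_square algebra_simps)
    qed
  qed (use i2 iGE iF in auto)
  finally show "c * integral\<^sup>L (law i) (\<lambda>x. (x - \<mu> i)\<^sup>2) \<le> expectation (\<lambda>\<omega>. F \<omega> * (\<omega> i - \<mu> i))"
    unfolding E2 .
qed

text \<open>Cauchy-Schwarz for \<open>F\<close> and the sum of the centred coordinates.\<close>

lemma variance_ge_coordinates:
  fixes F :: "((nat \<times> 'a) + (nat \<times> 'a) set \<Rightarrow> real) \<Rightarrow> real" and D :: "real measure"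
  assumes F: "F \<in> borel_measurable \<Omega>" and bdd: "\<And>\<omega>. \<bar>F \<omega>\<bar> \<le> B"
    and I: "finite I" "\<And>i. i \<in> I \<Longrightarrow> law i = D"
    and K: "AE x in D. \<bar>x\<bar> \<le> K" and c: "0 \<le> c"
    and slope: "\<And>i. i \<in> I \<Longrightarrow> AE \<omega> in \<Omega>. \<forall>x y. - K \<le> x \<and> x \<le> y \<and> y \<le> K \<longrightarrow>
      c * (y - x) \<le> F (\<omega> (i := y)) - F (\<omega> (i := x))"
  shows "c\<^sup>2 * real (card I) * prob_space.variance D (\<lambda>x. x) \<le> variance F"
proof -
  define \<mu> where "\<mu> = integral\<^sup>L D (\<lambda>x. x)"
  define V where "V = integral\<^sup>L D (\<lambda>x. (x - \<mu>)\<^sup>2)"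
  define f where "f i \<omega> = \<omega> i - \<mu>" for i and \<omega> :: "(nat \<times> 'a) + (nat \<times> 'a) set \<Rightarrow> real"
  have f: "f i \<in> borel_measurable \<Omega>" for i
    unfolding f_def[abs_def] by (intro borel_measurable_diff measurable_coordinate borel_measurable_const) simp
  have cov: "c * V \<le> expectation (\<lambda>\<omega>. F \<omega> * f i \<omega>)" and E0: "expectation (f i) = 0"
    and E2: "expectation (\<lambda>\<omega>. (f i \<omega>)\<^sup>2) = V" and AE2: "AE \<omega> in \<Omega>. \<bar>f i \<omega>\<bar> \<le> 2 * K" if i: "i \<in> I" for i
    using covariance_coordinate_ge[OF F bdd _ slope[OF i]] K unfolding I(2)[OF i]
    by (simp_all add: f_def[abs_def] V_def \<mu>_def)
  have B0: "0 \<le> B" using bdd[of undefined] by linarith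
  have int_f: "integrable \<Omega> (f i)" if "i \<in> I" for i
    by (rule integrable_AE_bounded[OF f AE2[OF that]])
  have int_ff: "integrable \<Omega> (\<lambda>\<omega>. f i \<omega> * f j \<omega>)" if "i \<in> I" "j \<in> I" for i j
  proof (rule integrable_AE_bounded[where B = "(2 * K) * (2 * K)"])
    show "AE \<omega> in \<Omega>. \<bar>f i \<omega> * f j \<omega>\<bar> \<le> (2 * K) * (2 * K)"
      using AE2[OF that(1)] AE2[OF that(2)]
      by eventually_elim (unfold abs_mult, intro mult_mono, auto)
  qed (intro borel_measurable_times f)
  have int_Ff: "integrable \<Omega> (\<lambda>\<omega>. F \<omega> * f i \<omega>)" if "i \<in> I" for i
  proof (rule integrable_AE_bounded[where B = "B * (2 * K)"])
    show "AE \<omega> in \<Omega>. \<bar>F \<omega> * f i \<omega>\<bar> \<le> B * (2 * K)"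
      using AE2[OF that] by eventually_elim (unfold abs_mult, intro mult_mono bdd, use B0 in auto)
  qed (intro borel_measurable_times F f)
  have int_F2: "integrable \<Omega> (\<lambda>\<omega>. (F \<omega> - expectation F)\<^sup>2)"
  proof (rule integrable_bounded[where B = "(B + \<bar>expectation F\<bar>)\<^sup>2"])
    show "\<bar>(F \<omega> - expectation F)\<^sup>2\<bar> \<le> (B + \<bar>expectation F\<bar>)\<^sup>2" for \<omega>
    proof -
      have "\<bar>F \<omega> - expectation F\<bar> \<le> \<bar>B + \<bar>expectation F\<bar>\<bar>" using bdd[of \<omega>] by linarith
      then show ?thesis by (simp add: abs_le_square_iff)
    qed
  qed (intro borel_measurable_power borel_measurable_diff F borel_measurable_const)
  have orth: "expectation (\<lambda>\<omega>. f i \<omega> * f j \<omega>) = 0" if "i \<in> I" "j \<in> I" "i \<noteq> j" for i j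
  proof -
    have "indep_var borel (f i) borel (f j)"
      by (rule indep_functions[of "{i}" "{j}"])
        (use that in \<open>auto simp: f_def[abs_def] intro!: borel_measurable_diff measurable_coordinate\<close>)
    from indep_var_lebesgue_integral[OF this int_f int_f] show ?thesis using that E0 by simp
  qed
  let ?T = "\<lambda>\<omega>. \<Sum>i\<in>I. f i \<omega>"
  have TT: "expectation (\<lambda>\<omega>. ?T \<omega> * ?T \<omega>) = real (card I) * V"
  proof -
    have "expectation (\<lambda>\<omega>. ?T \<omega> * ?T \<omega>) = expectation (\<lambda>\<omega>. \<Sum>i\<in>I. \<Sum>j\<in>I. f i \<omega> * f j \<omega>)"
      by (simp add: sum_product)
    also have "\<dots> = (\<Sum>i\<in>I. \<Sum>j\<in>I. expectation (\<lambda>\<omega>. f i \<omega> * f j \<omega>))"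
      using int_ff by simp
    also have "\<dots> = (\<Sum>i\<in>I. V)"
    proof (rule sum.cong[OF refl])
      fix i assume i: "i \<in> I"
      have "(\<Sum>j\<in>I. expectation (\<lambda>\<omega>. f i \<omega> * f j \<omega>)) = expectation (\<lambda>\<omega>. f i \<omega> * f i \<omega>)
          + (\<Sum>j\<in>I - {i}. expectation (\<lambda>\<omega>. f i \<omega> * f j \<omega>))"
        using I(1) i by (rule sum.remove)
      also have "(\<Sum>j\<in>I - {i}. expectation (\<lambda>\<omega>. f i \<omega> * f j \<omega>)) = 0"
        using i orth by (intro sum.neutral) auto
      finally show "(\<Sum>j\<in>I. expectation (\<lambda>\<omega>. f i \<omega> * f j \<omega>)) = V"
        using E2[OF i] by (simp add: power2_eq_square)
    qed
    finally show ?thesis by simp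
  qed
  have int_TT: "integrable \<Omega> (\<lambda>\<omega>. ?T \<omega> * ?T \<omega>)"
    using int_ff by (simp add: sum_product)
  have int_FT: "integrable \<Omega> (\<lambda>\<omega>. F \<omega> * ?T \<omega>)"
    using int_Ff by (simp add: sum_distrib_left)
  have int_T: "integrable \<Omega> ?T" using int_f by simp
  have ET: "expectation ?T = 0" using int_f E0 by simp
  have FT: "real (card I) * (c * V) \<le> expectation (\<lambda>\<omega>. F \<omega> * ?T \<omega>)"
  proof -
    have "real (card I) * (c * V) \<le> (\<Sum>i\<in>I. expectation (\<lambda>\<omega>. F \<omega> * f i \<omega>))"
      using sum_mono[of I "\<lambda>_. c * V", OF cov] by simp
    then show ?thesis using int_Ff by (simp add: sum_distrib_left)
  qed
  \<comment> \<open>Taking the coefficient \<open>c\<close> instead of the optimal one avoids a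
    division by \<open>V\<close>, which may be zero. The covariance bound \<open>FT\<close> turns
    the expansion into the claim.\<close>
  have "0 \<le> expectation (\<lambda>\<omega>. (F \<omega> - expectation F - c * ?T \<omega>)\<^sup>2)" by (intro integral_nonneg_AE) auto
  also have "\<dots> = expectation (\<lambda>\<omega>. (F \<omega> - expectation F)\<^sup>2 - 2 * c * (F \<omega> * ?T \<omega>)
      + 2 * c * expectation F * ?T \<omega> + c\<^sup>2 * (?T \<omega> * ?T \<omega>))"
    by (intro Bochner_Integration.integral_cong refl) (simp add: power2_eq_square algebra_simps)
  also have "\<dots> = variance F - 2 * c * expectation (\<lambda>\<omega>. F \<omega> * ?T \<omega>) + c\<^sup>2 * (real (card I) * V)"
    using int_F2 int_FT int_T int_TT ET TT by simp
  finally have "2 * c * expectation (\<lambda>\<omega>. F \<omega> * ?T \<omega>) \<le> variance F + c\<^sup>2 * (real (card I) * V)" by simp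
  moreover have "2 * c * (real (card I) * (c * V)) \<le> 2 * c * expectation (\<lambda>\<omega>. F \<omega> * ?T \<omega>)"
    using FT c by (intro mult_left_mono) auto
  ultimately have "c\<^sup>2 * real (card I) * V \<le> variance F" by (simp add: power2_eq_square algebra_simps)
  then show ?thesis by (simp add: V_def \<mu>_def)
qed

end

section \<open>Slopes of the mean in a single weight\<close>

text \<open>With coordinate 0 at \<open>v\<close> as reference, a change of the vertex weight
  becomes a common factor on all edges at \<open>v\<close>, the situation of
  \<open>mean_vertex_slope\<close>.\<close>

lemma edge_weight_update_vertex:
  assumes "card e = 2"
  shows "edge_weight (\<omega> (Inl v := x)) e =
    (if v \<in> e then exp (- x) * edge_weight (\<omega> (Inl v := 0)) e else edge_weight (\<omega> (Inl v := 0)) e)"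
proof -
  have fin: "finite e" using assms by (metis card.infinite zero_neq_numeral)
  have "(\<Sum>u\<in>e. (\<omega> (Inl v := x)) (Inl u)) = (if v \<in> e then x else 0) + (\<Sum>u\<in>e. (\<omega> (Inl v := 0)) (Inl u))" for x
  proof (cases "v \<in> e")
    case True
    then show ?thesis using fin by (simp add: sum.remove)
  next
    case False
    then have "(\<Sum>u\<in>e. (\<omega> (Inl v := x)) (Inl u)) = (\<Sum>u\<in>e. \<omega> (Inl u))" for x
      by (intro sum.cong) auto
    then show ?thesis using False by simp
  qed
  from this[of x] show ?thesis
    unfolding edge_weight_def by (simp flip: exp_add)
qed

lemma edge_weight_update_edge:
  assumes "u \<noteq> v"
  shows "edge_weight (\<omega> (Inr {v, u} := x)) =
    (edge_weight \<omega>)({v, u} := exp (x - \<omega> (Inl v) - \<omega> (Inl u)))"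
  using assms by (auto simp: edge_weight_def fun_eq_iff)

lemma edge_weight_ge:
  assumes "u \<noteq> v" "\<bar>\<omega> (Inr {v, u})\<bar> \<le> K" "\<bar>\<omega> (Inl v)\<bar> \<le> K" "\<bar>\<omega> (Inl u)\<bar> \<le> K"
  shows "exp (- (3 * K)) \<le> edge_weight \<omega> {v, u}"
  using assms by (auto simp: edge_weight_def)

context cylinder_model
begin

text \<open>The deterministic content of compact support and smallness on one cylinder; the slope
  estimates use nothing else about the realisation.\<close>

definition tame :: "real \<Rightarrow> nat \<Rightarrow> ((nat \<times> 'a) + (nat \<times> 'a) set \<Rightarrow> real) \<Rightarrow> bool" where
  "tame K n \<omega> \<longleftrightarrow> (\<forall>i\<in>coords (cyl n). \<bar>\<omega> i\<bar> \<le> K) \<and>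
    (\<forall>v\<in>cyl n. sum (edge_weight \<omega>) (incident S (cyl n) v) \<le> 1)"

text \<open>The mean decreases in a vertex weight, hence the order of \<open>x\<close> and
  \<open>y\<close>. In the constant, \<open>exp (- K)\<close> bounds the slope of the exponential,
  \<open>exp (- (3 * K))\<close> the weight of an edge at \<open>v\<close>, and
  \<open>exp (2 * K)\<close> the rescaled sum at \<open>v\<close>. From \<open>n = 2\<close> on,
  \<open>v\<close> has a neighbour in an adjacent column.\<close>

lemma mean_slope_vertex:
  assumes tame: "tame K n \<omega>" and n: "2 \<le> n" and v: "v \<in> cyl n"
    and xy: "- K \<le> x" "x \<le> y" "y \<le> K"
  shows "exp (- (4 * K)) / 4 / (1 + exp (2 * K))\<^sup>2 * (y - x) \<le>
    edge_mean S (edge_weight (\<omega> (Inl v := x))) (cyl n) - edge_mean S (edge_weight (\<omega> (Inl v := y))) (cyl n)"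
proof -
  let ?A = "cyl n"
  define w where "w = edge_weight (\<omega> (Inl v := 0))"
  interpret weighted_graph S w unfolding w_def by (rule weighted)
  have K: "\<bar>\<omega> i\<bar> \<le> K" if "i \<in> coords ?A" for i using tame that by (auto simp: tame_def)
  have inc: "sum (edge_weight \<omega>) (incident S ?A a) \<le> 1" if "a \<in> ?A" for a using tame that by (auto simp: tame_def)
  have K0: "0 \<le> K" using xy by linarith
  obtain u where u: "{v, u} \<in> S" "{v, u} \<subseteq> ?A" "u \<noteq> v"
  proof (cases "fst v < n")
    case True
    have "{v, (Suc (fst v), snd v)} \<in> S"
      unfolding strip_edge_iff using v
      by (intro disjI1 exI[of _ "fst v"] exI[of _ "snd v"]) (auto simp: cyl_verts_def)
    moreover have "{v, (Suc (fst v), snd v)} \<subseteq> ?A" "(Suc (fst v), snd v) \<noteq> v"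
      using v True by (auto simp: cyl_verts_def)
    ultimately show thesis by (rule that)
  next
    case False
    then have f: "fst v = Suc (fst v - 1)" "1 \<le> fst v - 1" using v n by (auto simp: cyl_verts_def)
    then have "{v, (fst v - 1, snd v)} = {(fst v - 1, snd v), (Suc (fst v - 1), snd v)}"
      by (cases v) auto
    then have "{v, (fst v - 1, snd v)} \<in> S"
      unfolding strip_edge_iff using v by (intro disjI1 exI[of _ "fst v - 1"] exI[of _ "snd v"]) (auto simp: cyl_verts_def)
    moreover have "{v, (fst v - 1, snd v)} \<subseteq> ?A" "(fst v - 1, snd v) \<noteq> v"
      using v f by (auto simp: cyl_verts_def prod_eq_iff)
    ultimately show thesis by (rule that)
  qed
  have w_eq: "edge_weight \<omega> e = (if v \<in> e then exp (- \<omega> (Inl v)) * w e else w e)" if "e \<in> S" for e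
    using edge_weight_update_vertex[OF card_strip_edge[OF that], of \<omega> v "\<omega> (Inl v)"] by (simp add: w_def)
  have mean_eq: "edge_mean S (edge_weight (\<omega> (Inl v := z))) ?A
      = edge_mean S (\<lambda>e. if v \<in> e then exp (- z) * w e else w e) ?A" for z
    unfolding w_def by (intro edge_mean_cong edge_weight_update_vertex card_strip_edge)
  define \<sigma> where "\<sigma> = sum w (incident S ?A v)"
  \<comment> \<open>Edges at \<open>u\<close> that avoid \<open>v\<close> do not feel the weight of
    \<open>v\<close>, so the bound by 1 survives the reset of that coordinate.\<close>
  have "sum w (incident S (?A - {v}) u) = sum (edge_weight \<omega>) (incident S (?A - {v}) u)"
    by (intro sum.cong refl) (use w_eq in \<open>auto simp: incident_def\<close>)
  also have "\<dots> \<le> sum (edge_weight \<omega>) (incident S ?A u)"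
    by (intro sum_mono2 finite_incident finite_cyl less_imp_le[OF edge_weight_pos]) (auto simp: incident_def)
  also have "\<dots> \<le> 1" using u(2) by (intro inc) auto
  finally have inc_u: "sum w (incident S (?A - {v}) u) \<le> 1" .
  have "\<sigma> = exp (\<omega> (Inl v)) * sum (edge_weight \<omega>) (incident S ?A v)"
    unfolding \<sigma>_def sum_distrib_left
    by (intro sum.cong refl) (use w_eq in \<open>auto simp: incident_def exp_minus\<close>)
  also have "\<dots> \<le> exp K * 1"
  proof (intro mult_mono inc v)
    show "exp (\<omega> (Inl v)) \<le> exp K" using K[OF InlI[OF v]] by simp
    show "0 \<le> sum (edge_weight \<omega>) (incident S ?A v)"
      by (intro sum_nonneg less_imp_le[OF edge_weight_pos])
  qed auto
  finally have \<sigma>: "\<sigma> \<le> exp K" by simp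
  have \<sigma>0: "0 \<le> \<sigma>" unfolding \<sigma>_def w_def by (intro sum_nonneg less_imp_le[OF edge_weight_pos])
  have wvu: "exp (- (3 * K)) \<le> w {v, u}"
    unfolding w_def
  proof (rule edge_weight_ge[OF u(3)])
    have "Inr {v, u} \<in> coords ?A" "Inl u \<in> coords ?A" using u by (auto simp: induced_def)
    then show "\<bar>(\<omega> (Inl v := 0)) (Inr {v, u})\<bar> \<le> K" "\<bar>(\<omega> (Inl v := 0)) (Inl v)\<bar> \<le> K"
      "\<bar>(\<omega> (Inl v := 0)) (Inl u)\<bar> \<le> K" using K K0 u(3) by auto
  qed
  have "exp (- (4 * K)) / 4 / (1 + exp (2 * K))\<^sup>2 * (y - x)
      = exp (- K) * (y - x) * (exp (- (3 * K)) / 4) / (1 + exp (2 * K))\<^sup>2"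
  proof -
    have "exp (- (4 * K)) = exp (- K) * exp (- (3 * K))" by (simp flip: exp_add)
    then show ?thesis by simp
  qed
  also have "\<dots> \<le> (exp (- x) - exp (- y)) * (w {v, u} / 4) / (1 + exp (- x) * \<sigma>)\<^sup>2"
  proof (rule frac_le)
    have "exp (- K) * (y - x) \<le> exp (- x) - exp (- y)" using exp_diff_ge[of K "- y" "- x"] xy by simp
    then show "exp (- K) * (y - x) * (exp (- (3 * K)) / 4) \<le> (exp (- x) - exp (- y)) * (w {v, u} / 4)"
      using wvu xy by (intro mult_mono) auto
    have "0 \<le> exp (- x) - exp (- y)" using xy by simp
    then show "0 \<le> (exp (- x) - exp (- y)) * (w {v, u} / 4)"
      using order_trans[OF exp_ge_zero wvu] by simp
    have p: "0 \<le> exp (- x) * \<sigma>" using \<sigma>0 by simp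
    then show "0 < (1 + exp (- x) * \<sigma>)\<^sup>2" by (intro zero_less_power) linarith
    have "exp (- x) * \<sigma> \<le> exp K * exp K" using xy \<sigma> \<sigma>0 by (intro mult_mono) auto
    also have "\<dots> = exp (2 * K)" by (simp flip: exp_add)
    finally show "(1 + exp (- x) * \<sigma>)\<^sup>2 \<le> (1 + exp (2 * K))\<^sup>2" using p by (intro power_mono) auto
  qed
  also have "\<dots> \<le> edge_mean S (edge_weight (\<omega> (Inl v := x))) ?A - edge_mean S (edge_weight (\<omega> (Inl v := y))) ?A"
    unfolding mean_eq \<sigma>_def using xy
    by (intro mean_vertex_slope[OF finite_cyl u inc_u]) auto
  finally show ?thesis .
qed

text \<open>The margin \<open>\<eta>\<close> is a lower bound for the present weight of the edge:
  taken out of a sum that is at most 1 at either end, it leaves \<open>1 - \<eta>\<close> for the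
  other edges, whatever value the edge receives afterwards.\<close>

lemma mean_slope_edge:
  assumes tame: "tame K n \<omega>" and e: "{v, u} \<in> S" "{v, u} \<subseteq> cyl n" "u \<noteq> v"
    and xy: "- K \<le> x" "x \<le> y" "y \<le> K"
  shows "exp (- (6 * K)) / 8 / (1 + exp (3 * K))\<^sup>2 * (y - x) \<le>
    edge_mean S (edge_weight (\<omega> (Inr {v, u} := y))) (cyl n) - edge_mean S (edge_weight (\<omega> (Inr {v, u} := x))) (cyl n)"
proof -
  let ?A = "cyl n"
  interpret weighted_graph S "edge_weight \<omega>" by (rule weighted)
  have K: "\<bar>\<omega> i\<bar> \<le> K" if "i \<in> coords ?A" for i using tame that by (auto simp: tame_def)
  have co: "Inr {v, u} \<in> coords ?A" "Inl v \<in> coords ?A" "Inl u \<in> coords ?A" using e by (auto simp: induced_def)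
  define \<eta> where "\<eta> = exp (- (3 * K))"
  define s where "s = \<omega> (Inl v) + \<omega> (Inl u)"
  have K0: "0 \<le> K" using xy by linarith
  have s: "\<bar>s\<bar> \<le> 2 * K" using K[OF co(2)] K[OF co(3)] by (simp add: s_def)
  have \<eta>: "0 \<le> \<eta>" "\<eta> \<le> 1" using K0 by (auto simp: \<eta>_def)
  have w: "\<eta> \<le> edge_weight \<omega> {v, u}"
    unfolding \<eta>_def by (rule edge_weight_ge[OF e(3)]) (use K co in auto)
  have inc: "sum ((edge_weight \<omega>)({v, u} := 0)) (incident S ?A a) \<le> 1 - \<eta>" if "a \<in> {v, u}" for a
  proof -
    have mem: "{v, u} \<in> incident S ?A a" using e that by (auto simp: incident_def)
    have "sum ((edge_weight \<omega>)({v, u} := 0)) (incident S ?A a)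
        = sum ((edge_weight \<omega>)({v, u} := 0)) (incident S ?A a - {{v, u}})"
      using sum.remove[OF finite_incident[OF finite_cyl] mem, of "(edge_weight \<omega>)({v, u} := 0)"] by simp
    also have "\<dots> = sum (edge_weight \<omega>) (incident S ?A a - {{v, u}})"
      by (intro sum.cong) auto
    also have "\<dots> = sum (edge_weight \<omega>) (incident S ?A a) - edge_weight \<omega> {v, u}"
      using sum.remove[OF finite_incident[OF finite_cyl] mem, of "edge_weight \<omega>"] by simp
    also have "\<dots> \<le> 1 - \<eta>" using w tame that e(2) by (force simp: tame_def)
    finally show ?thesis .
  qed
  have "exp (- (6 * K)) / 8 / (1 + exp (3 * K))\<^sup>2 * (y - x)
      = exp (- (3 * K)) * (y - x) * (\<eta> / 8) / (1 + exp (3 * K))\<^sup>2"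
  proof -
    have "exp (- (6 * K)) = exp (- (3 * K)) * \<eta>" by (simp add: \<eta>_def flip: exp_add)
    then show ?thesis by simp
  qed
  also have "\<dots> \<le> (exp (y - s) - exp (x - s)) * (\<eta> / 8) / (1 + exp (y - s))\<^sup>2"
  proof (rule frac_le)
    have "exp (- (3 * K)) * (y - x) \<le> exp (y - s) - exp (x - s)"
      using exp_diff_ge[of "3 * K" "x - s" "y - s"] s xy by auto
    then show "exp (- (3 * K)) * (y - x) * (\<eta> / 8) \<le> (exp (y - s) - exp (x - s)) * (\<eta> / 8)"
      using \<eta> by (intro mult_right_mono) auto
    show "0 \<le> (exp (y - s) - exp (x - s)) * (\<eta> / 8)" using xy \<eta> by (intro mult_nonneg_nonneg) auto
    show "0 < (1 + exp (y - s))\<^sup>2" by (intro zero_less_power add_pos_pos) auto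
    have "exp (y - s) \<le> exp (3 * K)" using s xy by auto
    then show "(1 + exp (y - s))\<^sup>2 \<le> (1 + exp (3 * K))\<^sup>2" by (intro power_mono) (auto intro: add_nonneg_nonneg)
  qed
  also have "\<dots> \<le> edge_mean S ((edge_weight \<omega>)({v, u} := exp (y - s))) ?A
      - edge_mean S ((edge_weight \<omega>)({v, u} := exp (x - s))) ?A"
    using xy by (intro mean_edge_slope[OF finite_cyl e \<eta> inc inc]) auto
  finally show ?thesis
    unfolding edge_weight_update_edge[OF e(3)] s_def diff_diff_eq .
qed

text \<open>One non-degenerate law is enough. For \<open>N\<close> all vertex coordinates are used,
  otherwise the \<open>n - 1\<close> edges along one row, and \<open>n - 1\<close> is at least
  \<open>n / 2\<close> from \<open>n = 2\<close> on. The constant does not depend on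
  \<open>n\<close>.\<close>

lemma variance_edge_mean_ge:
  assumes K: "AE x in N. \<bar>x\<bar> \<le> K" "AE x in W. \<bar>x\<bar> \<le> K"
    and deg: "\<not> (degenerate N \<and> degenerate W)"
  shows "\<exists>c>0. \<forall>n\<ge>2. (AE \<omega> in \<Omega>. tame K n \<omega>) \<longrightarrow>
    c * real n \<le> variance (\<lambda>\<omega>. edge_mean S (edge_weight \<omega>) (cyl n))"
proof -
  let ?F = "\<lambda>n \<omega>. edge_mean S (edge_weight \<omega>) (cyl n)"
  have rv: "?F n \<in> borel_measurable \<Omega>" for n by (rule measurable_edge_mean) simp
  have var_pos: "0 < prob_space.variance D (\<lambda>x. x)"
    if D: "prob_space D" "sets D = sets borel" "AE x in D. \<bar>x\<bar> \<le> K" "\<not> degenerate D" for D :: "real measure"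
  proof -
    interpret D: prob_space D by (rule D(1))
    let ?\<mu> = "D.expectation (\<lambda>x. x)"
    have "(\<lambda>x. (x - ?\<mu>)\<^sup>2) \<in> borel_measurable D"
      unfolding measurable_cong_sets[OF D(2) refl] by simp
    moreover have "AE x in D. \<bar>(x - ?\<mu>)\<^sup>2\<bar> \<le> (K + \<bar>?\<mu>\<bar>)\<^sup>2"
      using D(3)
    proof eventually_elim
      case (elim x)
      then have "\<bar>x - ?\<mu>\<bar>\<^sup>2 \<le> (K + \<bar>?\<mu>\<bar>)\<^sup>2" by (intro power_mono) auto
      then show ?case by simp
    qed
    ultimately have int: "integrable D (\<lambda>x. (x - ?\<mu>)\<^sup>2)" by (rule D.integrable_AE_bounded)
    have "D.variance (\<lambda>x. x) \<noteq> 0"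
    proof
      assume "D.variance (\<lambda>x. x) = 0"
      then have "AE x in D. (x - ?\<mu>)\<^sup>2 = 0" using integral_nonneg_eq_0_iff_AE[OF int] by simp
      then have "AE x in D. x = ?\<mu>" by eventually_elim simp
      then show False using D(4) unfolding degenerate_def by blast
    qed
    then show ?thesis by (simp add: less_le)
  qed
  obtain j where j: "j \<in> VH" using VH by auto
  show ?thesis
  proof (cases "degenerate N")
    case False
    define c where "c = exp (- (4 * K)) / 4 / (1 + exp (2 * K))\<^sup>2"
    have c: "0 < c" unfolding c_def by (intro divide_pos_pos zero_less_power add_pos_pos) auto
    have V: "0 < prob_space.variance N (\<lambda>x. x)" by (rule var_pos[OF prob_N sets_N K(1) False])
    have "c\<^sup>2 * prob_space.variance N (\<lambda>x. x) * real n \<le> variance (?F n)"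
      if n: "2 \<le> n" and tame: "AE \<omega> in \<Omega>. tame K n \<omega>" for n
    proof -
      \<comment> \<open>The sign is reversed because \<open>?F n\<close> decreases in the vertex
        weights, while \<open>variance_ge_coordinates\<close> wants an increasing function.\<close>
      have "c\<^sup>2 * real (card (Inl ` cyl n :: ((nat \<times> 'a) + (nat \<times> 'a) set) set)) * prob_space.variance N (\<lambda>x. x)
          \<le> variance (\<lambda>\<omega>. - ?F n \<omega>)"
      proof (rule variance_ge_coordinates[where B = "card (cyl n)" and K = K])
        show "(\<lambda>\<omega>. - ?F n \<omega>) \<in> borel_measurable \<Omega>" by (rule borel_measurable_uminus[OF rv])
        show "\<bar>- ?F n \<omega>\<bar> \<le> card (cyl n)" for \<omega> using edge_mean_bound[OF finite_cyl] by simp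
        show "AE \<omega> in \<Omega>. \<forall>x y. - K \<le> x \<and> x \<le> y \<and> y \<le> K \<longrightarrow>
            c * (y - x) \<le> - ?F n (\<omega> (i := y)) - - ?F n (\<omega> (i := x))" if i: "i \<in> Inl ` cyl n" for i
          using tame
        proof eventually_elim
          case (elim \<omega>)
          obtain v where v: "v \<in> cyl n" "i = Inl v" using i by auto
          show ?case unfolding v(2) c_def using mean_slope_vertex[OF elim n v(1)] by simp
        qed
      qed (use finite_cyl K c in auto)
      also have "variance (\<lambda>\<omega>. - ?F n \<omega>) = variance (?F n)"
        by (simp add: power2_commute)
      finally have "c\<^sup>2 * real (card (cyl n)) * prob_space.variance N (\<lambda>x. x) \<le> variance (?F n)"
        by (simp add: card_image)
      moreover have "n * 1 \<le> n * card VH"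
        using VH finite_VH by (intro mult_le_mono2) (simp add: Suc_leI card_gt_0_iff)
      then have "real n \<le> real (card (cyl n))"
        by (simp add: cyl_verts_def card_cartesian_product flip: of_nat_mult)
      then have "(c\<^sup>2 * prob_space.variance N (\<lambda>x. x)) * real n
          \<le> (c\<^sup>2 * prob_space.variance N (\<lambda>x. x)) * real (card (cyl n))"
        using V by (intro mult_left_mono mult_nonneg_nonneg) auto
      ultimately show ?thesis by (simp only: mult.assoc mult.commute[of "real (card (cyl n))"])
    qed
    then show ?thesis using V c by (intro exI[of _ "c\<^sup>2 * prob_space.variance N (\<lambda>x. x)"]) auto
  next
    case True
    then have W: "\<not> degenerate W" using deg by simp
    define c where "c = exp (- (6 * K)) / 8 / (1 + exp (3 * K))\<^sup>2"
    have c: "0 < c" unfolding c_def by (intro divide_pos_pos zero_less_power add_pos_pos) auto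
    have V: "0 < prob_space.variance W (\<lambda>x. x)" by (rule var_pos[OF prob_W sets_W K(2) W])
    have "c\<^sup>2 * prob_space.variance W (\<lambda>x. x) / 2 * real n \<le> variance (?F n)"
      if n: "2 \<le> n" and tame: "AE \<omega> in \<Omega>. tame K n \<omega>" for n
    proof -
      let ?e = "\<lambda>k. {(k, j), (Suc k, j)}"
      define I where "I = (\<lambda>k. Inr (?e k) :: (nat \<times> 'a) + (nat \<times> 'a) set) ` {1..<n}"
      have card_I: "card I = n - 1"
        unfolding I_def by (subst card_image) (auto simp: inj_on_def doubleton_eq_iff)
      have "c\<^sup>2 * real (card I) * prob_space.variance W (\<lambda>x. x) \<le> variance (?F n)"
      proof (rule variance_ge_coordinates[where B = "card (cyl n)" and K = K])
        show "\<bar>?F n \<omega>\<bar> \<le> card (cyl n)" for \<omega> by (rule edge_mean_bound[OF finite_cyl])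
        show "AE \<omega> in \<Omega>. \<forall>x y. - K \<le> x \<and> x \<le> y \<and> y \<le> K \<longrightarrow>
            c * (y - x) \<le> ?F n (\<omega> (i := y)) - ?F n (\<omega> (i := x))" if i: "i \<in> I" for i
          using tame
        proof eventually_elim
          case (elim \<omega>)
          obtain k where k: "1 \<le> k" "k < n" "i = Inr (?e k)" using i by (auto simp: I_def)
          have "?e k \<in> S" unfolding strip_edge_iff using j by blast
          moreover have "?e k \<subseteq> cyl n" using k j by (auto simp: cyl_verts_def)
          moreover have "(Suc k, j) \<noteq> (k, j)" by simp
          ultimately show ?case unfolding k(3) c_def using mean_slope_edge[OF elim] by blast
        qed
        show "finite I" by (simp add: I_def)
      qed (use K c rv in \<open>auto simp: I_def\<close>)
      moreover have "real n / 2 \<le> real (card I)" using n by (simp add: card_I of_nat_diff)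
      then have "(c\<^sup>2 * prob_space.variance W (\<lambda>x. x)) * (real n / 2)
          \<le> (c\<^sup>2 * prob_space.variance W (\<lambda>x. x)) * real (card I)"
        using V by (intro mult_left_mono mult_nonneg_nonneg) auto
      ultimately show ?thesis by (simp add: mult.assoc mult.commute[of "real (card I)"])
    qed
    then show ?thesis using V c by (intro exI[of _ "c\<^sup>2 * prob_space.variance W (\<lambda>x. x) / 2"]) auto
  qed
qed


section \<open>From realisations to the hypotheses on the strip\<close>

text \<open>The number of unpaired vertices is nonnegative. Twice as sharp as
  \<open>edge_mean_bound\<close>, this confines the limit in (i) to its interval.\<close>

lemma edge_mean_range:
  assumes "finite A"
  shows "0 \<le> edge_mean S (edge_weight \<omega>) A" "2 * edge_mean S (edge_weight \<omega>) A \<le> card A"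
proof -
  interpret weighted_graph S "edge_weight \<omega>" by (rule weighted)
  have Z: "1 \<le> Z A" by (rule Z_ge_1[OF assms])
  have "0 \<le> msum real A"
    unfolding matching_sum_def using prod_weight_nonneg by (intro sum_nonneg mult_nonneg_nonneg) auto
  then show "0 \<le> mean A" using Z by (simp add: edge_mean_def)
  have "msum real A \<le> msum (\<lambda>k. 0 * (real k)\<^sup>2 + 0 * real k + card A / 2) A"
    unfolding matching_sum_def
  proof (intro sum_mono mult_right_mono prod_weight_nonneg)
    fix m assume "m \<in> matchings (induced S A)"
    from num_unpaired_eq[OF card_strip_edge assms this]
    show "real (card m) \<le> 0 * (real (card m))\<^sup>2 + 0 * real (card m) + card A / 2"
      by (simp add: num_unpaired_def)
  qed
  also have "\<dots> = card A / 2 * Z A" unfolding msum_quadratic by simp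
  finally show "2 * mean A \<le> card A" using Z by (simp add: edge_mean_def field_simps)
qed

lemma realisation_affine:
  fixes M :: "'w measure" and g :: "((nat \<times> 'a) + (nat \<times> 'a) set \<Rightarrow> real) \<Rightarrow> real"
  assumes rw: "random_weights N W (cyl n) (induced S (cyl n)) M \<nu> \<omega>" and n: "1 \<le> n"
    and g: "\<And>J. coords (cyl n) \<subseteq> J \<Longrightarrow> g \<in> borel_measurable (Pi\<^sub>M J law)"
      "\<And>\<omega>. g (restrict \<omega> (coords (cyl n))) = g \<omega>"
    and B: "\<And>\<omega>. \<bar>g \<omega>\<bar> \<le> B"
    and X: "\<And>x. X x = a + b * g (\<lambda>i. case_sum \<nu> \<omega> i x)"
  shows "X \<in> borel_measurable M" "integrable M (\<lambda>x. (X x)\<^sup>2)"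
    and "integral\<^sup>L M X = a + b * expectation g"
    and "prob_space.variance M X = b\<^sup>2 * variance g"
proof -
  have M: "prob_space M" using rw by (simp add: random_weights_def)
  have gJ: "g \<in> borel_measurable (Pi\<^sub>M (coords (cyl n)) law)" and gO: "g \<in> borel_measurable \<Omega>"
    by (rule g(1), simp)+
  have X': "X = (\<lambda>x. a + b * g (\<lambda>i. case_sum \<nu> \<omega> i x))" using X by auto
  show Xm: "X \<in> borel_measurable M"
    unfolding X' by (intro borel_measurable_add borel_measurable_times borel_measurable_const
        distr_realisation(1)[OF rw n gJ g(2)])
  have "\<bar>(X x)\<^sup>2\<bar> \<le> (\<bar>a\<bar> + \<bar>b\<bar> * B)\<^sup>2" for x
  proof -
    have "\<bar>X x\<bar> \<le> \<bar>a\<bar> + \<bar>b\<bar> * \<bar>g (\<lambda>i. case_sum \<nu> \<omega> i x)\<bar>"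
      unfolding X by (simp add: abs_mult[symmetric] abs_triangle_ineq)
    also have "\<dots> \<le> \<bar>a\<bar> + \<bar>b\<bar> * B" by (intro add_left_mono mult_left_mono B) simp
    finally have "\<bar>X x\<bar>\<^sup>2 \<le> (\<bar>a\<bar> + \<bar>b\<bar> * B)\<^sup>2" by (intro power_mono) auto
    then show ?thesis by simp
  qed
  then show "integrable M (\<lambda>x. (X x)\<^sup>2)"
    by (intro prob_space.integrable_bounded[OF M] borel_measurable_power Xm)
  have ig: "integrable \<Omega> g" by (rule integrable_bounded[OF gO B])
  have "integral\<^sup>L M X = expectation (\<lambda>\<omega>. a + b * g \<omega>)"
    unfolding X' by (rule expectation_realisation[OF rw n gJ g(2) gO, of "\<lambda>t. a + b * t"]) simp
  then show E: "integral\<^sup>L M X = a + b * expectation g" using ig by (simp add: prob_space)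
  have "prob_space.variance M X = expectation (\<lambda>\<omega>. (a + b * g \<omega> - (a + b * expectation g))\<^sup>2)"
    unfolding E unfolding X'
    by (rule expectation_realisation[OF rw n gJ g(2) gO, of "\<lambda>t. (a + b * t - (a + b * expectation g))\<^sup>2"]) simp
  also have "\<dots> = expectation (\<lambda>\<omega>. b\<^sup>2 * (g \<omega> - expectation g)\<^sup>2)"
    by (intro Bochner_Integration.integral_cong refl) (simp add: power2_eq_square algebra_simps)
  finally show "prob_space.variance M X = b\<^sup>2 * variance g" by simp
qed

lemma case_sum_apply: "(\<lambda>i. case_sum f g i x) = case_sum (\<lambda>v. f v x) (\<lambda>e. g e x)"
  by (auto split: sum.split)

lemma cyl_U_mean_eq:
  "cyl_U_mean VH EH \<nu> \<omega> n x = real (card (cyl n))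
    + (- 2) * edge_mean S (edge_weight (\<lambda>i. case_sum (\<nu> n) (\<omega> n) i x)) (cyl n)"
  unfolding cyl_U_mean_def cyl_edges_eq case_sum_apply
  by (simp add: U_mean_eq[OF card_strip_edge finite_cyl])

lemma cyl_U_quenched_var_eq:
  "cyl_U_quenched_var VH EH \<nu> \<omega> n x =
    0 + 4 * edge_var S (edge_weight (\<lambda>i. case_sum (\<nu> n) (\<omega> n) i x)) (cyl n)"
  unfolding cyl_U_quenched_var_def cyl_edges_eq case_sum_apply
  by (simp add: U_quenched_var_eq[OF card_strip_edge finite_cyl])

text \<open>Averaging the hypothesis over the two ends of an edge bounds its absorbed weight by
  \<open>1 / d\<close>, and at most \<open>d\<close> edges meet at a vertex. The case without
  incident edges is separated because \<open>d\<close> may then be 0.\<close>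

lemma sum_incident_le_1:
  assumes "\<And>e v. e \<in> induced S (cyl n) \<Longrightarrow> v \<in> cyl n \<Longrightarrow>
    \<omega> (Inr e) - 2 * \<omega> (Inl v) < - ln (real (max_degree (cyl n) (induced S (cyl n))))"
    and v: "v \<in> cyl n"
  shows "sum (edge_weight \<omega>) (incident S (cyl n) v) \<le> 1"
proof (cases "incident S (cyl n) v = {}")
  case False
  define d where "d = real (max_degree (cyl n) (induced S (cyl n)))"
  have "{e \<in> induced S (cyl n). v \<in> e} = incident S (cyl n) v" by (auto simp: induced_def incident_def)
  then have "card (incident S (cyl n) v) \<in> (\<lambda>v. card {e \<in> induced S (cyl n). v \<in> e}) ` cyl n"
    using v by (intro image_eqI[of _ _ v]) auto
  then have "card (incident S (cyl n) v) \<le> max_degree (cyl n) (induced S (cyl n))"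
    unfolding max_degree_def using finite_cyl by (intro Max_ge finite_imageI)
  then have d: "real (card (incident S (cyl n) v)) \<le> d" by (simp add: d_def)
  moreover have "0 < card (incident S (cyl n) v)"
    using False finite_incident[OF finite_cyl] by (simp add: card_gt_0_iff)
  ultimately have d0: "0 < d" by linarith
  have "edge_weight \<omega> e \<le> 1 / d" if e: "e \<in> incident S (cyl n) v" for e
  proof -
    have e': "e \<in> S" "e \<subseteq> cyl n" using e by (auto simp: incident_def)
    obtain a b where ab: "e = {a, b}" "a \<noteq> b" using card_strip_edge[OF e'(1)] by (auto simp: card_2_iff)
    have ind: "e \<in> induced S (cyl n)" using e' by (simp add: induced_def)
    have "\<omega> (Inr e) - 2 * \<omega> (Inl a) < - ln d" "\<omega> (Inr e) - 2 * \<omega> (Inl b) < - ln d"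
      unfolding d_def using e'(2) ab(1) by (intro assms(1)[OF ind]; blast)+
    then have "\<omega> (Inr e) - (\<Sum>v\<in>e. \<omega> (Inl v)) \<le> - ln d" using ab by simp
    then have "edge_weight \<omega> e \<le> exp (- ln d)" by (simp add: edge_weight_def)
    also have "\<dots> = 1 / d" using d0 by (simp add: exp_minus inverse_eq_divide)
    finally show ?thesis .
  qed
  then have "sum (edge_weight \<omega>) (incident S (cyl n) v) \<le> real (card (incident S (cyl n) v)) * (1 / d)"
    by (rule sum_bounded_above)
  also have "\<dots> \<le> 1" using d d0 by simp
  finally show ?thesis .
qed simp

text \<open>Smallness is assumed for the realisation on \<open>M\<close>. What moves to
  \<open>\<Omega>\<close> is its consequence for the weight sum at each vertex, a real function of
  the cylinder's coordinates whose law is the same on both spaces.\<close>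

lemma AE_tame:
  fixes M :: "'w measure"
  assumes rw: "random_weights N W (cyl n) (induced S (cyl n)) M \<nu> \<omega>" and n: "1 \<le> n"
    and K: "AE x in N. \<bar>x\<bar> \<le> K" "AE x in W. \<bar>x\<bar> \<le> K"
    and small: "\<forall>e\<in>induced S (cyl n). \<forall>v\<in>cyl n. AE x in M.
      \<omega> e x - 2 * \<nu> v x < - ln (real (max_degree (cyl n) (induced S (cyl n))))"
  shows "AE \<omega> in \<Omega>. tame K n \<omega>"
proof -
  have fin: "finite (coords (cyl n))" by (intro finite_Plus finite_induced finite_cyl)
  have "AE \<omega> in \<Omega>. \<bar>\<omega> i\<bar> \<le> K" for i
  proof (rule AE_PiM_component[of UNIV law i, OF prob_law UNIV_I])
    have "law i = N \<or> law i = W" by (cases i) simp_all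
    then show "AE x in law i. \<bar>x\<bar> \<le> K" using K by (elim disjE) (simp_all only:)
  qed
  then have 1: "AE \<omega> in \<Omega>. \<forall>i\<in>coords (cyl n). \<bar>\<omega> i\<bar> \<le> K"
    by (rule AE_finite_allI[OF fin])
  have "AE x in M. \<forall>e\<in>induced S (cyl n). \<forall>v\<in>cyl n.
      \<omega> e x - 2 * \<nu> v x < - ln (real (max_degree (cyl n) (induced S (cyl n))))"
    using small by (intro AE_finite_allI finite_induced finite_cyl) auto
  then have AE_M: "AE x in M. sum (edge_weight (\<lambda>i. case_sum \<nu> \<omega> i x)) (incident S (cyl n) v) \<le> 1"
    if "v \<in> cyl n" for v
    by eventually_elim (intro sum_incident_le_1 that, simp)
  have "AE \<omega> in \<Omega>. sum (edge_weight \<omega>) (incident S (cyl n) v) \<le> 1" if v: "v \<in> cyl n" for v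
  proof -
    let ?g = "\<lambda>\<omega>. sum (edge_weight \<omega>) (incident S (cyl n) v)"
    have g: "?g \<in> borel_measurable (Pi\<^sub>M J law)" if "coords (cyl n) \<subseteq> J" for J
      using that by (intro borel_measurable_sum measurable_edge_weight[where A = "cyl n"])
        (auto simp: incident_def induced_def)
    have gJ: "?g \<in> borel_measurable (Pi\<^sub>M (coords (cyl n)) law)" and gO: "?g \<in> borel_measurable \<Omega>"
      by (rule g, simp)+
    define G where "G x = ?g (\<lambda>i. case_sum \<nu> \<omega> i x)" for x
    have G: "G \<in> borel_measurable M" "distr M borel G = distr \<Omega> borel ?g"
      unfolding G_def[abs_def] by (rule distr_realisation[OF rw n gJ incident_restrict])+
    have "AE x in M. G x \<le> 1" unfolding G_def by (rule AE_M[OF v])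
    then have "AE y in distr M borel G. y \<le> 1" by (subst AE_distr_iff[OF G(1)]) auto
    then show ?thesis unfolding G(2) by (rule AE_distrD[OF gO])
  qed
  then have "AE \<omega> in \<Omega>. \<forall>v\<in>cyl n. sum (edge_weight \<omega>) (incident S (cyl n) v) \<le> 1"
    by (intro AE_finite_allI finite_cyl)
  with 1 show ?thesis by eventually_elim (simp add: tame_def)
qed

lemma compactly_supported_AE:
  assumes "compactly_supported D" shows "\<exists>K. AE x in D. \<bar>x\<bar> \<le> K"
proof -
  obtain C where C: "compact C" "AE x in D. x \<in> C" using assms by (auto simp: compactly_supported_def)
  then obtain K where "\<forall>x\<in>C. \<bar>x\<bar> \<le> K" using compact_imp_bounded[of C] by (auto simp: bounded_iff)
  with C(2) have "AE x in D. \<bar>x\<bar> \<le> K" by (auto elim: eventually_mono)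
  then show ?thesis ..
qed

end

text \<open>Each column has \<open>card VH\<close> vertices, which is the natural upper bound for
  \<open>u\<close>. If both laws are point masses, the Gibbs mean of the number of unpaired vertices
  is almost surely constant and \<open>\<sigma>\<^sub>A\<close> is 0, so (iii) excludes this case.
  The constants precede the quantifier over realisations and thus depend on the graph and the laws
  only.\<close>

theorem theorem1p3:
  fixes VH :: "'a set" and EH :: "'a set set"
    and N W :: "real measure" and \<epsilon> :: real
  assumes "simple_graph VH EH" and "VH \<noteq> {}"
    and "prob_space N" and "sets N = sets borel"
    and "prob_space W" and "sets W = sets borel"
    and "\<epsilon> > 0"
    and "integrable N (\<lambda>x. \<bar>x\<bar> powr (2 + \<epsilon>))"
    and "integrable W (\<lambda>x. \<bar>x\<bar> powr (2 + \<epsilon>))"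
  shows
    "(\<exists>u. 0 \<le> u \<and> u \<le> real (card VH) \<and>
        (\<forall>(M :: nat \<Rightarrow> 'w measure) \<nu> \<omega>. cylinder_weights VH EH N W M \<nu> \<omega> \<longrightarrow>
           tendsto_in_prob M (\<lambda>n x. cyl_U_mean VH EH \<nu> \<omega> n x / real n) u)) \<and>
     (\<exists>\<sigma>\<^sub>Q \<sigma>\<^sub>A. 0 < \<sigma>\<^sub>Q \<and> 0 \<le> \<sigma>\<^sub>A \<and>
        (\<forall>(M :: nat \<Rightarrow> 'w measure) \<nu> \<omega>. cylinder_weights VH EH N W M \<nu> \<omega> \<longrightarrow>
           tendsto_in_prob M (\<lambda>n x. cyl_U_quenched_var VH EH \<nu> \<omega> n x / real n) (\<sigma>\<^sub>Q\<^sup>2) \<and>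
           (\<lambda>n. prob_space.variance (M n) (cyl_U_mean VH EH \<nu> \<omega> n) / real n) \<longlonglongrightarrow> \<sigma>\<^sub>A\<^sup>2 \<and>
           (compactly_supported N \<and> compactly_supported W \<and>
            \<not> (degenerate N \<and> degenerate W) \<and> small_edge_weights VH EH M \<nu> \<omega> \<longrightarrow>
              0 < \<sigma>\<^sub>A)))"
proof -
  interpret cylinder_model VH EH N W
    using assms(1-6) by (simp add: cylinder_model_def)
  let ?f = "\<lambda>n \<omega>. edge_mean S (edge_weight \<omega>) (cyl n)"
  let ?v = "\<lambda>n \<omega>. edge_var S (edge_weight \<omega>) (cyl n)"
  define h where "h = real (card VH)"
  have card_cyl: "real (card (cyl n)) = h * real n" for n
    by (simp add: h_def cyl_verts_def card_cartesian_product)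
  have rw: "random_weights N W (cyl n) (induced S (cyl n)) (M n) (\<nu> n) (\<omega> n)"
    if "cylinder_weights VH EH N W M \<nu> \<omega>" "1 \<le> n" for M :: "nat \<Rightarrow> 'w measure" and \<nu> \<omega> n
    using that by (simp add: cylinder_weights_def cyl_edges_eq)
  have mean_real: "cyl_U_mean VH EH \<nu> \<omega> n \<in> borel_measurable (M n)"
    "integrable (M n) (\<lambda>x. (cyl_U_mean VH EH \<nu> \<omega> n x)\<^sup>2)"
    "integral\<^sup>L (M n) (cyl_U_mean VH EH \<nu> \<omega> n) = real (card (cyl n)) + (- 2) * expectation (?f n)"
    "prob_space.variance (M n) (cyl_U_mean VH EH \<nu> \<omega> n) = ((- 2))\<^sup>2 * variance (?f n)"
    if "cylinder_weights VH EH N W M \<nu> \<omega>" "1 \<le> n" for M :: "nat \<Rightarrow> 'w measure" and \<nu> \<omega> n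
    by (rule realisation_affine[where g = "?f n" and X = "cyl_U_mean VH EH \<nu> \<omega> n",
        OF rw[OF that] that(2) measurable_edge_mean edge_mean_restrict edge_mean_bound[OF finite_cyl] cyl_U_mean_eq], assumption?)+
  have var_real: "cyl_U_quenched_var VH EH \<nu> \<omega> n \<in> borel_measurable (M n)"
    "integrable (M n) (\<lambda>x. (cyl_U_quenched_var VH EH \<nu> \<omega> n x)\<^sup>2)"
    "integral\<^sup>L (M n) (cyl_U_quenched_var VH EH \<nu> \<omega> n) = 0 + 4 * expectation (?v n)"
    "prob_space.variance (M n) (cyl_U_quenched_var VH EH \<nu> \<omega> n) = (4)\<^sup>2 * variance (?v n)"
    if "cylinder_weights VH EH N W M \<nu> \<omega>" "1 \<le> n" for M :: "nat \<Rightarrow> 'w measure" and \<nu> \<omega> n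
    by (rule realisation_affine[where g = "?v n" and X = "cyl_U_quenched_var VH EH \<nu> \<omega> n",
        OF rw[OF that] that(2) measurable_edge_var edge_var_restrict edge_var_bound[OF finite_cyl] cyl_U_quenched_var_eq], assumption?)+
  obtain a where a: "(\<lambda>n. expectation (?f n) / real n) \<longlonglongrightarrow> a"
    using edge_mean_limits(1) by (auto simp: convergent_def)
  obtain s where s: "(\<lambda>n. variance (?f n) / real n) \<longlonglongrightarrow> s"
    using edge_mean_limits(2) by (auto simp: convergent_def)
  obtain K where K: "\<And>n. 1 \<le> n \<Longrightarrow> variance (?f n) \<le> K * real n"
    using edge_mean_limits(3) by blast
  obtain b where b: "(\<lambda>n. expectation (?v n) / real n) \<longlonglongrightarrow> b"
    using edge_var_limits(1) by (auto simp: convergent_def)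
  obtain L where L: "\<And>n. 1 \<le> n \<Longrightarrow> variance (?v n) \<le> L * real n"
    using edge_var_limits(3) by blast
  have prob_M: "prob_space (M n)" if "cylinder_weights VH EH N W M \<nu> \<omega>" "1 \<le> n"
    for M :: "nat \<Rightarrow> 'w measure" and \<nu> \<omega> n
    using rw[OF that] by (simp add: random_weights_def)
  have int_f: "integrable \<Omega> (?f n)" for n
    by (rule integrable_bounded[OF measurable_edge_mean edge_mean_bound[OF finite_cyl]]) simp
  have f_range: "0 \<le> expectation (?f n) / real n" "expectation (?f n) / real n \<le> h / 2" if "1 \<le> n" for n
  proof -
    show "0 \<le> expectation (?f n) / real n"
      by (intro divide_nonneg_nonneg integral_nonneg_AE AE_I2 edge_mean_range finite_cyl) simp
    have "expectation (?f n) \<le> h * real n / 2"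
      using edge_mean_range(2)[OF finite_cyl] card_cyl int_f
      by (intro integral_le_const) (auto simp: field_simps)
    then show "expectation (?f n) / real n \<le> h / 2" using that by (simp add: field_simps)
  qed
  have a0: "0 \<le> a" using LIMSEQ_le_const[OF a] f_range(1) by blast
  have ah: "a \<le> h / 2" using LIMSEQ_le_const2[OF a] f_range(2) by blast
  have s0: "0 \<le> s"
  proof (rule LIMSEQ_le_const[OF s], intro exI allI impI)
    show "0 \<le> variance (?f n) / real n" for n by (intro divide_nonneg_nonneg integral_nonneg_AE) auto
  qed
  have b0: "0 < b"
  proof -
    obtain r where r: "0 < r" "\<And>q n. 4 * q \<le> n \<Longrightarrow> real q * r \<le> expectation (?v n)"
      using edge_var_expectation_ge by blast
    \<comment> \<open>\<open>n div 4\<close> blocks fit into the cylinder, and for these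
      \<open>n\<close> that is at least \<open>n / 8\<close>.\<close>
    have "r / 8 \<le> expectation (?v n) / real n" if "8 \<le> n" for n
    proof -
      have "n \<le> 8 * (n div 4)" using that by presburger
      then have "real n / 8 \<le> real (n div 4)" by linarith
      then have "real n / 8 * r \<le> real (n div 4) * r" using r(1) by (intro mult_right_mono) auto
      also have "\<dots> \<le> expectation (?v n)" by (intro r(2)) simp
      finally show ?thesis using that by (simp add: field_simps)
    qed
    then have "r / 8 \<le> b" using LIMSEQ_le_const[OF b] by blast
    then show ?thesis using r(1) by linarith
  qed
  have i: "tendsto_in_prob M (\<lambda>n x. cyl_U_mean VH EH \<nu> \<omega> n x / real n) (h - 2 * a)"
    if cw: "cylinder_weights VH EH N W M \<nu> \<omega>" for M :: "nat \<Rightarrow> 'w measure" and \<nu> \<omega>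
  proof (rule tendsto_in_prob_variance[where K = "4 * K"])
    fix n :: nat assume n: "1 \<le> n"
    show "prob_space (M n)" by (rule prob_M[OF cw n])
    show "cyl_U_mean VH EH \<nu> \<omega> n \<in> borel_measurable (M n)" by (rule mean_real(1)[OF cw n])
    show "integrable (M n) (\<lambda>x. (cyl_U_mean VH EH \<nu> \<omega> n x)\<^sup>2)" by (rule mean_real(2)[OF cw n])
    show "prob_space.variance (M n) (cyl_U_mean VH EH \<nu> \<omega> n) \<le> 4 * K * real n"
      unfolding mean_real(4)[OF cw n] using K[OF n] by simp
  next
    have "(\<lambda>n. h - 2 * (expectation (?f n) / real n)) \<longlonglongrightarrow> h - 2 * a"
      by (intro tendsto_intros a)
    moreover have "eventually (\<lambda>n. h - 2 * (expectation (?f n) / real n)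
        = integral\<^sup>L (M n) (cyl_U_mean VH EH \<nu> \<omega> n) / real n) sequentially"
      using eventually_ge_at_top[of 1]
      by eventually_elim (simp add: mean_real(3)[OF cw] card_cyl field_simps)
    ultimately show "(\<lambda>n. integral\<^sup>L (M n) (cyl_U_mean VH EH \<nu> \<omega> n) / real n) \<longlonglongrightarrow> h - 2 * a"
      by (rule Lim_transform_eventually)
  qed
  have ii: "tendsto_in_prob M (\<lambda>n x. cyl_U_quenched_var VH EH \<nu> \<omega> n x / real n) ((sqrt (4 * b))\<^sup>2)"
    if cw: "cylinder_weights VH EH N W M \<nu> \<omega>" for M :: "nat \<Rightarrow> 'w measure" and \<nu> \<omega>
  proof (rule tendsto_in_prob_variance[where K = "16 * L"])
    fix n :: nat assume n: "1 \<le> n"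
    show "prob_space (M n)" by (rule prob_M[OF cw n])
    show "cyl_U_quenched_var VH EH \<nu> \<omega> n \<in> borel_measurable (M n)" by (rule var_real(1)[OF cw n])
    show "integrable (M n) (\<lambda>x. (cyl_U_quenched_var VH EH \<nu> \<omega> n x)\<^sup>2)" by (rule var_real(2)[OF cw n])
    show "prob_space.variance (M n) (cyl_U_quenched_var VH EH \<nu> \<omega> n) \<le> 16 * L * real n"
      unfolding var_real(4)[OF cw n] using L[OF n] by simp
  next
    have "(\<lambda>n. 4 * (expectation (?v n) / real n)) \<longlonglongrightarrow> 4 * b" by (intro tendsto_intros b)
    moreover have "eventually (\<lambda>n. 4 * (expectation (?v n) / real n)
        = integral\<^sup>L (M n) (cyl_U_quenched_var VH EH \<nu> \<omega> n) / real n) sequentially"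
      using eventually_ge_at_top[of 1] by eventually_elim (simp add: var_real(3)[OF cw])
    ultimately have "(\<lambda>n. integral\<^sup>L (M n) (cyl_U_quenched_var VH EH \<nu> \<omega> n) / real n) \<longlonglongrightarrow> 4 * b"
      by (rule Lim_transform_eventually)
    then show "(\<lambda>n. integral\<^sup>L (M n) (cyl_U_quenched_var VH EH \<nu> \<omega> n) / real n) \<longlonglongrightarrow> (sqrt (4 * b))\<^sup>2"
      using b0 by simp
  qed
  have iii: "(\<lambda>n. prob_space.variance (M n) (cyl_U_mean VH EH \<nu> \<omega> n) / real n) \<longlonglongrightarrow> (sqrt (4 * s))\<^sup>2"
    if cw: "cylinder_weights VH EH N W M \<nu> \<omega>" for M :: "nat \<Rightarrow> 'w measure" and \<nu> \<omega>
  proof -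
    have "(\<lambda>n. 4 * (variance (?f n) / real n)) \<longlonglongrightarrow> 4 * s" by (intro tendsto_intros s)
    moreover have "eventually (\<lambda>n. 4 * (variance (?f n) / real n)
        = prob_space.variance (M n) (cyl_U_mean VH EH \<nu> \<omega> n) / real n) sequentially"
      using eventually_ge_at_top[of 1] by eventually_elim (simp only: mean_real(4)[OF cw], simp)
    ultimately have "(\<lambda>n. prob_space.variance (M n) (cyl_U_mean VH EH \<nu> \<omega> n) / real n) \<longlonglongrightarrow> 4 * s"
      by (rule Lim_transform_eventually)
    then show ?thesis using s0 by simp
  qed
  have iv: "0 < sqrt (4 * s)"
    if cw: "cylinder_weights VH EH N W M \<nu> \<omega>"
      and cs: "compactly_supported N" "compactly_supported W"
      and deg: "\<not> (degenerate N \<and> degenerate W)" and small: "small_edge_weights VH EH M \<nu> \<omega>"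
    for M :: "nat \<Rightarrow> 'w measure" and \<nu> \<omega>
  proof -
    obtain K\<^sub>1 K\<^sub>2 where K12: "AE x in N. \<bar>x\<bar> \<le> K\<^sub>1" "AE x in W. \<bar>x\<bar> \<le> K\<^sub>2"
      using compactly_supported_AE cs by metis
    define K' where "K' = max K\<^sub>1 K\<^sub>2"
    have K': "AE x in N. \<bar>x\<bar> \<le> K'" "AE x in W. \<bar>x\<bar> \<le> K'"
      unfolding K'_def by (rule eventually_mono[OF K12(1)] eventually_mono[OF K12(2)]; simp)+
    obtain c where c: "0 < c" "\<And>n. 2 \<le> n \<Longrightarrow> (AE \<omega> in \<Omega>. tame K' n \<omega>) \<Longrightarrow> c * real n \<le> variance (?f n)"
      using variance_edge_mean_ge[OF K' deg] by blast
    have "eventually (\<lambda>n. c \<le> variance (?f n) / real n) sequentially"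
      using small[unfolded small_edge_weights_def cyl_edges_eq] eventually_ge_at_top[of 2]
    proof eventually_elim
      case (elim n)
      have n: "1 \<le> n" using elim(2) by simp
      have "c * real n \<le> variance (?f n)" by (rule c(2)[OF elim(2) AE_tame[OF rw[OF cw n] n K' elim(1)]])
      then show ?case using elim(2) by (simp add: field_simps)
    qed
    then have "c \<le> s" by (rule tendsto_lowerbound[OF s]) simp
    then show ?thesis using c(1) by simp
  qed
  show ?thesis
  proof (intro conjI)
    show "\<exists>u. 0 \<le> u \<and> u \<le> real (card VH) \<and>
        (\<forall>(M :: nat \<Rightarrow> 'w measure) \<nu> \<omega>. cylinder_weights VH EH N W M \<nu> \<omega> \<longrightarrow>
           tendsto_in_prob M (\<lambda>n x. cyl_U_mean VH EH \<nu> \<omega> n x / real n) u)"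
      using i a0 ah by (intro exI[of _ "h - 2 * a"]) (auto simp: h_def)
    show "\<exists>\<sigma>\<^sub>Q \<sigma>\<^sub>A. 0 < \<sigma>\<^sub>Q \<and> 0 \<le> \<sigma>\<^sub>A \<and>
        (\<forall>(M :: nat \<Rightarrow> 'w measure) \<nu> \<omega>. cylinder_weights VH EH N W M \<nu> \<omega> \<longrightarrow>
           tendsto_in_prob M (\<lambda>n x. cyl_U_quenched_var VH EH \<nu> \<omega> n x / real n) (\<sigma>\<^sub>Q\<^sup>2) \<and>
           (\<lambda>n. prob_space.variance (M n) (cyl_U_mean VH EH \<nu> \<omega> n) / real n) \<longlonglongrightarrow> \<sigma>\<^sub>A\<^sup>2 \<and>
           (compactly_supported N \<and> compactly_supported W \<and>
            \<not> (degenerate N \<and> degenerate W) \<and> small_edge_weights VH EH M \<nu> \<omega> \<longrightarrow>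
              0 < \<sigma>\<^sub>A))"
    \<comment> \<open>The number of unpaired vertices is a constant minus twice the edge count, so
      both variances carry the factor 4.\<close>
    proof (rule exI[of _ "sqrt (4 * b)"], rule exI[of _ "sqrt (4 * s)"], intro conjI allI impI)
      show "0 < sqrt (4 * b)" "0 \<le> sqrt (4 * s)" using b0 s0 by auto
    next
      fix M :: "nat \<Rightarrow> 'w measure" and \<nu> \<omega>
      assume cw: "cylinder_weights VH EH N W M \<nu> \<omega>"
      show "tendsto_in_prob M (\<lambda>n x. cyl_U_quenched_var VH EH \<nu> \<omega> n x / real n) ((sqrt (4 * b))\<^sup>2)"
        by (rule ii[OF cw])
      show "(\<lambda>n. prob_space.variance (M n) (cyl_U_mean VH EH \<nu> \<omega> n) / real n) \<longlonglongrightarrow> (sqrt (4 * s))\<^sup>2"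
        by (rule iii[OF cw])
      assume "compactly_supported N \<and> compactly_supported W \<and>
        \<not> (degenerate N \<and> degenerate W) \<and> small_edge_weights VH EH M \<nu> \<omega>"
      then show "0 < sqrt (4 * s)" by (elim conjE) (rule iv[OF cw])
    qed
  qed
qed

end
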